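(* Let $F=\alpha+\beta$ be a Randers metric on a manifold $M$. Then $F$ is of reversible projective Ricci curvature if and only if it is of square projective Ricci curvature.
   Context: Finsler notions. For a Finsler metric $F$ on an $n$-dimensional manifold $M$, let $g_{ij}=\frac12[F^2]_{y^iy^j}$, $(g^{ij})=(g_{ij})^{-1}$, and $G^i=\frac14 g^{il}\{[F^2]_{x^ky^l}y^k-[F^2]_{x^l}\}$ (spray coefficients). The Riemann curvature is ${R^i}_k=2\frac{\partial G^i}{\partial x^k}-y^j\frac{\partial^2G^i}{\partial x^j\partial y^k}+2G^j\frac{\partial^2G^i}{\partial y^j\partial y^k}-\frac{\partial G^i}{\partial y^j}\frac{\partial G^j}{\partial y^k}$ and $Ric(x,y)={R^i}_i(x,y)$. The Busemann–Hausdorff volume density in local coordinates is $\sigma_{BH}(x)=\mathrm{Vol}(B^n(1))/\mathrm{Vol}\{(y^i)\in\mathbb R^n: F(x,y^i\partial_{x^i})<1\}$ (Euclidean volumes, $B^n(1)$ the unit ball), and the $S$-curvature is $S(x,y)=\frac{\partial G^m}{\partial y^m}-y^m\frac{\partial}{\partial x^m}[\ln\sigma_{BH}]$. The projective Ricci curvature is $$PRic=Ric+\frac{n-1}{n+1}S_{|m}y^m+\frac{n-1}{(n+1)^2}S^2,$$ where "$|$" is the horizontal covariant derivative of the Berwald connection, so $S_{|m}y^m=y^m\frac{\partial S}{\partial x^m}-2G^m\frac{\partial S}{\partial y^m}$. A Randers metric is $F=\alpha+\beta$, where $\alpha=\sqrt{a_{ij}(x)y^iy^j}$ is a Riemannian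 metric and $\beta=b_i(x)y^i$ is a 1-form on $M$ with $\|\beta_x\|_\alpha<1$ for all $x$ (so that $F$ is a Finsler metric). $F$ is of reversible projective Ricci curvature if $PRic(x,y)=PRic(x,-y)$ for all $x\in M$ and $y\in T_xM\setminus\{0\}$. $F$ is of square projective Ricci curvature if $PRic(x,y)$ is quadratic in $y$ for each $x$, i.e. all third-order partial derivatives of $PRic$ with respect to $y$ vanish. *)

theory Defs
  imports "HOL-Analysis.Analysis"
begin

section \<open>Smooth functions and partial derivatives\<close>

text \<open>\<open>Ck_on k S f\<close> and \<open>smooth_on S f\<close> are only used for open \<open>S\<close>. On a finite-dimensional
  domain, differentiability plus \<open>C\<^sup>k\<close> of all directional derivatives is the usual \<open>C\<^sup>k\<^sup>+\<^sup>1\<close>.\<close>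

primrec Ck_on :: "nat \<Rightarrow> 'a::euclidean_space set \<Rightarrow> ('a \<Rightarrow> 'b::real_normed_vector) \<Rightarrow> bool" where
  "Ck_on 0 S f \<longleftrightarrow> continuous_on S f"
| "Ck_on (Suc k) S f \<longleftrightarrow>
     (\<forall>x\<in>S. f differentiable at x) \<and> (\<forall>v. Ck_on k S (\<lambda>x. frechet_derivative f (at x) v))"

definition smooth_on :: "'a::euclidean_space set \<Rightarrow> ('a \<Rightarrow> 'b::real_normed_vector) \<Rightarrow> bool" where
  "smooth_on S f \<longleftrightarrow> (\<forall>k. Ck_on k S f)"

definition pd :: "'n::finite \<Rightarrow> (real^'n \<Rightarrow> real) \<Rightarrow> real^'n \<Rightarrow> real" where
  "pd i f x = deriv (\<lambda>t. f (x + t *\<^sub>R axis i 1)) 0"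


section \<open>Smooth manifolds and tangent vectors\<close>

text \<open>A chart is a domain together with a coordinate map; the values of the map outside the
  domain are irrelevant.\<close>

type_synonym ('m, 'n) chart = "'m set \<times> ('m \<Rightarrow> real^'n)"

definition chart_image :: "('m, 'n::finite) chart \<Rightarrow> (real^'n) set" where
  "chart_image c = snd c ` fst c"

definition chart_inv :: "('m, 'n::finite) chart \<Rightarrow> real^'n \<Rightarrow> 'm" where
  "chart_inv c = inv_into (fst c) (snd c)"

definition transition :: "('m, 'n::finite) chart \<Rightarrow> ('m, 'n) chart \<Rightarrow> real^'n \<Rightarrow> real^'n" where
  "transition c d = snd d \<circ> chart_inv c"

definition smooth_manifold :: "'m topology \<Rightarrow> ('m, 'n::finite) chart set \<Rightarrow> bool" where
  "smooth_manifold M A \<longleftrightarrow>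
     Hausdorff_space M \<and> second_countable M \<and>
     (\<Union>c\<in>A. fst c) = topspace M \<and>
     (\<forall>c\<in>A. openin M (fst c) \<and> open (chart_image c) \<and>
        homeomorphic_map (subtopology M (fst c)) (top_of_set (chart_image c)) (snd c)) \<and>
     (\<forall>c\<in>A. \<forall>d\<in>A. smooth_on (snd c ` (fst c \<inter> fst d)) (transition c d))"

text \<open>A tangent vector at \<open>p\<close> is the family of its coordinate vectors with respect to all charts
  of the atlas around \<open>p\<close>, which are related by the differentials of the transition maps. At all
  other charts the family is \<open>0\<close>, so that a tangent vector is a unique element of the function
  type. The vector space operations are pointwise.\<close>

definition charts_at :: "('m, 'n::finite) chart set \<Rightarrow> 'm \<Rightarrow> ('m, 'n) chart set" where
  "charts_at A p = {c \<in> A. p \<in> fst c}"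

definition tangent_space ::
  "('m, 'n::finite) chart set \<Rightarrow> 'm \<Rightarrow> (('m, 'n) chart \<Rightarrow> real^'n) set" where
  "tangent_space A p = {v.
     (\<forall>c\<in>charts_at A p. \<forall>d\<in>charts_at A p.
        v d = frechet_derivative (transition c d) (at (snd c p)) (v c)) \<and>
     (\<forall>c. c \<notin> charts_at A p \<longrightarrow> v c = 0)}"

text \<open>The tangent vector \<open>y\<^sup>i \<partial>/\<partial>x\<^sup>i\<close> at \<open>p\<close> with coordinates \<open>y\<close> in the chart \<open>c\<close>.\<close>

definition coord_vec ::
  "('m, 'n::finite) chart set \<Rightarrow> ('m, 'n) chart \<Rightarrow> 'm \<Rightarrow> real^'n \<Rightarrow> ('m, 'n) chart \<Rightarrow> real^'n" where
  "coord_vec A c p y = (\<lambda>d.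
     if d \<in> charts_at A p then frechet_derivative (transition c d) (at (snd c p)) y else 0)"

text \<open>A function on the tangent bundle (in particular a Finsler metric) as a function of the
  standard local coordinates \<open>(x, y)\<close> induced by the chart \<open>c\<close>.\<close>

definition coord_rep ::
  "('m, 'n::finite) chart set \<Rightarrow> ('m, 'n) chart \<Rightarrow> ('m \<Rightarrow> (('m, 'n) chart \<Rightarrow> real^'n) \<Rightarrow> real)
    \<Rightarrow> real^'n \<Rightarrow> real^'n \<Rightarrow> real" where
  "coord_rep A c F x y = F (chart_inv c x) (coord_vec A c (chart_inv c x) y)"


section \<open>Randers metrics\<close>

definition riemannian_metric ::
  "('m, 'n::finite) chart set
    \<Rightarrow> ('m \<Rightarrow> (('m, 'n) chart \<Rightarrow> real^'n) \<Rightarrow> (('m, 'n) chart \<Rightarrow> real^'n) \<Rightarrow> real) \<Rightarrow> bool" where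
  "riemannian_metric A a \<longleftrightarrow>
     (\<forall>p. charts_at A p \<noteq> {} \<longrightarrow>
        (\<forall>u\<in>tangent_space A p. \<forall>v\<in>tangent_space A p. a p u v = a p v u) \<and>
        (\<forall>u\<in>tangent_space A p. \<forall>v\<in>tangent_space A p. \<forall>w\<in>tangent_space A p. \<forall>r s.
           a p (\<lambda>d. r *\<^sub>R u d + s *\<^sub>R v d) w = r * a p u w + s * a p v w) \<and>
        (\<forall>v\<in>tangent_space A p. v \<noteq> (\<lambda>d. 0) \<longrightarrow> a p v v > 0)) \<and>
     (\<forall>c\<in>A. \<forall>i j. smooth_on (chart_image c) (\<lambda>x.
        a (chart_inv c x) (coord_vec A c (chart_inv c x) (axis i 1))
          (coord_vec A c (chart_inv c x) (axis j 1))))"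

definition one_form ::
  "('m, 'n::finite) chart set \<Rightarrow> ('m \<Rightarrow> (('m, 'n) chart \<Rightarrow> real^'n) \<Rightarrow> real) \<Rightarrow> bool" where
  "one_form A b \<longleftrightarrow>
     (\<forall>p. charts_at A p \<noteq> {} \<longrightarrow>
        (\<forall>u\<in>tangent_space A p. \<forall>v\<in>tangent_space A p. \<forall>r s.
           b p (\<lambda>d. r *\<^sub>R u d + s *\<^sub>R v d) = r * b p u + s * b p v)) \<and>
     (\<forall>c\<in>A. \<forall>i. smooth_on (chart_image c) (\<lambda>x.
        b (chart_inv c x) (coord_vec A c (chart_inv c x) (axis i 1))))"

definition form_norm ::
  "('m, 'n::finite) chart set
    \<Rightarrow> ('m \<Rightarrow> (('m, 'n) chart \<Rightarrow> real^'n) \<Rightarrow> (('m, 'n) chart \<Rightarrow> real^'n) \<Rightarrow> real)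
    \<Rightarrow> ('m \<Rightarrow> (('m, 'n) chart \<Rightarrow> real^'n) \<Rightarrow> real) \<Rightarrow> 'm \<Rightarrow> real" where
  "form_norm A a b p = (SUP v\<in>tangent_space A p - {\<lambda>d. 0}. \<bar>b p v\<bar> / sqrt (a p v v))"

definition randers_metric ::
  "('m, 'n::finite) chart set \<Rightarrow> ('m \<Rightarrow> (('m, 'n) chart \<Rightarrow> real^'n) \<Rightarrow> real) \<Rightarrow> bool" where
  "randers_metric A F \<longleftrightarrow>
     (\<exists>a b. riemannian_metric A a \<and> one_form A b \<and>
        (\<forall>p. charts_at A p \<noteq> {} \<longrightarrow>
           form_norm A a b p < 1 \<and>
           (\<forall>v\<in>tangent_space A p. F p v = sqrt (a p v v) + b p v)))"


section \<open>Curvatures of a Finsler metric in local coordinates\<close>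

text \<open>Throughout, \<open>F x y\<close> is a Finsler metric in the local coordinates \<open>(x, y)\<close>.\<close>

definition fundamental_tensor ::
  "(real^'n \<Rightarrow> real^'n \<Rightarrow> real) \<Rightarrow> real^'n \<Rightarrow> real^'n \<Rightarrow> real^'n^'n::finite" where
  "fundamental_tensor F x y = (\<chi> i j. 1/2 * pd j (pd i (\<lambda>y. (F x y)\<^sup>2)) y)"

definition spray_coeff ::
  "(real^'n \<Rightarrow> real^'n \<Rightarrow> real) \<Rightarrow> 'n::finite \<Rightarrow> real^'n \<Rightarrow> real^'n \<Rightarrow> real" where
  "spray_coeff F i x y = 1/4 * (\<Sum>l\<in>UNIV. matrix_inv (fundamental_tensor F x y) $ i $ l *
     ((\<Sum>k\<in>UNIV. pd l (\<lambda>y. pd k (\<lambda>x. (F x y)\<^sup>2) x) y * y $ k) - pd l (\<lambda>x. (F x y)\<^sup>2) x))"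

definition riemann_curvature ::
  "(real^'n \<Rightarrow> real^'n \<Rightarrow> real) \<Rightarrow> 'n::finite \<Rightarrow> 'n \<Rightarrow> real^'n \<Rightarrow> real^'n \<Rightarrow> real" where
  "riemann_curvature F i k x y = (let G = spray_coeff F in
     2 * pd k (\<lambda>x. G i x y) x
     - (\<Sum>j\<in>UNIV. y $ j * pd j (\<lambda>x. pd k (\<lambda>y. G i x y) y) x)
     + 2 * (\<Sum>j\<in>UNIV. G j x y * pd j (pd k (\<lambda>y. G i x y)) y)
     - (\<Sum>j\<in>UNIV. pd j (\<lambda>y. G i x y) y * pd k (\<lambda>y. G j x y) y))"

definition ricci_curvature ::
  "(real^'n \<Rightarrow> real^'n \<Rightarrow> real) \<Rightarrow> real^'n \<Rightarrow> real^'n::finite \<Rightarrow> real" where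
  "ricci_curvature F x y = (\<Sum>i\<in>UNIV. riemann_curvature F i i x y)"

definition BH_density :: "(real^'n \<Rightarrow> real^'n \<Rightarrow> real) \<Rightarrow> real^'n::finite \<Rightarrow> real" where
  "BH_density F x = measure lebesgue (ball (0::real^'n) 1) / measure lebesgue {y. F x y < 1}"

definition S_curvature ::
  "(real^'n \<Rightarrow> real^'n \<Rightarrow> real) \<Rightarrow> real^'n \<Rightarrow> real^'n::finite \<Rightarrow> real" where
  "S_curvature F x y = (\<Sum>m\<in>UNIV. pd m (\<lambda>y. spray_coeff F m x y) y)
     - (\<Sum>m\<in>UNIV. y $ m * pd m (\<lambda>x. ln (BH_density F x)) x)"

text \<open>The term \<open>S\<^sub>|\<^sub>m y\<^sup>m\<close>: the horizontal covariant derivative of \<open>S\<close> with respect to the Berwald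
  connection, contracted with \<open>y\<close>. The factor \<open>2\<close> comes from \<open>y\<^sup>m \<partial>G\<^sup>l/\<partial>y\<^sup>m = 2 G\<^sup>l\<close>, the homogeneity of the
  spray coefficients.\<close>

definition S_horizontal ::
  "(real^'n \<Rightarrow> real^'n \<Rightarrow> real) \<Rightarrow> real^'n \<Rightarrow> real^'n::finite \<Rightarrow> real" where
  "S_horizontal F x y = (\<Sum>m\<in>UNIV. y $ m * pd m (\<lambda>x. S_curvature F x y) x)
     - 2 * (\<Sum>m\<in>UNIV. spray_coeff F m x y * pd m (\<lambda>y. S_curvature F x y) y)"

definition PRic :: "(real^'n \<Rightarrow> real^'n \<Rightarrow> real) \<Rightarrow> real^'n \<Rightarrow> real^'n::finite \<Rightarrow> real" where
  "PRic F x y = (let n = real CARD('n) in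
     ricci_curvature F x y + (n - 1) / (n + 1) * S_horizontal F x y
     + (n - 1) / (n + 1)\<^sup>2 * (S_curvature F x y)\<^sup>2)"


section \<open>Reversible and square projective Ricci curvature\<close>

text \<open>The projective Ricci curvature at a tangent vector is defined through local coordinates;
  both conditions are required in every chart of the atlas.\<close>

definition reversible_PRic ::
  "('m, 'n::finite) chart set \<Rightarrow> ('m \<Rightarrow> (('m, 'n) chart \<Rightarrow> real^'n) \<Rightarrow> real) \<Rightarrow> bool" where
  "reversible_PRic A F \<longleftrightarrow>
     (\<forall>c\<in>A. \<forall>p\<in>fst c. \<forall>v\<in>tangent_space A p - {\<lambda>d. 0}.
        PRic (coord_rep A c F) (snd c p) (v c) = PRic (coord_rep A c F) (snd c p) (- v c))"

definition square_PRic ::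
  "('m, 'n::finite) chart set \<Rightarrow> ('m \<Rightarrow> (('m, 'n) chart \<Rightarrow> real^'n) \<Rightarrow> real) \<Rightarrow> bool" where
  "square_PRic A F \<longleftrightarrow>
     (\<forall>c\<in>A. \<forall>p\<in>fst c. \<forall>y. y \<noteq> 0 \<longrightarrow>
        (\<forall>i j k. pd i (pd j (pd k (\<lambda>y. PRic (coord_rep A c F) (snd c p) y))) y = 0))"

end

theory Submission
  imports Defs
begin

text \<open>For a Randers metric \<open>F = \<alpha> + \<beta>\<close> the spray coefficients are \<open>G\<^sup>i = H\<^sup>i + P y\<^sup>i\<close> with
  \<open>H\<^sup>i = A\<^sup>i + \<alpha> T\<^sup>i\<^sub>j y\<^sup>j\<close>, where \<open>A\<close> is the geodesic spray of \<open>\<alpha>\<close> and \<open>T\<close> is the \<open>\<alpha>\<close>-skew endomorphism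
  given by \<open>d\<beta>\<close>. The divergence of \<open>H\<close> is linear in \<open>y\<close>, since \<open>T\<close> is trace-free and skew. As \<open>PRic\<close> with
  respect to a volume form is a projective invariant, the function \<open>P\<close> can be dropped, and \<open>PRic\<close> can be
  computed from \<open>H\<close>. The terms that are neither quadratic nor of the form \<open>\<alpha>\<close> times linear cancel
  because \<open>\<alpha>\<close> is parallel and \<open>T\<close> is skew, so that \<open>PRic = q + \<alpha> \<lambda>\<close> with a quadratic form \<open>q\<close> and a
  linear form \<open>\<lambda>\<close>. Since \<open>\<alpha> \<lambda>\<close> is odd, reversibility means \<open>\<lambda> = 0\<close>. If all third derivatives vanish,
  \<open>\<alpha> \<lambda>\<close> is a polynomial of degree at most two on every line \<open>u + t v\<close> that avoids the origin; comparing
  \<open>t \<rightarrow> \<infinity>\<close> with \<open>t \<rightarrow> - \<infinity>\<close> yields \<open>\<lambda>(v) = 0\<close>. In dimension one there are no such lines, but there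
  \<open>T = 0\<close> and hence \<open>\<lambda> = 0\<close>.

  The volume form enters only through the smoothness of its density, which is seen from the explicit
  volume of the ellipsoid \<open>F < 1\<close>.\<close>

section \<open>Smooth functions\<close>

text \<open>The obstacle is that the true spray contains \<open>P\<close>, a quotient with
  denominator F, whose curvature would have to be expanded to second order. The weights in the
  definition of PRic prevent this: adding P y to a spray adds (n + 1) P to its divergence, and with
  these weights the changes of the Ricci curvature and of the S-terms are opposite.

  Apart from terms killed by skewness, the only singular ones are multiples of 1/\<alpha>. One comes
  from the x-derivative of \<alpha> inside H, the other from the trace of the squared y-Jacobian of
  H, and metric compatibility of the Christoffel symbols makes them equal.

  Since \<open>pd\<close> is total and built on \<open>deriv\<close>, each computation needs
  differentiability as well as a value. Hence partial derivatives are carried with explicit values,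
  and smoothness is kept jointly in (x, y), on a chart times the nonzero vectors.

  The third derivatives of \<alpha> \<lambda> are never computed: their vanishing is integrated back
  along lines.\<close>

lemma Ck_on_cong:
  assumes "open S" "\<And>x. x \<in> S \<Longrightarrow> f x = g x" "Ck_on k S f"
  shows "Ck_on k S g"
  using assms(2,3)
proof (induction k arbitrary: f g)
  case 0
  then show ?case using continuous_on_cong[OF refl, of S f g] by simp
next
  case (Suc k)
  have der: "(g has_derivative frechet_derivative f (at x)) (at x)" if "x \<in> S" for x
  proof (rule has_derivative_transform_within_open[OF _ assms(1) that])
    show "(f has_derivative frechet_derivative f (at x)) (at x)"
      using Suc.prems(2) that by (simp add: frechet_derivative_works)
  qed (rule Suc.prems(1))
  have "Ck_on k S (\<lambda>x. frechet_derivative g (at x) v)" for v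
  proof (rule Suc.IH)
    show "frechet_derivative f (at x) v = frechet_derivative g (at x) v" if "x \<in> S" for x
      using frechet_derivative_at[OF der[OF that]] by simp
    show "Ck_on k S (\<lambda>x. frechet_derivative f (at x) v)"
      using Suc.prems(2) by simp
  qed
  moreover have "g differentiable at x" if "x \<in> S" for x
    using der[OF that] differentiable_def by blast
  ultimately show ?case by simp
qed

lemma Ck_on_SucD: "Ck_on (Suc k) S f \<Longrightarrow> Ck_on k S f"
proof (induction k arbitrary: f)
  case 0
  then show ?case
    by (auto intro!: differentiable_imp_continuous_on
        simp: differentiable_on_def differentiable_at_withinI)
next
  case (Suc k)
  then show ?case by (metis Ck_on.simps(2))
qed

text \<open>Lets each closure rule name its derivative \<open>f'\<close>; uniqueness of the Frechet
  derivative identifies it with the one in the definition of \<open>Ck_on\<close>.\<close>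

lemma Ck_on_SucI:
  assumes "open S" "\<And>x. x \<in> S \<Longrightarrow> (f has_derivative f' x) (at x)" "\<And>v. Ck_on k S (\<lambda>x. f' x v)"
  shows "Ck_on (Suc k) S f"
proof -
  have "f' x v = frechet_derivative f (at x) v" if "x \<in> S" for x v
    using frechet_derivative_at[OF assms(2)[OF that]] by simp
  then have "Ck_on k S (\<lambda>x. frechet_derivative f (at x) v)" for v
    by (rule Ck_on_cong[OF assms(1) _ assms(3)[of v]])
  then show ?thesis using assms(2) by (auto simp: differentiable_def)
qed

lemma Ck_on_SucE:
  assumes "Ck_on (Suc k) S f" "x \<in> S"
  shows "(f has_derivative frechet_derivative f (at x)) (at x)"
  using assms by (simp add: frechet_derivative_works)

lemma Ck_on_const: "open S \<Longrightarrow> Ck_on k S (\<lambda>x. c)"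
  by (induction k arbitrary: c) (auto intro!: Ck_on_SucI[where f' = "\<lambda>x v. 0"] simp del: Ck_on.simps(2))

lemma Ck_on_linear:
  assumes "open S" "bounded_linear f"
  shows "Ck_on k S f"
proof (cases k)
  case 0
  then show ?thesis using assms by (simp add: linear_continuous_on)
next
  case (Suc j)
  show ?thesis unfolding Suc
    by (rule Ck_on_SucI[where f' = "\<lambda>x. f"])
      (use assms in \<open>auto intro!: bounded_linear_imp_has_derivative Ck_on_const\<close>)
qed

lemma Ck_on_add:
  assumes "open S" "Ck_on k S f" "Ck_on k S g"
  shows "Ck_on k S (\<lambda>x. f x + g x)"
  using assms(2,3)
proof (induction k arbitrary: f g)
  case 0
  then show ?case by (simp add: continuous_on_add)
next
  case (Suc k)
  have "Ck_on k S (\<lambda>x. frechet_derivative f (at x) v + frechet_derivative g (at x) v)" for v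
    using Suc.prems by (intro Suc.IH) auto
  then show ?case
    by (rule Ck_on_SucI[OF assms(1) has_derivative_add[OF Ck_on_SucE Ck_on_SucE], rotated -1])
      (use Suc.prems in auto)
qed

lemma Ck_on_mult:
  fixes f g :: "'a::euclidean_space \<Rightarrow> real"
  assumes "open S" "Ck_on k S f" "Ck_on k S g"
  shows "Ck_on k S (\<lambda>x. f x * g x)"
  using assms(2,3)
proof (induction k arbitrary: f g)
  case 0
  then show ?case by (simp add: continuous_on_mult)
next
  case (Suc k)
  have "Ck_on k S (\<lambda>x. f x * frechet_derivative g (at x) v + frechet_derivative f (at x) v * g x)" for v
    using Suc.prems Ck_on_SucD[OF Suc.prems(1)] Ck_on_SucD[OF Suc.prems(2)]
    by (intro Ck_on_add assms(1) Suc.IH) auto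
  then show ?case
    by (rule Ck_on_SucI[OF assms(1) has_derivative_mult[OF Ck_on_SucE Ck_on_SucE], rotated -1])
      (use Suc.prems in auto)
qed

text \<open>The derivative of 1/f contains 1/f again and otherwise only f', so order k of the
  inverse bootstraps to order k + 1. The square root is treated in the same way, whereas the
  derivative of \<open>ln\<close> is free of \<open>ln\<close> and a case distinction suffices
  there.\<close>

lemma Ck_on_inverse:
  fixes f :: "'a::euclidean_space \<Rightarrow> real"
  assumes "open S" "\<And>x. x \<in> S \<Longrightarrow> f x \<noteq> 0" "Ck_on k S f"
  shows "Ck_on k S (\<lambda>x. inverse (f x))"
  using assms(3)
proof (induction k)
  case 0
  then show ?case using assms(2) by (auto intro!: continuous_on_inverse)
next
  case (Suc k)
  then have IH: "Ck_on k S (\<lambda>x. inverse (f x))" using Ck_on_SucD by blast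
  have "Ck_on k S (\<lambda>x. frechet_derivative f (at x) v)" for v
    using Suc.prems by simp
  with IH have "Ck_on k S (\<lambda>x. (-1) * (inverse (f x) * frechet_derivative f (at x) v * inverse (f x)))" for v
    using assms(1) by (intro Ck_on_mult Ck_on_const) auto
  then have *: "Ck_on k S (\<lambda>x. - (inverse (f x) * frechet_derivative f (at x) v * inverse (f x)))" for v
    by simp
  show ?case
    by (rule Ck_on_SucI[OF assms(1) _ *])
      (rule Deriv.has_derivative_inverse[OF assms(2) Ck_on_SucE[OF Suc.prems]], assumption+)
qed

lemma Ck_on_ln:
  fixes f :: "'a::euclidean_space \<Rightarrow> real"
  assumes "open S" "\<And>x. x \<in> S \<Longrightarrow> f x > 0" "Ck_on k S f"
  shows "Ck_on k S (\<lambda>x. ln (f x))"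
proof (cases k)
  case 0
  then show ?thesis using assms by (fastforce intro!: continuous_on_ln)
next
  case (Suc j)
  have "Ck_on j S (\<lambda>x. inverse (f x))"
    using assms Suc Ck_on_SucD Ck_on_inverse by (metis less_irrefl)
  moreover have "Ck_on j S (\<lambda>x. frechet_derivative f (at x) v)" for v
    using assms(3) Suc by simp
  ultimately have *: "Ck_on j S (\<lambda>x. frechet_derivative f (at x) v * inverse (f x))" for v
    using assms(1) by (intro Ck_on_mult) auto
  show ?thesis unfolding Suc
  proof (rule Ck_on_SucI[OF assms(1) _ *])
    fix x assume "x \<in> S"
    then show "((\<lambda>x. ln (f x)) has_derivative (\<lambda>v. frechet_derivative f (at x) v * inverse (f x))) (at x)"
      using assms Suc
      by (auto intro!: derivative_eq_intros Ck_on_SucE simp: field_simps simp del: Ck_on.simps(2))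
  qed
qed

lemma Ck_on_sqrt:
  fixes f :: "'a::euclidean_space \<Rightarrow> real"
  assumes "open S" "\<And>x. x \<in> S \<Longrightarrow> f x > 0" "Ck_on k S f"
  shows "Ck_on k S (\<lambda>x. sqrt (f x))"
  using assms(3)
proof (induction k)
  case 0
  then show ?case by (auto intro!: continuous_on_real_sqrt)
next
  case (Suc k)
  then have "Ck_on k S (\<lambda>x. sqrt (f x))" using Ck_on_SucD by blast
  then have "Ck_on k S (\<lambda>x. inverse (sqrt (f x)))"
    using assms(1,2) by (intro Ck_on_inverse) (auto dest: less_imp_neq[OF assms(2)])
  moreover have "Ck_on k S (\<lambda>x. frechet_derivative f (at x) v)" for v
    using Suc.prems by simp
  ultimately have *: "Ck_on k S (\<lambda>x. frechet_derivative f (at x) v * (inverse (sqrt (f x)) * (1/2)))" for v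
    using assms(1) by (intro Ck_on_mult Ck_on_const) auto
  show ?case
  proof (rule Ck_on_SucI[OF assms(1) _ *])
    fix x assume "x \<in> S"
    then show "((\<lambda>x. sqrt (f x)) has_derivative (\<lambda>v. frechet_derivative f (at x) v * (inverse (sqrt (f x)) * (1/2)))) (at x)"
      using assms(1,2) Suc
      by (auto intro!: derivative_eq_intros Ck_on_SucE simp: field_simps simp del: Ck_on.simps(2))
  qed
qed

text \<open>For linear \<open>L\<close> the direction \<open>L v\<close> does not depend on the
  point, so the derivative of the composite is again a composite with \<open>L\<close> and the
  induction closes. The use is with \<open>L = fst\<close>, which turns functions of x into
  functions of (x, y).\<close>

lemma Ck_on_compose_linear:
  assumes "open S" "open T" "bounded_linear L" "\<And>x. x \<in> T \<Longrightarrow> L x \<in> S" "Ck_on k S f"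
  shows "Ck_on k T (\<lambda>x. f (L x))"
  using assms(5)
proof (induction k arbitrary: f)
  case 0
  show ?case
    using continuous_on_compose2[of S f T L] linear_continuous_on[OF assms(3), of T] 0 assms(4) by auto
next
  case (Suc k)
  have *: "Ck_on k T (\<lambda>x. frechet_derivative f (at (L x)) (L v))" for v
    using Suc.IH[of "\<lambda>x. frechet_derivative f (at x) (L v)"] Suc.prems by simp
  show ?case
  proof (rule Ck_on_SucI[OF assms(2) _ *])
    fix x assume "x \<in> T"
    then have "(f has_derivative frechet_derivative f (at (L x))) (at (L x))"
      using Ck_on_SucE[OF Suc.prems] assms(4) by blast
    from has_derivative_compose[OF bounded_linear_imp_has_derivative[OF assms(3)] this]
    show "((\<lambda>x. f (L x)) has_derivative (\<lambda>v. frechet_derivative f (at (L x)) (L v))) (at x)" .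
  qed
qed

lemma smooth_on_cong:
  "open S \<Longrightarrow> (\<And>x. x \<in> S \<Longrightarrow> f x = g x) \<Longrightarrow> smooth_on S f \<Longrightarrow> smooth_on S g"
  unfolding smooth_on_def using Ck_on_cong by blast

lemma smooth_on_const: "open S \<Longrightarrow> smooth_on S (\<lambda>x. c)"
  by (simp add: smooth_on_def Ck_on_const)

lemma smooth_on_linear: "open S \<Longrightarrow> bounded_linear f \<Longrightarrow> smooth_on S f"
  by (simp add: smooth_on_def Ck_on_linear)

lemma smooth_on_add:
  "open S \<Longrightarrow> smooth_on S f \<Longrightarrow> smooth_on S g \<Longrightarrow> smooth_on S (\<lambda>x. f x + g x)"
  by (simp add: smooth_on_def Ck_on_add)

lemma smooth_on_mult:
  fixes f g :: "'a::euclidean_space \<Rightarrow> real"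
  shows "open S \<Longrightarrow> smooth_on S f \<Longrightarrow> smooth_on S g \<Longrightarrow> smooth_on S (\<lambda>x. f x * g x)"
  by (simp add: smooth_on_def Ck_on_mult)

lemma smooth_on_diff:
  fixes f g :: "'a::euclidean_space \<Rightarrow> real"
  assumes "open S" "smooth_on S f" "smooth_on S g"
  shows "smooth_on S (\<lambda>x. f x - g x)"
  using smooth_on_add[OF assms(1,2) smooth_on_mult[OF assms(1) smooth_on_const[OF assms(1), of "-1"] assms(3)]]
  by simp

lemma smooth_on_divide:
  fixes f g :: "'a::euclidean_space \<Rightarrow> real"
  assumes "open S" "smooth_on S f" "smooth_on S g" "\<And>x. x \<in> S \<Longrightarrow> g x \<noteq> 0"
  shows "smooth_on S (\<lambda>x. f x / g x)"
  using assms unfolding divide_inverse by (auto simp: smooth_on_def intro!: Ck_on_mult Ck_on_inverse)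

lemma smooth_on_ln:
  fixes f :: "'a::euclidean_space \<Rightarrow> real"
  shows "open S \<Longrightarrow> smooth_on S f \<Longrightarrow> (\<And>x. x \<in> S \<Longrightarrow> f x > 0) \<Longrightarrow> smooth_on S (\<lambda>x. ln (f x))"
  by (simp add: smooth_on_def Ck_on_ln)

lemma smooth_on_sqrt:
  fixes f :: "'a::euclidean_space \<Rightarrow> real"
  shows "open S \<Longrightarrow> smooth_on S f \<Longrightarrow> (\<And>x. x \<in> S \<Longrightarrow> f x > 0) \<Longrightarrow> smooth_on S (\<lambda>x. sqrt (f x))"
  by (simp add: smooth_on_def Ck_on_sqrt)

lemma smooth_on_sum:
  "open S \<Longrightarrow> (\<And>i. i \<in> I \<Longrightarrow> smooth_on S (f i)) \<Longrightarrow> smooth_on S (\<lambda>x. \<Sum>i\<in>I. f i x)"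
  by (induction I rule: infinite_finite_induct) (auto intro!: smooth_on_const smooth_on_add)

lemma smooth_on_prod:
  fixes f :: "'i \<Rightarrow> 'a::euclidean_space \<Rightarrow> real"
  shows "open S \<Longrightarrow> (\<And>i. i \<in> I \<Longrightarrow> smooth_on S (f i)) \<Longrightarrow> smooth_on S (\<lambda>x. \<Prod>i\<in>I. f i x)"
  by (induction I rule: infinite_finite_induct) (auto intro!: smooth_on_const smooth_on_mult)

lemma smooth_on_compose_linear:
  assumes "open S" "open T" "bounded_linear L" "\<And>x. x \<in> T \<Longrightarrow> L x \<in> S" "smooth_on S f"
  shows "smooth_on T (\<lambda>x. f (L x))"
  using assms(5) Ck_on_compose_linear[OF assms(1-4)] unfolding smooth_on_def by blast

lemma smooth_on_has_derivative:
  "smooth_on S f \<Longrightarrow> x \<in> S \<Longrightarrow> (f has_derivative frechet_derivative f (at x)) (at x)"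
  unfolding smooth_on_def using Ck_on_SucE by blast

lemma smooth_on_frechet_derivative:
  "smooth_on S f \<Longrightarrow> smooth_on S (\<lambda>x. frechet_derivative f (at x) v)"
  unfolding smooth_on_def by (metis Ck_on.simps(2))

lemma smooth_on_det:
  fixes h :: "'a::euclidean_space \<Rightarrow> real^'n^'n"
  assumes "open S" "\<And>i j. smooth_on S (\<lambda>x. h x $ i $ j)"
  shows "smooth_on S (\<lambda>x. det (h x))"
  unfolding det_def using assms by (intro smooth_on_sum smooth_on_mult smooth_on_prod smooth_on_const)

lemma matrix_inv_mult:
  fixes A :: "real^'n^'n"
  assumes "invertible A"
  shows "A ** matrix_inv A = mat 1" "matrix_inv A ** A = mat 1"
  using someI_ex[OF assms[unfolded invertible_def]] unfolding matrix_inv_def by blast+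

text \<open>Cramer's rule writes the solution of the linear system as a quotient of determinants,
  which are polynomials in the entries.\<close>

lemma smooth_on_matrix_inv_mult:
  fixes h :: "'a::euclidean_space \<Rightarrow> real^'n^'n" and v :: "'a \<Rightarrow> real^'n"
  assumes "open S" "\<And>i j. smooth_on S (\<lambda>x. h x $ i $ j)" "\<And>i. smooth_on S (\<lambda>x. v x $ i)"
    and "\<And>x. x \<in> S \<Longrightarrow> det (h x) \<noteq> 0"
  shows "smooth_on S (\<lambda>x. (matrix_inv (h x) *v v x) $ k)"
proof -
  have eq: "(matrix_inv (h x) *v v x) $ k
      = det (\<chi> i j. if j = k then v x $ i else h x $ i $ j) / det (h x)" if "x \<in> S" for x
  proof -
    have "h x *v (matrix_inv (h x) *v v x) = v x"
      using assms(4)[OF that]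
      by (simp add: matrix_vector_mul_assoc matrix_inv_mult invertible_det_nz)
    then show ?thesis unfolding cramer[OF assms(4)[OF that]] by simp
  qed
  have "smooth_on S (\<lambda>x. if j = k then v x $ i else h x $ i $ j)" for i j
    using assms(2,3) by (cases "j = k") auto
  then have "smooth_on S (\<lambda>x. det (\<chi> i j. if j = k then v x $ i else h x $ i $ j) / det (h x))"
    using assms by (intro smooth_on_divide smooth_on_det) auto
  then show ?thesis by (rule smooth_on_cong[OF assms(1), rotated]) (rule eq[symmetric])
qed

lemma smooth_on_matrix_inv:
  fixes h :: "'a::euclidean_space \<Rightarrow> real^'n^'n"
  assumes "open S" "\<And>i j. smooth_on S (\<lambda>x. h x $ i $ j)" "\<And>x. x \<in> S \<Longrightarrow> det (h x) \<noteq> 0"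
  shows "smooth_on S (\<lambda>x. matrix_inv (h x) $ k $ l)"
proof -
  have "(matrix_inv (h x) *v axis l 1) $ k = matrix_inv (h x) $ k $ l" for x
    by (simp add: matrix_vector_mult_basis column_def)
  then show ?thesis
    using smooth_on_matrix_inv_mult[of S h "\<lambda>x. axis l 1" k] assms smooth_on_const by fastforce
qed

section \<open>Partial derivatives with explicit values\<close>

text \<open>Couples the value of a partial derivative with its existence, so that sum, product and
  quotient rules hold without side conditions on differentiability.\<close>

definition has_pd :: "(real^'n::finite \<Rightarrow> real) \<Rightarrow> real \<Rightarrow> 'n \<Rightarrow> real^'n \<Rightarrow> bool" where
  "has_pd f D i x \<longleftrightarrow> ((\<lambda>t. f (x + t *\<^sub>R axis i 1)) has_field_derivative D) (at 0)"

lemma has_pd_imp_pd: "has_pd f D i x \<Longrightarrow> pd i f x = D"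
  by (simp add: has_pd_def pd_def DERIV_imp_deriv)

lemma has_pd_const: "has_pd (\<lambda>x. c) 0 i x"
  by (simp add: has_pd_def)

lemma has_pd_nth: "has_pd (\<lambda>x. x $ j) (if i = j then 1 else 0) i x"
  unfolding has_pd_def by (auto intro!: derivative_eq_intros simp: axis_def)

lemma has_pd_add: "has_pd f D i x \<Longrightarrow> has_pd g E i x \<Longrightarrow> has_pd (\<lambda>x. f x + g x) (D + E) i x"
  unfolding has_pd_def by (rule DERIV_add)

lemma has_pd_diff: "has_pd f D i x \<Longrightarrow> has_pd g E i x \<Longrightarrow> has_pd (\<lambda>x. f x - g x) (D - E) i x"
  unfolding has_pd_def by (rule DERIV_diff)

lemma has_pd_mult:
  "has_pd f D i x \<Longrightarrow> has_pd g E i x \<Longrightarrow> has_pd (\<lambda>x. f x * g x) (D * g x + E * f x) i x"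
  unfolding has_pd_def by (drule (1) DERIV_mult) simp

lemma has_pd_cmult: "has_pd f D i x \<Longrightarrow> has_pd (\<lambda>x. c * f x) (c * D) i x"
  unfolding has_pd_def by (rule DERIV_cmult)

lemma has_pd_divide:
  "has_pd f D i x \<Longrightarrow> has_pd g E i x \<Longrightarrow> g x \<noteq> 0 \<Longrightarrow>
    has_pd (\<lambda>x. f x / g x) ((D * g x - f x * E) / (g x * g x)) i x"
  unfolding has_pd_def by (drule (1) DERIV_divide) simp_all

lemma has_pd_sqrt:
  "has_pd f D i x \<Longrightarrow> f x > 0 \<Longrightarrow> has_pd (\<lambda>x. sqrt (f x)) (D / (2 * sqrt (f x))) i x"
  unfolding has_pd_def by (auto intro!: derivative_eq_intros simp: field_simps)

lemma has_pd_sum: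
  "(\<And>j. j \<in> I \<Longrightarrow> has_pd (f j) (D j) i x) \<Longrightarrow> has_pd (\<lambda>x. \<Sum>j\<in>I. f j x) (\<Sum>j\<in>I. D j) i x"
  unfolding has_pd_def by (rule DERIV_sum)

lemma eventually_along_axis:
  fixes x :: "real^'n"
  assumes "open S" "x \<in> S"
  shows "\<forall>\<^sub>F t in nhds 0. x + t *\<^sub>R axis i 1 \<in> S"
proof -
  have "((\<lambda>t. x + t *\<^sub>R axis i 1) \<longlongrightarrow> x + 0 *\<^sub>R axis i 1) (nhds 0)"
    by (intro tendsto_intros filterlim_ident)
  then show ?thesis using assms by (simp add: topological_tendstoD)
qed

text \<open>A derivative sees only the germ at the point. Formulas that are known only inside a
  chart or away from y = 0 can therefore be differentiated there.\<close>

lemma pd_cong: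
  assumes "open S" "x \<in> S" "\<And>z. z \<in> S \<Longrightarrow> f z = g z"
  shows "pd i f x = pd i g x"
  unfolding pd_def
  by (rule deriv_cong_ev) (use eventually_along_axis[OF assms(1,2), of i] assms(3) in \<open>auto elim: eventually_mono\<close>)

lemma has_derivative_imp_has_pd:
  assumes "(f has_derivative f') (at x)"
  shows "has_pd f (f' (axis i 1)) i x"
proof -
  have "((\<lambda>t::real. x + t *\<^sub>R axis i 1) has_derivative (\<lambda>t. t *\<^sub>R axis i 1)) (at 0)"
    by (auto intro!: derivative_eq_intros)
  moreover have "(f has_derivative f') (at (x + 0 *\<^sub>R axis i 1))" using assms by simp
  ultimately have "((\<lambda>t. f (x + t *\<^sub>R axis i 1)) has_derivative (\<lambda>t. f' (t *\<^sub>R axis i 1))) (at 0)"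
    by (rule has_derivative_compose)
  moreover have "f' (t *\<^sub>R axis i 1) = t * f' (axis i 1)" for t
    using has_derivative_linear[OF assms] by (simp add: linear_cmul)
  moreover have "(\<lambda>t. t * f' (axis i 1)) = (*) (f' (axis i 1))"
    by (rule ext) (rule mult.commute)
  ultimately show ?thesis
    unfolding has_pd_def has_field_derivative_def by simp
qed

lemma smooth_on_has_pd:
  assumes "smooth_on S f" "x \<in> S"
  shows "has_pd f (pd i f x) i x"
  using has_derivative_imp_has_pd[OF smooth_on_has_derivative[OF assms], of i] has_pd_imp_pd by metis

lemma smooth_on_pd:
  fixes f :: "real^'n \<Rightarrow> real"
  assumes "open S" "smooth_on S f"
  shows "smooth_on S (pd i f)"
  by (rule smooth_on_cong[OF assms(1) _ smooth_on_frechet_derivative[OF assms(2), of "axis i 1"]])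
    (metis has_derivative_imp_has_pd smooth_on_has_derivative has_pd_imp_pd assms(2))

lemma smooth_on_has_derivative_pd:
  fixes f :: "real^'n \<Rightarrow> real"
  assumes "smooth_on S f" "x \<in> S"
  shows "(f has_derivative (\<lambda>v. \<Sum>i\<in>UNIV. v $ i * pd i f x)) (at x)"
proof -
  let ?f' = "frechet_derivative f (at x)"
  have d: "(f has_derivative ?f') (at x)" by (rule smooth_on_has_derivative[OF assms])
  have "?f' v = (\<Sum>i\<in>UNIV. v $ i * pd i f x)" for v
  proof -
    have "?f' v = ?f' (\<Sum>i\<in>UNIV. (v $ i) *\<^sub>R axis i 1)"
      by (simp add: basis_expansion scalar_mult_eq_scaleR[symmetric])
    also have "\<dots> = (\<Sum>i\<in>UNIV. v $ i * ?f' (axis i 1))"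
      using has_derivative_linear[OF d] by (simp add: linear_sum linear_cmul)
    finally show ?thesis using has_pd_imp_pd[OF has_derivative_imp_has_pd[OF d]] by simp
  qed
  then show ?thesis using d by presburger
qed

section \<open>Joint smoothness in position and direction\<close>

definition smooth2_on :: "(real^'n::finite) set \<Rightarrow> (real^'n) set \<Rightarrow> (real^'n \<Rightarrow> real^'n \<Rightarrow> real) \<Rightarrow> bool" where
  "smooth2_on U V f \<longleftrightarrow> smooth_on (U \<times> V) (\<lambda>z. f (fst z) (snd z))"

text \<open>Evaluating the joint derivative on a vector supported in one factor gives the partial
  derivative in that factor; in this form the partial derivatives in y are seen to be jointly smooth
  again.\<close>

lemma smooth2_on_pd:
  assumes "smooth2_on U V f" "x \<in> U" "y \<in> V"
  shows "has_pd (\<lambda>x. f x y) (pd i (\<lambda>x. f x y) x) i x" "has_pd (f x) (pd i (f x) y) i y"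
    "pd i (\<lambda>x. f x y) x = frechet_derivative (\<lambda>z. f (fst z) (snd z)) (at (x, y)) (axis i 1, 0)"
    "pd i (f x) y = frechet_derivative (\<lambda>z. f (fst z) (snd z)) (at (x, y)) (0, axis i 1)"
proof -
  define f' where "f' = frechet_derivative (\<lambda>z. f (fst z) (snd z)) (at (x, y))"
  have f': "((\<lambda>z. f (fst z) (snd z)) has_derivative f') (at (x, y))"
    unfolding f'_def using smooth_on_has_derivative[of "U \<times> V" _ "(x, y)"] assms
    by (simp add: smooth2_on_def)
  have "((\<lambda>x. (x, y)) has_derivative (\<lambda>v. (v, 0))) (at x)"
    by (auto intro!: derivative_eq_intros)
  from has_derivative_compose[OF this f']
  have x: "has_pd (\<lambda>x. f x y) (f' (axis i 1, 0)) i x"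
    using has_derivative_imp_has_pd by fastforce
  have "((\<lambda>y. (x, y)) has_derivative (\<lambda>v. (0, v))) (at y)"
    by (auto intro!: derivative_eq_intros)
  from has_derivative_compose[OF this f']
  have y: "has_pd (f x) (f' (0, axis i 1)) i y"
    using has_derivative_imp_has_pd by fastforce
  show "has_pd (\<lambda>x. f x y) (pd i (\<lambda>x. f x y) x) i x" "has_pd (f x) (pd i (f x) y) i y"
    "pd i (\<lambda>x. f x y) x = frechet_derivative (\<lambda>z. f (fst z) (snd z)) (at (x, y)) (axis i 1, 0)"
    "pd i (f x) y = frechet_derivative (\<lambda>z. f (fst z) (snd z)) (at (x, y)) (0, axis i 1)"
    using x y has_pd_imp_pd[OF x] has_pd_imp_pd[OF y] by (simp_all add: f'_def)
qed

lemma smooth2_on_pd_snd: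
  assumes "open U" "open V" "smooth2_on U V f"
  shows "smooth2_on U V (\<lambda>x y. pd i (f x) y)"
  unfolding smooth2_on_def
  by (rule smooth_on_cong[OF open_Times[OF assms(1,2)] _
        smooth_on_frechet_derivative[OF assms(3)[unfolded smooth2_on_def], of "(0, axis i 1)"]])
    (use smooth2_on_pd(4)[OF assms(3)] in auto)

lemma smooth2_on_const1:
  assumes "open U" "open V" "smooth_on U f"
  shows "smooth2_on U V (\<lambda>x y. f x)"
  unfolding smooth2_on_def
  by (rule smooth_on_compose_linear[OF assms(1) open_Times[OF assms(1,2)] bounded_linear_fst _ assms(3)])
    auto

lemma smooth2_on_nth:
  assumes "open U" "open V"
  shows "smooth2_on U V (\<lambda>x y. y $ i)"
  unfolding smooth2_on_def
  by (rule smooth_on_linear[OF open_Times[OF assms(1,2)]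
        bounded_linear_compose[OF bounded_linear_vec_nth bounded_linear_snd]])

lemma smooth2_on_const: "open U \<Longrightarrow> open V \<Longrightarrow> smooth2_on U V (\<lambda>x y. c)"
  unfolding smooth2_on_def by (simp add: smooth_on_const open_Times)

lemma smooth2_on_add:
  "open U \<Longrightarrow> open V \<Longrightarrow> smooth2_on U V f \<Longrightarrow> smooth2_on U V g \<Longrightarrow> smooth2_on U V (\<lambda>x y. f x y + g x y)"
  unfolding smooth2_on_def by (simp add: smooth_on_add open_Times)

lemma smooth2_on_diff:
  "open U \<Longrightarrow> open V \<Longrightarrow> smooth2_on U V f \<Longrightarrow> smooth2_on U V g \<Longrightarrow> smooth2_on U V (\<lambda>x y. f x y - g x y)"
  unfolding smooth2_on_def by (simp add: smooth_on_diff open_Times)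

lemma smooth2_on_mult:
  "open U \<Longrightarrow> open V \<Longrightarrow> smooth2_on U V f \<Longrightarrow> smooth2_on U V g \<Longrightarrow> smooth2_on U V (\<lambda>x y. f x y * g x y)"
  unfolding smooth2_on_def by (simp add: smooth_on_mult open_Times)

lemma smooth2_on_divide:
  "open U \<Longrightarrow> open V \<Longrightarrow> smooth2_on U V f \<Longrightarrow> smooth2_on U V g \<Longrightarrow>
    (\<And>x y. x \<in> U \<Longrightarrow> y \<in> V \<Longrightarrow> g x y \<noteq> 0) \<Longrightarrow> smooth2_on U V (\<lambda>x y. f x y / g x y)"
  unfolding smooth2_on_def by (rule smooth_on_divide) (auto simp: open_Times)

lemma smooth2_on_sqrt:
  "open U \<Longrightarrow> open V \<Longrightarrow> smooth2_on U V f \<Longrightarrow>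
    (\<And>x y. x \<in> U \<Longrightarrow> y \<in> V \<Longrightarrow> f x y > 0) \<Longrightarrow> smooth2_on U V (\<lambda>x y. sqrt (f x y))"
  unfolding smooth2_on_def by (rule smooth_on_sqrt) (auto simp: open_Times)

lemma smooth2_on_sum:
  "open U \<Longrightarrow> open V \<Longrightarrow> (\<And>i. i \<in> I \<Longrightarrow> smooth2_on U V (f i)) \<Longrightarrow> smooth2_on U V (\<lambda>x y. \<Sum>i\<in>I. f i x y)"
  unfolding smooth2_on_def by (rule smooth_on_sum) (auto simp: open_Times)

section \<open>Projective invariance\<close>

text \<open>This and the next definitions take arbitrary spray coefficients instead of a metric,
  because they are also applied to \<open>H\<close>, which is not introduced as the spray of a
  metric.\<close>

definition spray_div ::
  "('n \<Rightarrow> real^'n \<Rightarrow> real^'n \<Rightarrow> real) \<Rightarrow> real^'n \<Rightarrow> real^'n::finite \<Rightarrow> real" where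
  "spray_div G x y = (\<Sum>i\<in>UNIV. pd i (G i x) y)"

definition spray_ricci ::
  "('n \<Rightarrow> real^'n \<Rightarrow> real^'n \<Rightarrow> real) \<Rightarrow> real^'n \<Rightarrow> real^'n::finite \<Rightarrow> real" where
  "spray_ricci G x y = (\<Sum>i\<in>UNIV. 2 * pd i (\<lambda>x. G i x y) x
     - (\<Sum>j\<in>UNIV. y $ j * pd j (\<lambda>x. pd i (G i x) y) x)
     + 2 * (\<Sum>j\<in>UNIV. G j x y * pd j (pd i (G i x)) y)
     - (\<Sum>j\<in>UNIV. pd j (G i x) y * pd i (G j x) y))"

text \<open>The form \<open>c\<close> plays the role of \<open>d (ln \<sigma>)\<close>.\<close>

definition spray_S ::
  "('n \<Rightarrow> real^'n \<Rightarrow> real^'n \<Rightarrow> real) \<Rightarrow> ('n \<Rightarrow> real^'n \<Rightarrow> real)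
    \<Rightarrow> real^'n \<Rightarrow> real^'n::finite \<Rightarrow> real" where
  "spray_S G c x y = spray_div G x y - (\<Sum>m\<in>UNIV. y $ m * c m x)"

definition spray_PRic ::
  "('n \<Rightarrow> real^'n \<Rightarrow> real^'n \<Rightarrow> real) \<Rightarrow> ('n \<Rightarrow> real^'n \<Rightarrow> real)
    \<Rightarrow> real^'n \<Rightarrow> real^'n::finite \<Rightarrow> real" where
  "spray_PRic G c x y = spray_ricci G x y
     + (real CARD('n) - 1) / (real CARD('n) + 1) *
       ((\<Sum>m\<in>UNIV. y $ m * pd m (\<lambda>x. spray_S G c x y) x)
        - 2 * (\<Sum>m\<in>UNIV. G m x y * pd m (spray_S G c x) y))
     + (real CARD('n) - 1) / (real CARD('n) + 1)\<^sup>2 * (spray_S G c x y)\<^sup>2"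

lemma PRic_eq_spray_PRic:
  "PRic F x y = spray_PRic (spray_coeff F) (\<lambda>m x. pd m (\<lambda>x. ln (BH_density F x)) x) x y"
proof -
  have "S_curvature F = spray_S (spray_coeff F) (\<lambda>m x. pd m (\<lambda>x. ln (BH_density F x)) x)"
    by (intro ext) (simp add: S_curvature_def spray_S_def spray_div_def)
  moreover have "ricci_curvature F x y = spray_ricci (spray_coeff F) x y"
    by (simp add: ricci_curvature_def spray_ricci_def riemann_curvature_def Let_def)
  ultimately show ?thesis
    by (simp add: PRic_def spray_PRic_def S_horizontal_def Let_def)
qed

lemma pd_fst_cong:
  assumes "open U" "x \<in> U" "y \<in> V" "\<And>x y. x \<in> U \<Longrightarrow> y \<in> V \<Longrightarrow> f x y = g x y"
  shows "pd i (\<lambda>x. f x y) x = pd i (\<lambda>x. g x y) x"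
  by (rule pd_cong[OF assms(1,2)]) (rule assms(4)[OF _ assms(3)])

lemma pd_snd_cong:
  assumes "open V" "x \<in> U" "y \<in> V" "\<And>x y. x \<in> U \<Longrightarrow> y \<in> V \<Longrightarrow> f x y = g x y"
  shows "pd i (f x) y = pd i (g x) y"
  by (rule pd_cong[OF assms(1,3)]) (rule assms(4)[OF assms(2)])

text \<open>Formulas for sprays are available only on open sets of x and of y, so equality is passed
  through one order of differentiation after the other.\<close>

lemma spray_PRic_cong:
  fixes G :: "'n::finite \<Rightarrow> real^'n \<Rightarrow> real^'n \<Rightarrow> real"
  assumes "open U" "open V" "x \<in> U" "y \<in> V"
    and GH: "\<And>i x y. x \<in> U \<Longrightarrow> y \<in> V \<Longrightarrow> G i x y = H i x y"
    and cd: "\<And>m x. x \<in> U \<Longrightarrow> c m x = d m x"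
  shows "spray_PRic G c x y = spray_PRic H d x y"
proof -
  note x = pd_fst_cong[where U = U and V = V, OF assms(1)]
  note y = pd_snd_cong[where U = U and V = V, OF assms(2)]
  have d1: "pd j (G i x) y = pd j (H i x) y" if "x \<in> U" "y \<in> V" for i j x y
    by (rule y[OF that GH])
  have S: "spray_S G c x y = spray_S H d x y" if "x \<in> U" "y \<in> V" for x y
    using d1[OF that] cd[OF that(1)] by (simp add: spray_S_def spray_div_def)
  have "pd j (\<lambda>x. pd i (G i x) y) x = pd j (\<lambda>x. pd i (H i x) y) x" for i j
    by (rule x[OF assms(3,4) d1])
  moreover have "pd j (pd i (G i x)) y = pd j (pd i (H i x)) y" for i j
    by (rule y[OF assms(3,4) d1])
  moreover have "pd i (\<lambda>x. G i x y) x = pd i (\<lambda>x. H i x y) x" for i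
    by (rule x[OF assms(3,4) GH])
  moreover have "pd m (\<lambda>x. spray_S G c x y) x = pd m (\<lambda>x. spray_S H d x y) x" for m
    by (rule x[OF assms(3,4) S])
  moreover have "pd m (spray_S G c x) y = pd m (spray_S H d x) y" for m
    by (rule y[OF assms(3,4) S])
  ultimately show ?thesis
    using d1[OF assms(3,4)] S[OF assms(3,4)] GH[OF assms(3,4)]
    by (simp add: spray_PRic_def spray_ricci_def)
qed

lemma smooth2_on_spray_div:
  assumes "open U" "open V" "\<And>i. smooth2_on U V (G i)"
  shows "smooth2_on U V (spray_div G)"
proof -
  have "smooth2_on U V (\<lambda>x y. \<Sum>i\<in>UNIV. pd i (G i x) y)"
    by (intro smooth2_on_sum smooth2_on_pd_snd assms)
  then show ?thesis unfolding spray_div_def[abs_def] .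
qed

text \<open>Exchanging the trace with the outer derivative turns two of the four terms into
  derivatives of the divergence. For \<open>H\<close> the divergence is linear in y, which makes
  these terms elementary.\<close>

lemma spray_ricci_eq:
  fixes G :: "'n::finite \<Rightarrow> real^'n \<Rightarrow> real^'n \<Rightarrow> real"
  assumes "open U" "open V" "\<And>i. smooth2_on U V (G i)" "x \<in> U" "y \<in> V"
  shows "spray_ricci G x y = 2 * (\<Sum>i\<in>UNIV. pd i (\<lambda>x. G i x y) x)
     - (\<Sum>j\<in>UNIV. y $ j * pd j (\<lambda>x. spray_div G x y) x)
     + 2 * (\<Sum>j\<in>UNIV. G j x y * pd j (spray_div G x) y)
     - (\<Sum>i\<in>UNIV. \<Sum>j\<in>UNIV. pd j (G i x) y * pd i (G j x) y)"
proof -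
  have sm: "smooth2_on U V (\<lambda>x y. pd i (G i x) y)" for i
    by (intro smooth2_on_pd_snd assms)
  have "pd j (\<lambda>x. spray_div G x y) x = (\<Sum>i\<in>UNIV. pd j (\<lambda>x. pd i (G i x) y) x)" for j
    unfolding spray_div_def
    by (intro has_pd_imp_pd has_pd_sum smooth2_on_pd(1)[OF sm assms(4,5)])
  then have 1: "(\<Sum>i\<in>UNIV. \<Sum>j\<in>UNIV. y $ j * pd j (\<lambda>x. pd i (G i x) y) x)
      = (\<Sum>j\<in>UNIV. y $ j * pd j (\<lambda>x. spray_div G x y) x)"
    by (subst sum.swap) (simp add: sum_distrib_left)
  have "pd j (spray_div G x) y = (\<Sum>i\<in>UNIV. pd j (pd i (G i x)) y)" for j
    unfolding spray_div_def[abs_def]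
    by (intro has_pd_imp_pd has_pd_sum smooth2_on_pd(2)[OF sm assms(4,5)])
  then have 2: "(\<Sum>i\<in>UNIV. \<Sum>j\<in>UNIV. G j x y * pd j (pd i (G i x)) y)
      = (\<Sum>j\<in>UNIV. G j x y * pd j (spray_div G x) y)"
    by (subst sum.swap) (simp add: sum_distrib_left)
  show ?thesis
    unfolding spray_ricci_def
    by (simp add: sum.distrib sum_subtractf sum_distrib_left[symmetric] 1 2)
qed

text \<open>Trace of the square of the y-Jacobian of H + P y, with \<open>h\<close> the Jacobian of
  H, \<open>p\<close> the gradient of P, \<open>v\<close> = y and \<open>q\<close> = P. The
  Kronecker part of the Jacobian produces \<open>real CARD('n) * q\<^sup>2\<close>.\<close>

lemma double_sum_projective:
  fixes h :: "'n::finite \<Rightarrow> 'n \<Rightarrow> real"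
  shows "(\<Sum>i\<in>UNIV. \<Sum>j\<in>UNIV. (h i j + p j * v i + (if j = i then q else 0))
      * (h j i + p i * v j + (if i = j then q else 0)))
    = (\<Sum>i\<in>UNIV. \<Sum>j\<in>UNIV. h i j * h j i) + 2 * (\<Sum>i\<in>UNIV. p i * (\<Sum>j\<in>UNIV. v j * h i j))
      + 2 * q * (\<Sum>i\<in>UNIV. h i i) + (\<Sum>i\<in>UNIV. v i * p i)\<^sup>2 + 2 * q * (\<Sum>i\<in>UNIV. v i * p i)
      + real CARD('n) * q\<^sup>2"
proof -
  have e: "(h i j + p j * v i + (if j = i then q else 0)) * (h j i + p i * v j + (if i = j then q else 0))
     = h i j * h j i + p i * (v j * h i j) + p j * (v i * h j i) + (v i * p i) * (v j * p j)
       + (if j = i then 2 * q * h i i + 2 * q * (v i * p i) + q\<^sup>2 else 0)" for i j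
    by (simp add: algebra_simps power2_eq_square)
  have s: "(\<Sum>i\<in>UNIV. \<Sum>j\<in>UNIV. p j * (v i * h j i)) = (\<Sum>i\<in>UNIV. p i * (\<Sum>j\<in>UNIV. v j * h i j))"
    by (subst sum.swap) (simp add: sum_distrib_left)
  show ?thesis
    unfolding e sum.distrib s
    by (simp add: sum.distrib sum_distrib_left[symmetric] sum_distrib_right[symmetric] power2_eq_square)
qed

text \<open>The spray \<open>G\<^sup>i - S y\<^sup>i / (n + 1)\<close> depends only on the projective class of \<open>G\<close>, and the projective
  Ricci curvature is its Ricci curvature.\<close>

lemma spray_PRic_projective:
  fixes H :: "'n::finite \<Rightarrow> real^'n \<Rightarrow> real^'n \<Rightarrow> real"
  assumes U: "open U" and V: "open V" and x0: "x \<in> U" and y0: "y \<in> V"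
    and H: "\<And>i. smooth2_on U V (H i)" and P: "smooth2_on U V P"
    and c: "\<And>m. smooth_on U (c m)"
    and euler_H: "\<And>i x y. x \<in> U \<Longrightarrow> y \<in> V \<Longrightarrow> (\<Sum>j\<in>UNIV. y $ j * pd j (H i x) y) = 2 * H i x y"
    and euler_P: "\<And>x y. x \<in> U \<Longrightarrow> y \<in> V \<Longrightarrow> (\<Sum>j\<in>UNIV. y $ j * pd j (P x) y) = P x y"
    and euler_div: "\<And>x y. x \<in> U \<Longrightarrow> y \<in> V \<Longrightarrow>
      (\<Sum>j\<in>UNIV. y $ j * pd j (spray_div H x) y) = spray_div H x y"
  shows "spray_PRic (\<lambda>i x y. H i x y + P x y * y $ i) c x y = spray_PRic H c x y"
proof -
  define n where "n = real CARD('n)"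
  define G where "G = (\<lambda>i x y. H i x y + P x y * y $ i)"
  have G: "smooth2_on U V (G i)" for i
    unfolding G_def by (intro smooth2_on_add smooth2_on_mult smooth2_on_nth U V H P)
  have dG: "pd j (G i x) y = pd j (H i x) y + pd j (P x) y * y $ i + (if j = i then P x y else 0)"
    if "x \<in> U" "y \<in> V" for i j x y
  proof -
    have "has_pd (\<lambda>y. H i x y + P x y * y $ i)
      (pd j (H i x) y + (pd j (P x) y * y $ i + (if j = i then 1 else 0) * P x y)) j y"
      by (intro has_pd_add has_pd_mult has_pd_nth smooth2_on_pd(2)[OF H that] smooth2_on_pd(2)[OF P that])
    then show ?thesis unfolding G_def using has_pd_imp_pd by fastforce
  qed
  have dxG: "pd j (\<lambda>x. G i x y) x = pd j (\<lambda>x. H i x y) x + pd j (\<lambda>x. P x y) x * y $ i" for i j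
  proof -
    have "has_pd (\<lambda>x. H i x y + P x y * y $ i)
      (pd j (\<lambda>x. H i x y) x + (pd j (\<lambda>x. P x y) x * y $ i + 0 * P x y)) j x"
      by (intro has_pd_add has_pd_mult has_pd_const smooth2_on_pd(1)[OF H x0 y0] smooth2_on_pd(1)[OF P x0 y0])
    then show ?thesis unfolding G_def using has_pd_imp_pd by fastforce
  qed
  \<comment> \<open>The Kronecker part contributes n copies of \<open>P\<close>, and Euler's
    identity for the degree one function \<open>P\<close> contributes one more. This is the n + 1 in
    the weights of PRic.\<close>
  have divG: "spray_div G x y = spray_div H x y + (n + 1) * P x y" if "x \<in> U" "y \<in> V" for x y
    using euler_P[OF that]
    by (simp add: spray_div_def dG[OF that] sum.distrib n_def algebra_simps)
  have SG: "spray_S G c x y = spray_S H c x y + (n + 1) * P x y" if "x \<in> U" "y \<in> V" for x y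
    using divG[OF that] by (simp add: spray_S_def)
  have div_smooth: "smooth2_on U V (spray_div H)"
    by (rule smooth2_on_spray_div[OF U V H])
  have S_smooth: "smooth2_on U V (spray_S H c)"
  proof -
    have "smooth2_on U V (\<lambda>x y. spray_div H x y - (\<Sum>m\<in>UNIV. y $ m * c m x))"
      by (intro smooth2_on_diff smooth2_on_sum smooth2_on_mult smooth2_on_nth smooth2_on_const1
          div_smooth U V c)
    then show ?thesis unfolding spray_S_def[abs_def] .
  qed
  have pd_x: "pd j (\<lambda>x. g x y) x = pd j (\<lambda>x. f x y) x + (n + 1) * pd j (\<lambda>x. P x y) x"
    if "smooth2_on U V f" "\<And>x y. x \<in> U \<Longrightarrow> y \<in> V \<Longrightarrow> g x y = f x y + (n + 1) * P x y" for f g j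
  proof -
    have "pd j (\<lambda>x. g x y) x = pd j (\<lambda>x. f x y + (n + 1) * P x y) x"
      by (rule pd_fst_cong[where U = U and V = V, OF U x0 y0 that(2)])
    also have "\<dots> = pd j (\<lambda>x. f x y) x + (n + 1) * pd j (\<lambda>x. P x y) x"
      by (intro has_pd_imp_pd has_pd_add has_pd_cmult smooth2_on_pd(1)[OF that(1) x0 y0]
          smooth2_on_pd(1)[OF P x0 y0])
    finally show ?thesis .
  qed
  have pd_y: "pd j (g x) y = pd j (f x) y + (n + 1) * pd j (P x) y"
    if "smooth2_on U V f" "\<And>x y. x \<in> U \<Longrightarrow> y \<in> V \<Longrightarrow> g x y = f x y + (n + 1) * P x y" for f g j
  proof -
    have "pd j (g x) y = pd j (\<lambda>y. f x y + (n + 1) * P x y) y"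
      by (rule pd_snd_cong[where U = U and V = V, OF V x0 y0 that(2)])
    also have "\<dots> = pd j (f x) y + (n + 1) * pd j (P x) y"
      by (intro has_pd_imp_pd has_pd_add has_pd_cmult smooth2_on_pd(2)[OF that(1) x0 y0]
          smooth2_on_pd(2)[OF P x0 y0])
    finally show ?thesis .
  qed
  have div_x: "pd j (\<lambda>x. spray_div G x y) x = pd j (\<lambda>x. spray_div H x y) x + (n + 1) * pd j (\<lambda>x. P x y) x" for j
    by (rule pd_x[OF div_smooth divG])
  have div_y: "pd j (spray_div G x) y = pd j (spray_div H x) y + (n + 1) * pd j (P x) y" for j
    by (rule pd_y[OF div_smooth divG])
  have S_x: "pd j (\<lambda>x. spray_S G c x y) x = pd j (\<lambda>x. spray_S H c x y) x + (n + 1) * pd j (\<lambda>x. P x y) x" for j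
    by (rule pd_x[OF S_smooth SG])
  have S_y: "pd j (spray_S G c x) y = pd j (spray_S H c x) y + (n + 1) * pd j (P x) y" for j
    by (rule pd_y[OF S_smooth SG])
  define p where "p = P x y"
  have Gxy: "G j x y = H j x y + p * y $ j" for j
    by (simp add: G_def p_def)
  define D where "D = spray_div H x y"
  define W where "W = spray_S H c x y"
  define HH where "HH = (\<Sum>i\<in>UNIV. \<Sum>j\<in>UNIV. pd j (H i x) y * pd i (H j x) y)"
  define HP where "HP = (\<Sum>i\<in>UNIV. H i x y * pd i (P x) y)"
  define HD where "HD = (\<Sum>i\<in>UNIV. H i x y * pd i (spray_div H x) y)"
  define HW where "HW = (\<Sum>i\<in>UNIV. H i x y * pd i (spray_S H c x) y)"
  define yP where "yP = (\<Sum>j\<in>UNIV. y $ j * pd j (\<lambda>x. P x y) x)"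
  define yD where "yD = (\<Sum>j\<in>UNIV. y $ j * pd j (\<lambda>x. spray_div H x y) x)"
  define yW where "yW = (\<Sum>j\<in>UNIV. y $ j * pd j (\<lambda>x. spray_S H c x y) x)"
  define Hx where "Hx = (\<Sum>i\<in>UNIV. pd i (\<lambda>x. H i x y) x)"
  have euler_S: "(\<Sum>j\<in>UNIV. y $ j * pd j (spray_S H c x) y) = W"
  proof -
    have "pd j (spray_S H c x) y = pd j (spray_div H x) y - c j x" for j
    proof -
      have "has_pd (\<lambda>y. spray_div H x y - (\<Sum>m\<in>UNIV. y $ m * c m x))
         (pd j (spray_div H x) y - (\<Sum>m\<in>UNIV. (if j = m then 1 else 0) * c m x + 0 * y $ m)) j y"
        by (intro has_pd_diff has_pd_sum has_pd_mult has_pd_nth has_pd_const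
            smooth2_on_pd(2)[OF div_smooth x0 y0])
      moreover have "(\<Sum>m\<in>UNIV. (if j = m then 1 else 0) * c m x + 0 * y $ m) = c j x"
        by (simp add: if_distrib[of "\<lambda>t. t * _"] cong: if_cong)
      ultimately show ?thesis unfolding spray_S_def[abs_def] using has_pd_imp_pd by fastforce
    qed
    then show ?thesis using euler_div[OF x0 y0]
      by (simp add: W_def spray_S_def right_diff_distrib sum_subtractf)
  qed
  have ric: "spray_ricci G x y = 2 * (Hx + yP) - (yD + (n + 1) * yP) + 2 * (HD + (n + 1) * HP + p * D + (n + 1) * p\<^sup>2)
      - (HH + 4 * HP + 2 * p * D + p\<^sup>2 + 2 * p * p + n * p\<^sup>2)"
  proof -
    have 1: "(\<Sum>i\<in>UNIV. pd i (\<lambda>x. G i x y) x) = Hx + yP"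
      by (simp add: dxG sum.distrib Hx_def yP_def mult.commute)
    have 2: "(\<Sum>j\<in>UNIV. y $ j * pd j (\<lambda>x. spray_div G x y) x) = yD + (n + 1) * yP"
      unfolding div_x yD_def yP_def
      by (simp add: distrib_left sum.distrib sum_distrib_left mult.left_commute)
    have 3: "(\<Sum>j\<in>UNIV. G j x y * pd j (spray_div G x) y) = HD + (n + 1) * HP + p * D + (n + 1) * p\<^sup>2"
    proof -
      have "G j x y * pd j (spray_div G x) y = H j x y * pd j (spray_div H x) y
         + (n + 1) * (H j x y * pd j (P x) y) + p * (y $ j * pd j (spray_div H x) y)
         + (n + 1) * (p * (y $ j * pd j (P x) y))" for j
        unfolding div_y Gxy by (simp add: algebra_simps)
      then show ?thesis
        by (simp add: sum.distrib sum_distrib_left[symmetric] HD_def HP_def euler_P[OF x0 y0]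
            euler_div[OF x0 y0] power2_eq_square p_def[symmetric] D_def[symmetric])
    qed
    \<comment> \<open>\<open>4 * HP\<close> is the mixed term: Euler's identity replaces the
      Jacobian of \<open>H\<close> contracted with y by \<open>2 * H i x y\<close>, and the mixed
      term occurs twice.\<close>
    have 4: "(\<Sum>i\<in>UNIV. \<Sum>j\<in>UNIV. pd j (G i x) y * pd i (G j x) y)
       = HH + 4 * HP + 2 * p * D + p\<^sup>2 + 2 * p * p + n * p\<^sup>2"
    proof -
      have "2 * (\<Sum>i\<in>UNIV. pd i (P x) y * (2 * H i x y)) = 4 * HP"
        by (simp add: HP_def sum_distrib_left mult_ac)
      then show ?thesis
        unfolding dG[OF x0 y0] double_sum_projective
        by (simp add: euler_H[OF x0 y0] euler_P[OF x0 y0] HH_def D_def p_def n_def spray_div_def)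
    qed
    show ?thesis
      unfolding spray_ricci_eq[OF U V G x0 y0] 1 2 3 4 by simp
  qed
  have yS: "(\<Sum>m\<in>UNIV. y $ m * pd m (\<lambda>x. spray_S G c x y) x) = yW + (n + 1) * yP"
    unfolding S_x yW_def yP_def
    by (simp add: distrib_left sum.distrib sum_distrib_left mult.left_commute)
  have GS: "(\<Sum>j\<in>UNIV. G j x y * pd j (spray_S G c x) y) = HW + (n + 1) * HP + p * W + (n + 1) * p\<^sup>2"
  proof -
    have "G j x y * pd j (spray_S G c x) y = H j x y * pd j (spray_S H c x) y
       + (n + 1) * (H j x y * pd j (P x) y) + p * (y $ j * pd j (spray_S H c x) y)
       + (n + 1) * (p * (y $ j * pd j (P x) y))" for j
      unfolding S_y Gxy by (simp add: algebra_simps)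
    then show ?thesis
      by (simp add: sum.distrib sum_distrib_left[symmetric] HW_def HP_def euler_P[OF x0 y0]
          euler_S power2_eq_square p_def[symmetric])
  qed
  have n: "n + 1 \<noteq> 0" by (simp add: n_def)
  have "spray_PRic G c x y = 2 * (Hx + yP) - (yD + (n + 1) * yP) + 2 * (HD + (n + 1) * HP + p * D + (n + 1) * p\<^sup>2)
      - (HH + 4 * HP + 2 * p * D + p\<^sup>2 + 2 * p * p + n * p\<^sup>2)
      + (n - 1) / (n + 1) * (yW + (n + 1) * yP - 2 * (HW + (n + 1) * HP + p * W + (n + 1) * p\<^sup>2))
      + (n - 1) / (n + 1)\<^sup>2 * (W + (n + 1) * p)\<^sup>2"
    unfolding spray_PRic_def ric yS GS SG[OF x0 y0] n_def[symmetric] W_def[symmetric] p_def[symmetric] ..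
  also have "\<dots> = 2 * Hx - yD + 2 * HD - HH + (n - 1) / (n + 1) * (yW - 2 * HW) + (n - 1) / (n + 1)\<^sup>2 * W\<^sup>2"
  proof -
    \<comment> \<open>Writing n - 1 as \<open>k * (n + 1) * (n + 1)\<close> clears the denominators
      and leaves a polynomial identity.\<close>
    define k where "k = (n - 1) / (n + 1)\<^sup>2"
    have 1: "(n - 1) / (n + 1) = k * (n + 1)" "n - 1 = k * (n + 1) * (n + 1)"
      using n by (simp_all add: k_def power2_eq_square)
    \<comment> \<open>The P-dependent part of the Ricci curvature collapses to
      \<open>(n - 1) * (2 * HP + p\<^sup>2 - yP)\<close>. The S-terms contribute exactly its
      negative, while their products of \<open>p\<close> and \<open>W\<close> cancel each
      other.\<close>
    have 2: "2 * (Hx + yP) - (yD + (n + 1) * yP) + 2 * (HD + (n + 1) * HP + p * D + (n + 1) * p\<^sup>2)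
        - (HH + 4 * HP + 2 * p * D + p\<^sup>2 + 2 * p * p + n * p\<^sup>2)
      = 2 * Hx - yD + 2 * HD - HH + (n - 1) * (2 * HP + p\<^sup>2 - yP)"
      by (simp add: algebra_simps power2_eq_square)
    show ?thesis unfolding 2 1(1) k_def[symmetric] unfolding 1(2)
      by (simp add: algebra_simps power2_eq_square)
  qed
  also have "\<dots> = spray_PRic H c x y"
    unfolding spray_PRic_def spray_ricci_eq[OF U V H x0 y0]
    by (simp add: n_def Hx_def yD_def HD_def HH_def yW_def HW_def W_def)
  finally show ?thesis unfolding G_def .
qed

section \<open>Linear and quadratic forms\<close>

definition lin_form :: "('n \<Rightarrow> real) \<Rightarrow> real^'n::finite \<Rightarrow> real" where
  "lin_form c y = (\<Sum>k\<in>UNIV. c k * y $ k)"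

text \<open>The coefficients need not be symmetric, so products of linear forms and contracted
  tensors fit without symmetrisation; gradients then show both \<open>c l j\<close> and
  \<open>c j l\<close>.\<close>

definition quad_form :: "('n \<Rightarrow> 'n \<Rightarrow> real) \<Rightarrow> real^'n::finite \<Rightarrow> real" where
  "quad_form c y = (\<Sum>i\<in>UNIV. \<Sum>j\<in>UNIV. c i j * y $ i * y $ j)"

lemma quad_form_lin_form: "quad_form c y = (\<Sum>i\<in>UNIV. y $ i * lin_form (c i) y)"
  by (simp add: quad_form_def lin_form_def sum_distrib_left mult_ac)

lemma quad_form_lin_form': "quad_form c y = (\<Sum>j\<in>UNIV. y $ j * lin_form (\<lambda>i. c i j) y)"
  unfolding quad_form_def lin_form_def
  by (subst sum.swap) (simp add: sum_distrib_left mult_ac)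

lemma lin_form_mult: "lin_form c y * lin_form d y = quad_form (\<lambda>i j. c i * d j) y"
  by (simp add: lin_form_def quad_form_def sum_product mult_ac)

lemma lin_form_add: "lin_form c y + lin_form d y = lin_form (\<lambda>i. c i + d i) y"
  by (simp add: lin_form_def sum.distrib distrib_right)

lemma lin_form_diff: "lin_form c y - lin_form d y = lin_form (\<lambda>i. c i - d i) y"
  by (simp add: lin_form_def sum_subtractf left_diff_distrib)

lemma lin_form_cmult: "r * lin_form c y = lin_form (\<lambda>i. r * c i) y"
  by (simp add: lin_form_def sum_distrib_left mult_ac)

lemma lin_form_sum: "(\<Sum>m\<in>I. lin_form (c m) y) = lin_form (\<lambda>i. \<Sum>m\<in>I. c m i) y"
  unfolding lin_form_def by (subst sum.swap) (simp add: sum_distrib_right)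

lemma quad_form_add: "quad_form c y + quad_form d y = quad_form (\<lambda>i j. c i j + d i j) y"
  by (simp add: quad_form_def sum.distrib distrib_right)

lemma quad_form_diff: "quad_form c y - quad_form d y = quad_form (\<lambda>i j. c i j - d i j) y"
  by (simp add: quad_form_def sum_subtractf left_diff_distrib)

lemma quad_form_cmult: "r * quad_form c y = quad_form (\<lambda>i j. r * c i j) y"
  by (simp add: quad_form_def sum_distrib_left mult_ac)

lemma quad_form_sum: "(\<Sum>m\<in>I. quad_form (c m) y) = quad_form (\<lambda>i j. \<Sum>m\<in>I. c m i j) y"
proof -
  have "(\<Sum>m\<in>I. quad_form (c m) y) = (\<Sum>i\<in>UNIV. \<Sum>m\<in>I. \<Sum>j\<in>UNIV. c m i j * y $ i * y $ j)"
    unfolding quad_form_def by (rule sum.swap)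
  also have "\<dots> = (\<Sum>i\<in>UNIV. \<Sum>j\<in>UNIV. \<Sum>m\<in>I. c m i j * y $ i * y $ j)"
    by (intro sum.cong refl sum.swap)
  finally show ?thesis by (simp add: quad_form_def sum_distrib_right)
qed

lemma lin_form_scaleR: "lin_form c (t *\<^sub>R y) = t * lin_form c y"
  by (simp add: lin_form_def sum_distrib_left mult_ac)

lemma quad_form_scaleR: "quad_form c (t *\<^sub>R y) = t\<^sup>2 * quad_form c y"
  by (simp add: quad_form_def sum_distrib_left mult_ac power2_eq_square)

lemma lin_form_axis: "lin_form c (axis i 1) = c i"
  by (simp add: lin_form_def axis_def if_distrib[of "\<lambda>t. _ * t"] cong: if_cong)

lemma lin_form_plus: "lin_form c (u + v) = lin_form c u + lin_form c v"
  by (simp add: lin_form_def distrib_left sum.distrib)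

lemma lin_form_swap: "(\<Sum>l\<in>UNIV. u $ l * lin_form (c l) v) = (\<Sum>j\<in>UNIV. v $ j * lin_form (\<lambda>l. c l j) u)"
  unfolding lin_form_def sum_distrib_left by (subst sum.swap) (simp add: mult_ac)

lemma has_pd_lin_form: "has_pd (lin_form c) (c l) l y"
proof -
  have "has_pd (\<lambda>y. \<Sum>k\<in>UNIV. c k * y $ k) (\<Sum>k\<in>UNIV. c k * (if l = k then 1 else 0)) l y"
    by (intro has_pd_sum has_pd_cmult has_pd_nth)
  then show ?thesis
    by (simp add: lin_form_def[abs_def] if_distrib[of "\<lambda>t. _ * t"] cong: if_cong)
qed

lemma has_pd_quad_form: "has_pd (quad_form c) (lin_form (\<lambda>j. c l j + c j l) y) l y"
proof -
  have "has_pd (\<lambda>y. \<Sum>i\<in>UNIV. y $ i * lin_form (c i) y)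
     (\<Sum>i\<in>UNIV. (if l = i then 1 else 0) * lin_form (c i) y + c i l * y $ i) l y"
    by (intro has_pd_sum has_pd_mult has_pd_nth has_pd_lin_form)
  moreover have "(\<Sum>i\<in>UNIV. (if l = i then 1 else 0) * lin_form (c i) y + c i l * y $ i)
      = lin_form (\<lambda>j. c l j + c j l) y"
    by (simp add: sum.distrib if_distrib[of "\<lambda>t. t * _"] lin_form_add[symmetric] cong: if_cong)
      (simp add: lin_form_def)
  ultimately show ?thesis by (simp add: quad_form_lin_form[abs_def])
qed

lemma has_pd_lin_form_coeff:
  assumes "\<And>k. has_pd (c k) (d k) l x"
  shows "has_pd (\<lambda>x. lin_form (\<lambda>k. c k x) y) (lin_form d y) l x"
  unfolding lin_form_def mult.commute[of _ "y $ _"] by (intro has_pd_sum has_pd_cmult assms)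

lemma has_pd_quad_form_coeff:
  assumes "\<And>i j. has_pd (c i j) (d i j) l x"
  shows "has_pd (\<lambda>x. quad_form (\<lambda>i j. c i j x) y) (quad_form d y) l x"
  unfolding quad_form_lin_form by (intro has_pd_sum has_pd_cmult has_pd_lin_form_coeff assms)

lemma smooth2_on_lin_form:
  assumes "open U" "open V" "\<And>k. smooth_on U (c k)"
  shows "smooth2_on U V (\<lambda>x y. lin_form (\<lambda>k. c k x) y)"
  unfolding lin_form_def
  by (intro smooth2_on_sum smooth2_on_mult smooth2_on_const1 smooth2_on_nth assms)

lemma smooth2_on_quad_form:
  assumes "open U" "open V" "\<And>i j. smooth_on U (c i j)"
  shows "smooth2_on U V (\<lambda>x y. quad_form (\<lambda>i j. c i j x) y)"
  unfolding quad_form_def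
  by (intro smooth2_on_sum smooth2_on_mult smooth2_on_const1 smooth2_on_nth assms)

text \<open>The function \<open>f x (t *\<^sub>R y)\<close> of t is differentiated at t = 1 twice,
  by the chain rule and as the linear function \<open>t * f x y\<close>. Positive t suffice, since
  they form a neighbourhood of 1.\<close>

lemma euler_homogeneous:
  fixes f :: "real^'n::finite \<Rightarrow> real^'n \<Rightarrow> real"
  assumes "smooth2_on U (- {0}) f" "x \<in> U" "y \<noteq> 0"
    and hom: "\<And>t. t > 0 \<Longrightarrow> f x (t *\<^sub>R y) = t * f x y"
  shows "(\<Sum>j\<in>UNIV. y $ j * pd j (f x) y) = f x y"
proof -
  define f' where "f' = frechet_derivative (\<lambda>z. f (fst z) (snd z)) (at (x, y))"
  have f': "((\<lambda>z. f (fst z) (snd z)) has_derivative f') (at (x, y))"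
    unfolding f'_def using smooth_on_has_derivative[of "U \<times> - {0}" _ "(x, y)"] assms
    by (simp add: smooth2_on_def)
  have pd: "pd i (f x) y = f' (0, axis i 1)" for i
    unfolding f'_def using smooth2_on_pd(4)[OF assms(1,2)] assms(3) by simp
  have l: "linear f'" by (rule has_derivative_linear[OF f'])
  have "(0, y) = (\<Sum>i\<in>UNIV. y $ i *\<^sub>R (0::real^'n, axis i 1))"
    by (simp add: prod_eq_iff fst_sum snd_sum basis_expansion scalar_mult_eq_scaleR[symmetric])
  then have f'_sum: "f' (0, y) = (\<Sum>j\<in>UNIV. y $ j * pd j (f x) y)"
    by (simp add: linear_sum[OF l] linear_cmul[OF l] pd del: scaleR_Pair)
  have "((\<lambda>t. (x, t *\<^sub>R y)) has_derivative (\<lambda>t. (0, t *\<^sub>R y))) (at (1::real))"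
    by (auto intro!: derivative_eq_intros)
  from has_derivative_compose[OF this, of "\<lambda>z. f (fst z) (snd z)" f'] f'
  have "((\<lambda>t. f x (t *\<^sub>R y)) has_derivative (\<lambda>t. f' (0, t *\<^sub>R y))) (at 1)"
    by simp
  then have ft: "((\<lambda>t. t * f x y) has_derivative (\<lambda>t. f' (0, t *\<^sub>R y))) (at 1)"
    by (rule has_derivative_transform_within_open[of _ _ _ UNIV "{0<..}"]) (auto simp: hom)
  have "((\<lambda>t. t * f x y) has_derivative (\<lambda>t. t * f x y)) (at 1)"
    by (auto intro!: derivative_eq_intros)
  from has_derivative_unique[OF ft this] have "(\<lambda>t. f' (0, t *\<^sub>R y)) = (\<lambda>t. t * f x y)" .
  from fun_cong[OF this, of 1] f'_sum show ?thesis by simp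
qed

lemma pos_def_invertible:
  fixes g :: "real^'n^'n"
  assumes "\<And>u. u \<noteq> 0 \<Longrightarrow> 0 < quad_form (\<lambda>i j. g $ i $ j) u"
  shows "invertible g"
proof -
  have "u = 0" if "g *v u = 0" for u
  proof (rule ccontr)
    assume "u \<noteq> 0"
    have "quad_form (\<lambda>i j. g $ i $ j) u = (\<Sum>i\<in>UNIV. u $ i * (g *v u) $ i)"
      by (simp add: quad_form_lin_form lin_form_def matrix_vector_mult_def)
    then show False using assms[OF \<open>u \<noteq> 0\<close>] that by simp
  qed
  then show ?thesis
    by (simp add: invertible_left_inverse matrix_left_invertible_ker)
qed

lemma matrix_inv_sym:
  fixes A :: "real^'n^'n"
  assumes "invertible A" "transpose A = A"
  shows "transpose (matrix_inv A) = matrix_inv A"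
proof -
  have "transpose (matrix_inv A) ** A = mat 1"
    using arg_cong[OF matrix_inv_mult(1)[OF assms(1)], of transpose] assms(2)
    by (simp add: matrix_transpose_mul transpose_mat)
  then have "transpose (matrix_inv A) ** A ** matrix_inv A = matrix_inv A" by simp
  then show ?thesis by (simp add: matrix_mul_assoc[symmetric] matrix_inv_mult[OF assms(1)])
qed

section \<open>Randers metrics in a chart\<close>

text \<open>The bound on the norm of \<beta> is taken pointwise as |\<beta>| < \<alpha>, the form in
  which positivity of F and of the ellipsoid matrix use it; the supremum in \<open>form_norm\<close>
  is translated once, in the reduction to charts.\<close>

locale randers_chart =
  fixes U :: "(real^'n::finite) set"
    and a :: "'n \<Rightarrow> 'n \<Rightarrow> real^'n \<Rightarrow> real" and b :: "'n \<Rightarrow> real^'n \<Rightarrow> real"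
  assumes U: "open U"
    and smooth_a: "smooth_on U (a i j)"
    and smooth_b: "smooth_on U (b i)"
    and a_sym: "x \<in> U \<Longrightarrow> a i j x = a j i x"
    and a_pos: "x \<in> U \<Longrightarrow> y \<noteq> 0 \<Longrightarrow> 0 < quad_form (\<lambda>i j. a i j x) y"
    and b_less: "x \<in> U \<Longrightarrow> y \<noteq> 0 \<Longrightarrow> \<bar>lin_form (\<lambda>i. b i x) y\<bar> < sqrt (quad_form (\<lambda>i j. a i j x) y)"
begin

abbreviation "V \<equiv> - {0 :: real^'n}"

lemma V: "open V" by auto

definition \<alpha> where "\<alpha> x y = sqrt (quad_form (\<lambda>i j. a i j x) y)"
definition \<beta> where "\<beta> x y = lin_form (\<lambda>i. b i x) y"
text \<open>The vector y with its index lowered by the metric;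
  \<open>low l x y / \<alpha> x y\<close> is the y-derivative of \<alpha>.\<close>

definition low where "low l x y = lin_form (\<lambda>j. a l j x) y"
definition inv_a where "inv_a i j x = matrix_inv (\<chi> i j. a i j x) $ i $ j"

text \<open>\<open>s l j\<close>, \<open>\<Gamma>l l j k\<close> are the covariant components \<open>s\<^bsub>lj\<^esub>\<close>, \<open>\<Gamma>\<^bsub>ljk\<^esub>\<close>; \<open>T\<close> and \<open>\<Gamma>\<close> have the first
  index raised.\<close>

definition s where "s l j x = (pd j (b l) x - pd l (b j) x) / 2"
definition T where "T i j x = (\<Sum>l\<in>UNIV. inv_a i l x * s l j x)"
definition \<Gamma>l where "\<Gamma>l l j k x = (pd j (a l k) x + pd k (a l j) x - pd l (a j k) x) / 2"
definition \<Gamma> where "\<Gamma> i j k x = (\<Sum>l\<in>UNIV. inv_a i l x * \<Gamma>l l j k x)"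
definition T0 where "T0 i x y = lin_form (\<lambda>k. T i k x) y"
text \<open>In the normalisation of \<open>spray_coeff\<close> the geodesic spray is half of the
  Christoffel symbols contracted twice with y, whence the factor 1/2.\<close>

definition H where "H i x y = quad_form (\<lambda>j k. \<Gamma> i j k x / 2) y + \<alpha> x y * T0 i x y"

lemma invertible_a: "x \<in> U \<Longrightarrow> invertible (\<chi> i j. a i j x)"
  by (rule pos_def_invertible) (simp add: a_pos)

lemma inv_a_sym: "x \<in> U \<Longrightarrow> inv_a i j x = inv_a j i x"
proof -
  assume "x \<in> U"
  have "transpose (\<chi> i j. a i j x) = (\<chi> i j. a i j x)"
    using a_sym[OF \<open>x \<in> U\<close>] by (simp add: transpose_def vec_eq_iff)
  from matrix_inv_sym[OF invertible_a[OF \<open>x \<in> U\<close>] this]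
  have "transpose (matrix_inv (\<chi> i j. a i j x)) $ i $ j = matrix_inv (\<chi> i j. a i j x) $ i $ j"
    by (rule arg_cong)
  then show ?thesis by (simp add: inv_a_def transpose_def)
qed

lemma lower_raise:
  assumes "x \<in> U"
  shows "(\<Sum>i\<in>UNIV. a m i x * (\<Sum>l\<in>UNIV. inv_a i l x * w l)) = w m"
proof -
  let ?A = "\<chi> i j. a i j x" and ?w = "\<chi> i. w i"
  have "(\<Sum>i\<in>UNIV. a m i x * (\<Sum>l\<in>UNIV. inv_a i l x * w l)) = (?A *v (matrix_inv ?A *v ?w)) $ m"
    by (simp add: matrix_vector_mult_def inv_a_def)
  then show ?thesis
    by (simp add: matrix_vector_mul_assoc matrix_inv_mult[OF invertible_a[OF assms]])
qed

lemma lower_T: "x \<in> U \<Longrightarrow> (\<Sum>i\<in>UNIV. a m i x * T i j x) = s m j x"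
  unfolding T_def by (rule lower_raise)

lemma lower_\<Gamma>: "x \<in> U \<Longrightarrow> (\<Sum>i\<in>UNIV. a m i x * \<Gamma> i j k x) = \<Gamma>l m j k x"
  unfolding \<Gamma>_def by (rule lower_raise)

lemma pd_a_sym: "x \<in> U \<Longrightarrow> pd k (a i j) x = pd k (a j i) x"
  by (rule pd_cong[OF U _ a_sym])

lemma s_skew: "s j l x = - s l j x"
  unfolding s_def minus_divide_left minus_diff_eq ..

lemma \<Gamma>_sym: "x \<in> U \<Longrightarrow> \<Gamma> i j k x = \<Gamma> i k j x"
proof -
  assume x: "x \<in> U"
  have "\<Gamma>l l j k x = \<Gamma>l l k j x" for l
    unfolding \<Gamma>l_def using pd_a_sym[OF x, of l j k] by simp
  then show ?thesis by (simp add: \<Gamma>_def)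
qed

text \<open>\<open>s\<close> is skew and \<open>inv_a\<close> is symmetric, so exchanging the
  summation indices changes the sign of the trace.\<close>

lemma trace_T: "x \<in> U \<Longrightarrow> (\<Sum>i\<in>UNIV. T i i x) = 0"
proof -
  assume x: "x \<in> U"
  have "(\<Sum>i\<in>UNIV. T i i x) = (\<Sum>l\<in>UNIV. \<Sum>i\<in>UNIV. inv_a i l x * s l i x)"
    unfolding T_def by (rule sum.swap)
  also have "\<dots> = (\<Sum>l\<in>UNIV. \<Sum>i\<in>UNIV. - (inv_a l i x * s i l x))"
  proof (intro sum.cong refl)
    show "inv_a i l x * s l i x = - (inv_a l i x * s i l x)" for i l
      using inv_a_sym[OF x, of i l] s_skew[of l i x] by simp
  qed
  also have "\<dots> = - (\<Sum>i\<in>UNIV. T i i x)"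
    unfolding T_def by (simp add: sum_negf)
  finally show ?thesis by simp
qed

lemma smooth_inv_a: "smooth_on U (inv_a i j)"
  unfolding inv_a_def[abs_def] using smooth_a invertible_a
  by (intro smooth_on_matrix_inv U) (simp_all add: invertible_det_nz)

lemma smooth_s: "smooth_on U (s i j)"
  unfolding s_def[abs_def]
  by (intro smooth_on_divide smooth_on_diff smooth_on_const smooth_on_pd smooth_b U) simp

lemma smooth_T: "smooth_on U (T i j)"
  unfolding T_def[abs_def] by (intro smooth_on_sum smooth_on_mult smooth_inv_a smooth_s U)

lemma smooth_\<Gamma>l: "smooth_on U (\<Gamma>l i j k)"
  unfolding \<Gamma>l_def[abs_def]
  by (intro smooth_on_divide smooth_on_add smooth_on_diff smooth_on_const smooth_on_pd smooth_a U) simp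

lemma smooth_\<Gamma>: "smooth_on U (\<Gamma> i j k)"
  unfolding \<Gamma>_def[abs_def] by (intro smooth_on_sum smooth_on_mult smooth_inv_a smooth_\<Gamma>l U)

lemma \<alpha>_pos: "x \<in> U \<Longrightarrow> y \<noteq> 0 \<Longrightarrow> \<alpha> x y > 0"
  using a_pos by (simp add: \<alpha>_def)

lemma \<alpha>_square: "x \<in> U \<Longrightarrow> (\<alpha> x y)\<^sup>2 = quad_form (\<lambda>i j. a i j x) y"
  unfolding \<alpha>_def using a_pos[of x y] by (cases "y = 0") (auto simp: quad_form_def)

lemma smooth_\<alpha>: "smooth2_on U V \<alpha>"
  unfolding \<alpha>_def[abs_def] using a_pos by (intro smooth2_on_sqrt smooth2_on_quad_form smooth_a U V) auto

lemma smooth_T0: "smooth2_on U V (T0 i)"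
  unfolding T0_def[abs_def] by (intro smooth2_on_lin_form smooth_T U V)

lemma smooth_H: "smooth2_on U V (H i)"
  unfolding H_def[abs_def] using smooth_\<Gamma>
  by (intro smooth2_on_add smooth2_on_mult smooth_\<alpha> smooth_T0 smooth2_on_quad_form smooth_on_divide
      smooth_on_const U V) auto

lemma has_pd_a: "x \<in> U \<Longrightarrow> has_pd (a i j) (pd k (a i j) x) k x"
  by (rule smooth_on_has_pd[OF smooth_a])

lemma has_pd_b: "x \<in> U \<Longrightarrow> has_pd (b i) (pd k (b i) x) k x"
  by (rule smooth_on_has_pd[OF smooth_b])

lemma has_pd_\<alpha>_snd: "x \<in> U \<Longrightarrow> y \<noteq> 0 \<Longrightarrow> has_pd (\<alpha> x) (low l x y / \<alpha> x y) l y"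
proof -
  assume x: "x \<in> U" and y: "y \<noteq> 0"
  have "has_pd (\<lambda>y. sqrt (quad_form (\<lambda>i j. a i j x) y))
     (lin_form (\<lambda>j. a l j x + a j l x) y / (2 * sqrt (quad_form (\<lambda>i j. a i j x) y))) l y"
    by (intro has_pd_sqrt has_pd_quad_form a_pos x y)
  moreover have "lin_form (\<lambda>j. a l j x + a j l x) y = 2 * low l x y"
    by (simp add: low_def lin_form_cmult a_sym[OF x, of _ l])
  ultimately show ?thesis by (simp add: \<alpha>_def[abs_def])
qed

lemma has_pd_\<alpha>_fst: "x \<in> U \<Longrightarrow> y \<noteq> 0 \<Longrightarrow>
    has_pd (\<lambda>x. \<alpha> x y) (quad_form (\<lambda>i j. pd k (a i j) x) y / (2 * \<alpha> x y)) k x"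
  unfolding \<alpha>_def by (intro has_pd_sqrt has_pd_quad_form_coeff has_pd_a a_pos)

lemma has_pd_low: "has_pd (low l x) (a l j x) j y"
  unfolding low_def[abs_def] by (rule has_pd_lin_form)

lemma has_pd_T0: "has_pd (T0 i x) (T i j x) j y"
  unfolding T0_def[abs_def] by (rule has_pd_lin_form)

lemma has_pd_H_snd: "x \<in> U \<Longrightarrow> y \<noteq> 0 \<Longrightarrow>
    has_pd (H i x) (lin_form (\<lambda>k. \<Gamma> i j k x) y + (low j x y / \<alpha> x y * T0 i x y + T i j x * \<alpha> x y)) j y"
proof -
  assume x: "x \<in> U" and y: "y \<noteq> 0"
  have "has_pd (\<lambda>y. quad_form (\<lambda>j k. \<Gamma> i j k x / 2) y + \<alpha> x y * T0 i x y)
     (lin_form (\<lambda>k. \<Gamma> i j k x / 2 + \<Gamma> i k j x / 2) y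
       + (low j x y / \<alpha> x y * T0 i x y + T i j x * \<alpha> x y)) j y"
    by (intro has_pd_add has_pd_mult has_pd_quad_form has_pd_\<alpha>_snd has_pd_T0 x y)
  moreover have "\<Gamma> i j k x / 2 + \<Gamma> i k j x / 2 = \<Gamma> i j k x" for k
    using \<Gamma>_sym[OF x, of i j k] by simp
  ultimately show ?thesis by (simp add: H_def[abs_def])
qed

lemma has_pd_H_fst: "x \<in> U \<Longrightarrow> y \<noteq> 0 \<Longrightarrow>
    has_pd (\<lambda>x. H i x y) (quad_form (\<lambda>j k. pd m (\<Gamma> i j k) x / 2) y
      + (quad_form (\<lambda>i j. pd m (a i j) x) y / (2 * \<alpha> x y) * T0 i x y
         + lin_form (\<lambda>k. pd m (T i k) x) y * \<alpha> x y)) m x"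
proof -
  assume x: "x \<in> U" and y: "y \<noteq> 0"
  have "has_pd (\<lambda>x. \<Gamma> i j k x / 2) (pd m (\<Gamma> i j k) x / 2) m x" for j k
    using has_pd_divide[OF smooth_on_has_pd[OF smooth_\<Gamma>[of i j k] x] has_pd_const, of 2] by simp
  then show ?thesis
    unfolding H_def T0_def
    by (intro has_pd_add has_pd_mult has_pd_quad_form_coeff has_pd_lin_form_coeff has_pd_\<alpha>_fst
        smooth_on_has_pd[OF smooth_T] x y)
qed

lemma sum_low: "(\<Sum>l\<in>UNIV. y $ l * low l x y) = quad_form (\<lambda>i j. a i j x) y"
  by (simp add: low_def quad_form_lin_form)

text \<open>Moves the lowering from y to \<open>w\<close> by symmetry of the metric. Raised tensors
  such as \<open>T\<close> and \<open>\<Gamma>\<close> then return to their covariant form, where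
  skewness and symmetry are visible.\<close>

lemma sum_low_mult:
  assumes "x \<in> U"
  shows "(\<Sum>j\<in>UNIV. low j x y * w j) = (\<Sum>l\<in>UNIV. y $ l * (\<Sum>j\<in>UNIV. a l j x * w j))"
proof -
  have "(\<Sum>j\<in>UNIV. low j x y * w j) = (\<Sum>j\<in>UNIV. \<Sum>l\<in>UNIV. y $ l * (a l j x * w j))"
    unfolding low_def lin_form_def sum_distrib_right
  proof (intro sum.cong refl)
    show "a j l x * y $ l * w j = y $ l * (a l j x * w j)" for j l
      using a_sym[OF assms, of j l] by simp
  qed
  then show ?thesis by (subst (asm) sum.swap) (simp add: sum_distrib_left)
qed

lemma lower_T0: "x \<in> U \<Longrightarrow> (\<Sum>j\<in>UNIV. a l j x * T0 j x y) = lin_form (\<lambda>k. s l k x) y"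
  unfolding T0_def lin_form_cmult lin_form_sum by (simp add: lower_T)

lemma s_quad: "quad_form (\<lambda>l k. s l k x) y = 0"
proof -
  have "quad_form (\<lambda>l k. s l k x) y = quad_form (\<lambda>l k. - s k l x) y"
    unfolding s_skew[symmetric] ..
  also have "\<dots> = - quad_form (\<lambda>l k. s l k x) y"
    unfolding quad_form_lin_form[of "\<lambda>l k. s l k x"] quad_form_lin_form'[of "\<lambda>l k. - s k l x"]
    by (simp add: lin_form_def sum_negf)
  finally show ?thesis by simp
qed

text \<open>Lowering the index turns the sum into the skew form \<open>s\<close> evaluated at (y,
  y). This removes the 1/\<alpha> term of the divergence of \<open>H\<close> and the term of order
  -2 in \<alpha> in the trace of its squared Jacobian.\<close>

lemma low_T0: "x \<in> U \<Longrightarrow> (\<Sum>j\<in>UNIV. low j x y * T0 j x y) = 0"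
  using s_quad[of x y] unfolding sum_low_mult lower_T0 quad_form_lin_form .

end

section \<open>Functions given by a quadratic form\<close>

text \<open>Hides the coefficients: the even part of the curvature is a long sum of which only the
  quadratic dependence on y matters.\<close>

definition is_quad :: "(real^'n::finite \<Rightarrow> real) \<Rightarrow> bool" where
  "is_quad f \<longleftrightarrow> (\<exists>q. \<forall>y. f y = quad_form q y)"

lemma is_quadI: "(\<And>y. f y = quad_form q y) \<Longrightarrow> is_quad f"
  unfolding is_quad_def by (rule exI[of _ q]) simp

lemma is_quad_quad_form: "is_quad (quad_form q)"
  by (rule is_quadI) (rule refl)

lemma is_quad_lin_mult: "is_quad (\<lambda>y. lin_form c y * lin_form d y)"
  by (rule is_quadI) (rule lin_form_mult)

lemma is_quad_add: "is_quad f \<Longrightarrow> is_quad g \<Longrightarrow> is_quad (\<lambda>y. f y + g y)"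
proof -
  assume "is_quad f" "is_quad g"
  then obtain p q where "\<And>y. f y = quad_form p y" "\<And>y. g y = quad_form q y"
    unfolding is_quad_def by metis
  then show ?thesis by (intro is_quadI) (simp add: quad_form_add)
qed

lemma is_quad_diff: "is_quad f \<Longrightarrow> is_quad g \<Longrightarrow> is_quad (\<lambda>y. f y - g y)"
proof -
  assume "is_quad f" "is_quad g"
  then obtain p q where "\<And>y. f y = quad_form p y" "\<And>y. g y = quad_form q y"
    unfolding is_quad_def by metis
  then show ?thesis by (intro is_quadI) (simp add: quad_form_diff)
qed

lemma is_quad_cmult: "is_quad f \<Longrightarrow> is_quad (\<lambda>y. r * f y)"
proof -
  assume "is_quad f"
  then obtain p where "\<And>y. f y = quad_form p y"
    unfolding is_quad_def by metis
  then show ?thesis by (intro is_quadI) (simp add: quad_form_cmult)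
qed

lemma is_quad_sum: "finite I \<Longrightarrow> (\<And>i. i \<in> I \<Longrightarrow> is_quad (f i)) \<Longrightarrow> is_quad (\<lambda>y. \<Sum>i\<in>I. f i y)"
proof (induction I rule: finite_induct)
  case empty
  show ?case by (rule is_quadI[of _ "\<lambda>i j. 0"]) (simp add: quad_form_def)
next
  case (insert i I)
  then show ?case by (simp add: is_quad_add)
qed

lemmas is_quad_intros = is_quad_add is_quad_diff is_quad_cmult is_quad_sum is_quad_lin_mult
  is_quad_quad_form finite_class.finite_UNIV

section \<open>The projective Ricci curvature of the reduced spray\<close>

context randers_chart
begin

text \<open>The contracted Christoffel symbols, classically the differential of the logarithm of the
  Riemannian volume density.\<close>

definition dv where "dv k x = (\<Sum>i\<in>UNIV. \<Gamma> i i k x)"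

lemma smooth_dv: "smooth_on U (dv k)"
  unfolding dv_def[abs_def] by (intro smooth_on_sum smooth_\<Gamma> U)

lemma div_H: "x \<in> U \<Longrightarrow> y \<noteq> 0 \<Longrightarrow> spray_div H x y = lin_form (\<lambda>k. dv k x) y"
proof -
  assume x: "x \<in> U" and y: "y \<noteq> 0"
  have "spray_div H x y = (\<Sum>i\<in>UNIV. lin_form (\<lambda>k. \<Gamma> i i k x) y)
      + (\<Sum>i\<in>UNIV. low i x y * T0 i x y) / \<alpha> x y + (\<Sum>i\<in>UNIV. T i i x) * \<alpha> x y"
    unfolding spray_div_def has_pd_imp_pd[OF has_pd_H_snd[OF x y]]
    by (simp add: sum.distrib sum_distrib_right sum_divide_distrib)
  then show ?thesis
    by (simp add: low_T0[OF x] trace_T[OF x] lin_form_sum dv_def)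
qed

text \<open>Metric compatibility in coordinates, that is, \<alpha> is parallel: after contraction
  with y twice, two of the three derivatives in \<open>\<Gamma>l\<close> cancel.\<close>

lemma low_\<Gamma>: "x \<in> U \<Longrightarrow>
    (\<Sum>i\<in>UNIV. low i x y * lin_form (\<lambda>k. \<Gamma> i j k x) y) = quad_form (\<lambda>i k. pd j (a i k) x) y / 2"
proof -
  assume x: "x \<in> U"
  have "(\<Sum>i\<in>UNIV. a l i x * lin_form (\<lambda>k. \<Gamma> i j k x) y) = lin_form (\<lambda>k. \<Gamma>l l j k x) y" for l
    unfolding lin_form_cmult lin_form_sum by (simp add: lower_\<Gamma>[OF x])
  then have "(\<Sum>i\<in>UNIV. low i x y * lin_form (\<lambda>k. \<Gamma> i j k x) y) = quad_form (\<lambda>l k. \<Gamma>l l j k x) y"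
    unfolding sum_low_mult[OF x] by (simp add: quad_form_lin_form)
  moreover have "quad_form (\<lambda>l k. pd k (a l j) x) y = quad_form (\<lambda>l k. pd l (a j k) x) y"
    unfolding quad_form_lin_form'[of "\<lambda>l k. pd k (a l j) x"] quad_form_lin_form[of "\<lambda>l k. pd l (a j k) x"]
    by (simp add: pd_a_sym[OF x, of _ j])
  then have "quad_form (\<lambda>l k. \<Gamma>l l j k x) y = quad_form (\<lambda>i k. pd j (a i k) x) y / 2"
    unfolding \<Gamma>l_def diff_divide_distrib add_divide_distrib quad_form_diff[symmetric] quad_form_add[symmetric]
    using quad_form_cmult[of "1/2" "\<lambda>l k. pd k (a l j) x" y]
      quad_form_cmult[of "1/2" "\<lambda>l k. pd l (a j k) x" y]
      quad_form_cmult[of "1/2" "\<lambda>l k. pd j (a l k) x" y] by simp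
  ultimately show ?thesis by simp
qed

text \<open>The coefficients of \<lambda>. The first three contributions come from the x-derivative
  of \<open>T\<close>, from the trace of the squared Jacobian and from the divergence; together they
  are twice the Levi-Civita divergence of \<open>T\<close>. The last one comes from S and compares
  the given density with the Riemannian one.\<close>

definition odd_coeff where
  "odd_coeff c k x = 2 * (\<Sum>i\<in>UNIV. pd i (T i k) x)
     - 2 * (\<Sum>i\<in>UNIV. \<Sum>j\<in>UNIV. \<Gamma> i j k x * T j i x)
     + 2 * (\<Sum>j\<in>UNIV. dv j x * T j k x)
     - 2 * ((real CARD('n) - 1) / (real CARD('n) + 1)) * (\<Sum>j\<in>UNIV. (dv j x - c j x) * T j k x)"

text \<open>The divergence and S are linear in y, so their derivatives along \<open>H\<close> have
  this shape, with \<open>w\<close> their constant gradient; the result splits into a quadratic form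
  and \<alpha> times a linear form.\<close>

lemma sum_H_mult:
  "(\<Sum>j\<in>UNIV. H j x y * w j) = (\<Sum>j\<in>UNIV. w j * quad_form (\<lambda>i k. \<Gamma> j i k x / 2) y)
     + \<alpha> x y * lin_form (\<lambda>k. \<Sum>j\<in>UNIV. w j * T j k x) y"
proof -
  have "lin_form (\<lambda>k. \<Sum>j\<in>UNIV. w j * T j k x) y = (\<Sum>j\<in>UNIV. w j * T0 j x y)"
    by (simp add: T0_def lin_form_cmult lin_form_sum)
  then show ?thesis
    by (simp add: H_def sum.distrib distrib_left distrib_right sum_distrib_left mult_ac)
qed

text \<open>The Jacobian has three pieces: the Christoffel part, a rank one part with factor
  1/\<alpha>, and \<alpha> times \<open>T\<close>. Of their products, the square of the rank one
  part vanishes by \<open>low_T0\<close>; the products of the Christoffel part with the rank one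
  part are evaluated by \<open>low_\<Gamma>\<close> and give the only remaining 1/\<alpha> term;
  \<alpha> squared is a quadratic form again.\<close>

lemma pd_H_square:
  assumes x: "x \<in> U" and y: "y \<noteq> 0"
  shows "(\<Sum>i\<in>UNIV. \<Sum>j\<in>UNIV. pd j (H i x) y * pd i (H j x) y)
    = (\<Sum>i\<in>UNIV. \<Sum>j\<in>UNIV. lin_form (\<lambda>k. \<Gamma> i j k x) y * lin_form (\<lambda>k. \<Gamma> j i k x) y)
     + (\<Sum>j\<in>UNIV. quad_form (\<lambda>i k. pd j (a i k) x) y * T0 j x y) / \<alpha> x y
     + 2 * \<alpha> x y * lin_form (\<lambda>k. \<Sum>i\<in>UNIV. \<Sum>j\<in>UNIV. \<Gamma> i j k x * T j i x) y
     + 2 * (\<Sum>i\<in>UNIV. \<Sum>j\<in>UNIV. T j i x * (low j x y * T0 i x y))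
     + (\<Sum>i\<in>UNIV. \<Sum>j\<in>UNIV. T i j x * T j i x) * quad_form (\<lambda>i j. a i j x) y"
proof -
  define A where "A = \<alpha> x y"
  have A: "A \<noteq> 0" "A * A = quad_form (\<lambda>i j. a i j x) y"
    using \<alpha>_pos[OF x y] \<alpha>_square[OF x, of y] by (simp_all add: A_def power2_eq_square)
  define g where "g = (\<lambda>i j. lin_form (\<lambda>k. \<Gamma> i j k x) y)"
  define t where "t = (\<lambda>i. T0 i x y)"
  define l where "l = (\<lambda>i. low i x y)"
  have fold: "lin_form (\<lambda>k. \<Gamma> i j k x) y = g i j" "T0 i x y = t i" "low i x y = l i" for i j
    by (simp_all add: g_def t_def l_def)
  have e: "pd j (H i x) y * pd i (H j x) y = g i j * g j i
      + (l i * g i j * t j) / A + (l j * g j i * t i) / A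
      + A * (g i j * T j i x) + A * (g j i * T i j x)
      + (l j * t j) * (l i * t i) / (A * A)
      + T j i x * (l j * t i) + T i j x * (l i * t j) + (A * A) * (T i j x * T j i x)" for i j
    unfolding has_pd_imp_pd[OF has_pd_H_snd[OF x y]] fold A_def[symmetric]
    using A(1) by (simp add: field_simps)
  have 1: "(\<Sum>i\<in>UNIV. \<Sum>j\<in>UNIV. l j * g j i * t i) = (\<Sum>j\<in>UNIV. quad_form (\<lambda>i k. pd j (a i k) x) y * t j) / 2"
  proof -
    have "(\<Sum>j\<in>UNIV. l j * g j i * t i) = quad_form (\<lambda>i' k. pd i (a i' k) x) y * t i / 2" for i
      unfolding l_def g_def sum_distrib_right[symmetric] low_\<Gamma>[OF x] by simp
    then show ?thesis by (simp only: sum_divide_distrib)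
  qed
  have swap1: "(\<Sum>i\<in>UNIV. \<Sum>j\<in>UNIV. l i * g i j * t j) = (\<Sum>j\<in>UNIV. quad_form (\<lambda>i k. pd j (a i k) x) y * t j) / 2"
    by (subst sum.swap) (rule 1)
  have 2: "(\<Sum>i\<in>UNIV. \<Sum>j\<in>UNIV. g i j * T j i x)
      = lin_form (\<lambda>k. \<Sum>i\<in>UNIV. \<Sum>j\<in>UNIV. \<Gamma> i j k x * T j i x) y"
    unfolding lin_form_sum[symmetric] g_def
    by (simp add: lin_form_cmult[symmetric] mult.commute[of _ "T _ _ _"])
  have swap2: "(\<Sum>i\<in>UNIV. \<Sum>j\<in>UNIV. g j i * T i j x)
      = lin_form (\<lambda>k. \<Sum>i\<in>UNIV. \<Sum>j\<in>UNIV. \<Gamma> i j k x * T j i x) y"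
    by (subst sum.swap) (rule 2)
  have 3: "(\<Sum>i\<in>UNIV. \<Sum>j\<in>UNIV. (l j * t j) * (l i * t i)) = 0"
    unfolding sum_distrib_right[symmetric] by (simp add: l_def t_def low_T0[OF x])
  have 4: "(\<Sum>i\<in>UNIV. \<Sum>j\<in>UNIV. T i j x * (l i * t j)) = (\<Sum>i\<in>UNIV. \<Sum>j\<in>UNIV. T j i x * (l j * t i))"
    by (rule sum.swap)
  show ?thesis
    unfolding e sum.distrib sum_distrib_left[symmetric] sum_divide_distrib[symmetric] 1 swap1 2 swap2 3 4
      A(2) A_def[symmetric]
    by (simp add: g_def l_def t_def A_def)
qed

lemma spray_PRic_H:
  assumes x: "x \<in> U" and c: "\<And>m. smooth_on U (c m)"
  shows "\<exists>q. \<forall>y. y \<noteq> 0 \<longrightarrow> spray_PRic H c x y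
    = quad_form q y + \<alpha> x y * lin_form (\<lambda>k. odd_coeff c k x) y"
proof -
  define \<kappa> where "\<kappa> = (real CARD('n) - 1) / (real CARD('n) + 1)"
  define \<mu> where "\<mu> = (real CARD('n) - 1) / (real CARD('n) + 1)\<^sup>2"
  define w where "w = (\<lambda>k x. dv k x - c k x)"
  have w: "smooth_on U (w k)" for k
    unfolding w_def by (intro smooth_on_diff smooth_dv c U)
  \<comment> \<open>The even part: all contributions of order 0 or 2 in \<alpha>, with the square of
    \<alpha> replaced by its quadratic form.\<close>
  define Q where "Q = (\<lambda>y. 2 * (\<Sum>i\<in>UNIV. quad_form (\<lambda>j k. pd i (\<Gamma> i j k) x / 2) y)
    - quad_form (\<lambda>j k. pd j (dv k) x) y
    + 2 * (\<Sum>j\<in>UNIV. dv j x * quad_form (\<lambda>i k. \<Gamma> j i k x / 2) y)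
    - ((\<Sum>i\<in>UNIV. \<Sum>j\<in>UNIV. lin_form (\<lambda>k. \<Gamma> i j k x) y * lin_form (\<lambda>k. \<Gamma> j i k x) y)
       + 2 * (\<Sum>i\<in>UNIV. \<Sum>j\<in>UNIV. T j i x * (low j x y * T0 i x y))
       + (\<Sum>i\<in>UNIV. \<Sum>j\<in>UNIV. T i j x * T j i x) * quad_form (\<lambda>i j. a i j x) y)
    + \<kappa> * (quad_form (\<lambda>j k. pd j (w k) x) y - 2 * (\<Sum>j\<in>UNIV. w j x * quad_form (\<lambda>i k. \<Gamma> j i k x / 2) y))
    + \<mu> * (lin_form (\<lambda>k. w k x) y * lin_form (\<lambda>k. w k x) y))"
  have "is_quad Q"
    unfolding Q_def low_def T0_def by (intro is_quad_intros)
  then obtain q where q: "\<And>y. Q y = quad_form q y" unfolding is_quad_def by metis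
  have "spray_PRic H c x y = Q y + \<alpha> x y * lin_form (\<lambda>k. odd_coeff c k x) y" if y: "y \<noteq> 0" for y
  proof -
    have yV: "y \<in> V" using y by simp
    have SH: "spray_S H c x y = lin_form (\<lambda>k. w k x) y" if "x \<in> U" "y \<in> V" for x y
    proof -
      have "y \<noteq> 0" using that by simp
      then have "spray_S H c x y = lin_form (\<lambda>k. dv k x) y - lin_form (\<lambda>k. c k x) y"
        unfolding spray_S_def div_H[OF that(1) \<open>y \<noteq> 0\<close>] by (simp add: lin_form_def mult.commute)
      then show ?thesis by (simp add: lin_form_diff w_def)
    qed
    have dH: "spray_div H x y = lin_form (\<lambda>k. dv k x) y" if "x \<in> U" "y \<in> V" for x y
      by (rule div_H[OF that(1)]) (use that in simp)
    have px: "pd j (\<lambda>x. f x y) x = lin_form (\<lambda>k. pd j (v k) x) y"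
      if "\<And>x y. x \<in> U \<Longrightarrow> y \<in> V \<Longrightarrow> f x y = lin_form (\<lambda>k. v k x) y" "\<And>k. smooth_on U (v k)" for f v j
    proof -
      have "pd j (\<lambda>x. f x y) x = pd j (\<lambda>x. lin_form (\<lambda>k. v k x) y) x"
        by (rule pd_fst_cong[where U = U and V = V, OF U x yV that(1)])
      also have "\<dots> = lin_form (\<lambda>k. pd j (v k) x) y"
        by (intro has_pd_imp_pd has_pd_lin_form_coeff smooth_on_has_pd[OF that(2) x])
      finally show ?thesis .
    qed
    have py: "pd j (f x) y = v j x"
      if "\<And>x y. x \<in> U \<Longrightarrow> y \<in> V \<Longrightarrow> f x y = lin_form (\<lambda>k. v k x) y" for f v j
    proof -
      have "pd j (f x) y = pd j (\<lambda>y. lin_form (\<lambda>k. v k x) y) y"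
        by (rule pd_snd_cong[where U = U and V = V, OF V x yV that])
      also have "\<dots> = v j x"
        by (intro has_pd_imp_pd has_pd_lin_form)
      finally show ?thesis .
    qed
    have 1: "pd j (\<lambda>x. spray_div H x y) x = lin_form (\<lambda>k. pd j (dv k) x) y" for j
      by (rule px[OF dH smooth_dv])
    have 2: "pd j (spray_div H x) y = dv j x" for j
      by (rule py[OF dH])
    have 3: "pd j (\<lambda>x. spray_S H c x y) x = lin_form (\<lambda>k. pd j (w k) x) y" for j
      by (rule px[OF SH w])
    have 4: "pd j (spray_S H c x) y = w j x" for j
      by (rule py[OF SH])
    \<comment> \<open>The singular 1/\<alpha> term. It enters with a plus sign through the
      x-derivative of \<alpha> in \<open>H\<close> and with a minus sign through
      \<open>pd_H_square\<close>.\<close>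
    define C where "C = (\<Sum>j\<in>UNIV. quad_form (\<lambda>i k. pd j (a i k) x) y * T0 j x y) / \<alpha> x y"
    have 5: "2 * (\<Sum>i\<in>UNIV. pd i (\<lambda>x. H i x y) x) = 2 * (\<Sum>i\<in>UNIV. quad_form (\<lambda>j k. pd i (\<Gamma> i j k) x / 2) y)
       + C + \<alpha> x y * lin_form (\<lambda>k. 2 * (\<Sum>i\<in>UNIV. pd i (T i k) x)) y"
      unfolding has_pd_imp_pd[OF has_pd_H_fst[OF x y]] lin_form_cmult[symmetric] lin_form_sum[symmetric]
        C_def
      by (simp add: sum.distrib sum_distrib_left sum_divide_distrib mult_ac)
    have odd: "lin_form (\<lambda>k. odd_coeff c k x) y = lin_form (\<lambda>k. 2 * (\<Sum>i\<in>UNIV. pd i (T i k) x)) y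
      - 2 * lin_form (\<lambda>k. \<Sum>i\<in>UNIV. \<Sum>j\<in>UNIV. \<Gamma> i j k x * T j i x) y
      + 2 * lin_form (\<lambda>k. \<Sum>j\<in>UNIV. dv j x * T j k x) y
      - 2 * \<kappa> * lin_form (\<lambda>k. \<Sum>j\<in>UNIV. w j x * T j k x) y"
      unfolding odd_coeff_def \<kappa>_def[symmetric] w_def
      unfolding lin_form_cmult lin_form_add lin_form_diff ..
    have "spray_PRic H c x y = 2 * (\<Sum>i\<in>UNIV. pd i (\<lambda>x. H i x y) x)
      - quad_form (\<lambda>j k. pd j (dv k) x) y + 2 * (\<Sum>j\<in>UNIV. H j x y * dv j x)
      - (\<Sum>i\<in>UNIV. \<Sum>j\<in>UNIV. pd j (H i x) y * pd i (H j x) y)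
      + \<kappa> * (quad_form (\<lambda>j k. pd j (w k) x) y - 2 * (\<Sum>j\<in>UNIV. H j x y * w j x))
      + \<mu> * (lin_form (\<lambda>k. w k x) y * lin_form (\<lambda>k. w k x) y)"
      unfolding spray_PRic_def spray_ricci_eq[OF U V smooth_H x yV] 1 2 3 4 SH[OF x yV]
        \<kappa>_def[symmetric] \<mu>_def[symmetric] quad_form_lin_form[symmetric]
        power2_eq_square[of "lin_form _ _"] ..
    then show ?thesis
      unfolding 5 sum_H_mult pd_H_square[OF x y] odd Q_def C_def
      by (simp add: algebra_simps)
  qed
  then show ?thesis using q by auto
qed

lemma odd_coeff_1:
  assumes "x \<in> U" "CARD('n) = 1"
  shows "odd_coeff c k x = 0"
proof -
  have "i = j" for i j :: 'n
    using assms(2) by (metis card_1_singletonE UNIV_I singletonD)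
  then have "s i j x = 0" for i j x
    using s_skew[of i i x] by (metis equal_neg_zero)
  then have T: "T i j x = 0" for i j x by (simp add: T_def)
  then have "T i j = (\<lambda>x. 0)" for i j by (rule ext)
  then have "pd m (T i j) x = 0" for m i j
    using has_pd_imp_pd[OF has_pd_const] by metis
  then show ?thesis using T by (simp add: odd_coeff_def)
qed

end

section \<open>The spray of a Randers metric\<close>

context randers_chart
begin

definition R where "R x y = \<alpha> x y + \<beta> x y"

definition Ry where "Ry l x y = low l x y / \<alpha> x y + b l x"

definition Rx where
  "Rx k x y = quad_form (\<lambda>i j. pd k (a i j) x) y / (2 * \<alpha> x y) + lin_form (\<lambda>i. pd k (b i) x) y"

text \<open>The y-Hessian of \<alpha>; \<beta> is linear in y and contributes nothing.\<close>

definition Ryy where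
  "Ryy l j x y = a l j x / \<alpha> x y - low l x y * low j x y / (\<alpha> x y) ^ 3"

definition Rxy where
  "Rxy k l x y = lin_form (\<lambda>j. pd k (a l j) x) y / \<alpha> x y
     - quad_form (\<lambda>i j. pd k (a i j) x) y * low l x y / (2 * (\<alpha> x y) ^ 3) + pd k (b l) x"

text \<open>\<open>P\<close> is the solution of the radial component \<open>2 F\<^bsub>y\<^sup>j\<^esub> G\<^sup>j = F\<^bsub>x\<^sup>k\<^esub> y\<^sup>k\<close> of the Euler-Lagrange equations.\<close>

definition P where
  "P x y = ((\<Sum>k\<in>UNIV. y $ k * Rx k x y) / 2 - (\<Sum>j\<in>UNIV. Ry j x y * H j x y)) / R x y"

lemma R_pos: "x \<in> U \<Longrightarrow> y \<noteq> 0 \<Longrightarrow> R x y > 0"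
  using b_less[of x y] by (simp add: R_def \<alpha>_def \<beta>_def)

lemma has_pd_R_snd: "x \<in> U \<Longrightarrow> y \<noteq> 0 \<Longrightarrow> has_pd (R x) (Ry l x y) l y"
  unfolding R_def[abs_def] Ry_def \<beta>_def by (intro has_pd_add has_pd_\<alpha>_snd has_pd_lin_form)

lemma has_pd_R_fst: "x \<in> U \<Longrightarrow> y \<noteq> 0 \<Longrightarrow> has_pd (\<lambda>x. R x y) (Rx k x y) k x"
  unfolding R_def Rx_def \<beta>_def
  by (intro has_pd_add has_pd_\<alpha>_fst has_pd_lin_form_coeff has_pd_b)

lemma has_pd_Ry: 
  assumes x: "x \<in> U" and y: "y \<noteq> 0"
  shows "has_pd (Ry l x) (Ryy l j x y) j y"
proof -
  have A: "\<alpha> x y \<noteq> 0" using \<alpha>_pos[OF x y] by simp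
  have "has_pd (\<lambda>y. low l x y / \<alpha> x y + b l x)
     ((a l j x * \<alpha> x y - low l x y * (low j x y / \<alpha> x y)) / (\<alpha> x y * \<alpha> x y) + 0) j y"
    by (intro has_pd_add has_pd_divide has_pd_low has_pd_\<alpha>_snd has_pd_const x y A)
  moreover have "(a l j x * \<alpha> x y - low l x y * (low j x y / \<alpha> x y)) / (\<alpha> x y * \<alpha> x y) + 0 = Ryy l j x y"
    using A by (simp add: Ryy_def field_simps power3_eq_cube)
  ultimately show ?thesis by (simp add: Ry_def[abs_def])
qed

lemma has_pd_Rx:
  assumes x: "x \<in> U" and y: "y \<noteq> 0"
  shows "has_pd (Rx k x) (Rxy k l x y) l y"
proof -
  have A: "\<alpha> x y \<noteq> 0" "2 * \<alpha> x y \<noteq> 0" using \<alpha>_pos[OF x y] by simp_all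
  define E where "E = quad_form (\<lambda>i j. pd k (a i j) x) y"
  define m where "m = lin_form (\<lambda>j. pd k (a l j) x) y"
  have "has_pd (\<lambda>y. quad_form (\<lambda>i j. pd k (a i j) x) y / (2 * \<alpha> x y) + lin_form (\<lambda>i. pd k (b i) x) y)
     ((lin_form (\<lambda>j. pd k (a l j) x + pd k (a j l) x) y * (2 * \<alpha> x y)
        - quad_form (\<lambda>i j. pd k (a i j) x) y * (2 * (low l x y / \<alpha> x y))) / (2 * \<alpha> x y * (2 * \<alpha> x y))
      + pd k (b l) x) l y"
    by (intro has_pd_add has_pd_divide has_pd_quad_form has_pd_lin_form has_pd_cmult has_pd_\<alpha>_snd x y A)
  moreover have "lin_form (\<lambda>j. pd k (a l j) x + pd k (a j l) x) y = 2 * m"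
    by (simp add: m_def lin_form_cmult pd_a_sym[OF x, of k _ l])
  moreover have "(2 * m * (2 * \<alpha> x y) - E * (2 * (low l x y / \<alpha> x y))) / (2 * \<alpha> x y * (2 * \<alpha> x y))
      + pd k (b l) x = Rxy k l x y"
    using A unfolding Rxy_def E_def[symmetric] m_def[symmetric]
    by (simp add: field_simps power3_eq_cube)
  ultimately show ?thesis by (simp add: Rx_def[abs_def] E_def)
qed

lemma pd_square_snd:
  "x \<in> U \<Longrightarrow> y \<noteq> 0 \<Longrightarrow> pd i (\<lambda>y. (R x y)\<^sup>2) y = 2 * (R x y * Ry i x y)"
proof -
  assume x: "x \<in> U" and y: "y \<noteq> 0"
  have "has_pd (\<lambda>y. R x y * R x y) (Ry i x y * R x y + Ry i x y * R x y) i y"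
    by (intro has_pd_mult has_pd_R_snd x y)
  from has_pd_imp_pd[OF this] show ?thesis by (simp add: power2_eq_square)
qed

lemma pd_square_fst:
  "x \<in> U \<Longrightarrow> y \<noteq> 0 \<Longrightarrow> pd k (\<lambda>x. (R x y)\<^sup>2) x = 2 * (R x y * Rx k x y)"
proof -
  assume x: "x \<in> U" and y: "y \<noteq> 0"
  have "has_pd (\<lambda>x. R x y * R x y) (Rx k x y * R x y + Rx k x y * R x y) k x"
    by (intro has_pd_mult has_pd_R_fst x y)
  from has_pd_imp_pd[OF this] show ?thesis by (simp add: power2_eq_square)
qed

text \<open>Up to the factor 1/\<alpha> the Hessian is the orthogonal projection off y with its
  index lowered. It therefore sees a vector only through its lowered components, which for the spray
  are computable.\<close>

lemma sum_Ryy_mult: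
  assumes x: "x \<in> U"
  shows "(\<Sum>j\<in>UNIV. Ryy l j x y * u j) = (\<Sum>j\<in>UNIV. a l j x * u j) / \<alpha> x y
    - low l x y * (\<Sum>m\<in>UNIV. y $ m * (\<Sum>j\<in>UNIV. a m j x * u j)) / (\<alpha> x y) ^ 3"
proof -
  have "(\<Sum>j\<in>UNIV. Ryy l j x y * u j) = (\<Sum>j\<in>UNIV. a l j x * u j / \<alpha> x y - low l x y * (low j x y * u j) / (\<alpha> x y) ^ 3)"
    by (intro sum.cong refl) (simp add: Ryy_def left_diff_distrib)
  then show ?thesis
    by (simp add: sum_subtractf sum_divide_distrib[symmetric] sum_distrib_left[symmetric]
        sum_low_mult[OF x, symmetric])
qed

lemma sum_Ry_mult_y:
  assumes x: "x \<in> U" and y: "y \<noteq> 0"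
  shows "(\<Sum>j\<in>UNIV. Ry j x y * y $ j) = R x y"
proof -
  have "\<alpha> x y \<noteq> 0" using \<alpha>_pos[OF x y] by simp
  have "(\<Sum>j\<in>UNIV. Ry j x y * y $ j) = (\<Sum>i\<in>UNIV. y $ i * low i x y / \<alpha> x y + b i x * y $ i)"
    by (simp add: Ry_def distrib_left mult.commute)
  also have "\<dots> = (\<Sum>i\<in>UNIV. y $ i * low i x y) / \<alpha> x y + lin_form (\<lambda>i. b i x) y"
    by (simp only: sum.distrib lin_form_def sum_divide_distrib)
  finally show ?thesis
    unfolding sum_low \<alpha>_square[OF x, symmetric] using \<open>\<alpha> x y \<noteq> 0\<close>
    by (simp add: R_def \<beta>_def power2_eq_square)
qed

text \<open>The value at u is the square of the derivative of F along u plus F/\<alpha> times the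
  squared length of \<open>u - t *\<^sub>R y\<close>, the component of u orthogonal to y. If that
  component is zero, u is a nonzero multiple of y, and the derivative of F along y is F > 0.\<close>

lemma fundamental_tensor_pos:
  assumes x: "x \<in> U" and y: "y \<noteq> 0" and u: "u \<noteq> 0"
  shows "0 < quad_form (\<lambda>i j. Ry j x y * Ry i x y + R x y * Ryy i j x y) u"
proof -
  define A where "A = \<alpha> x y"
  define E where "E = quad_form (\<lambda>i j. a i j x)"
  define p where "p = (\<Sum>m\<in>UNIV. u $ m * low m x y)"
  define t where "t = p / E y"
  have A: "A > 0" "E y = A * A" using \<alpha>_pos[OF x y] \<alpha>_square[OF x, of y]
    by (simp_all add: A_def E_def power2_eq_square)
  have p': "p = (\<Sum>m\<in>UNIV. y $ m * (\<Sum>j\<in>UNIV. a m j x * u $ j))"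
    using sum_low_mult[OF x, of y "\<lambda>j. u $ j"] by (simp add: p_def mult.commute)
  have "quad_form (\<lambda>i j. Ryy i j x y) u = (\<Sum>l\<in>UNIV. u $ l * (\<Sum>j\<in>UNIV. Ryy l j x y * u $ j))"
    by (simp add: quad_form_lin_form lin_form_def)
  also have "\<dots> = E u / A - p * p / A ^ 3"
    unfolding sum_Ryy_mult[OF x] p'[symmetric] right_diff_distrib sum_subtractf
      times_divide_eq_right sum_divide_distrib[symmetric] mult.assoc[symmetric]
      sum_distrib_right[symmetric] p_def[symmetric] A_def[symmetric]
    by (simp add: E_def quad_form_lin_form lin_form_def)
  also have "\<dots> = (E u - p * p / E y) / A"
    using A(1) by (simp add: A(2) field_simps power3_eq_cube)
  finally have yy: "quad_form (\<lambda>i j. Ryy i j x y) u = (E u - p * p / E y) / A" .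
  have Ew: "E (u - t *\<^sub>R y) = E u - p * p / E y"
  proof -
    have "E (u - t *\<^sub>R y) = (\<Sum>i\<in>UNIV. (u - t *\<^sub>R y) $ i * low i x (u - t *\<^sub>R y))"
      by (simp add: E_def quad_form_lin_form low_def)
    also have "\<dots> = (\<Sum>i\<in>UNIV. u $ i * low i x u - t * (u $ i * low i x y) - t * (y $ i * low i x u)
        + t * t * (y $ i * low i x y))"
    proof (intro sum.cong refl)
      fix i
      have low: "low i x (u - t *\<^sub>R y) = low i x u - t * low i x y"
      proof -
        have "u - t *\<^sub>R y = u + (- t) *\<^sub>R y" by simp
        then show ?thesis unfolding low_def by (simp only: lin_form_plus lin_form_scaleR)
      qed
      show "(u - t *\<^sub>R y) $ i * low i x (u - t *\<^sub>R y) = u $ i * low i x u - t * (u $ i * low i x y)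
        - t * (y $ i * low i x u) + t * t * (y $ i * low i x y)"
        unfolding low by (simp add: algebra_simps)
    qed
    also have "\<dots> = E u - t * p - t * p + t * t * E y"
    proof -
      have "(\<Sum>i\<in>UNIV. y $ i * low i x u) = p"
        by (simp add: p' low_def lin_form_def)
      then show ?thesis
        unfolding sum.distrib sum_subtractf sum_distrib_left[symmetric] sum_low p_def[symmetric] E_def
        by simp
    qed
    also have "\<dots> = E u - p * p / E y"
      using A by (simp add: t_def)
    finally show ?thesis .
  qed
  have "quad_form (\<lambda>i j. Ry j x y * Ry i x y + R x y * Ryy i j x y) u
     = (lin_form (\<lambda>i. Ry i x y) u)\<^sup>2 + R x y * (E (u - t *\<^sub>R y) / A)"
    unfolding Ew yy[symmetric] power2_eq_square lin_form_mult quad_form_cmult quad_form_add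
    by (simp add: mult.commute)
  moreover have "0 < (lin_form (\<lambda>i. Ry i x y) u)\<^sup>2 + R x y * (E (u - t *\<^sub>R y) / A)"
  proof (cases "u - t *\<^sub>R y = 0")
    case False
    then have "E (u - t *\<^sub>R y) > 0" using a_pos[OF x] by (simp add: E_def)
    then show ?thesis using R_pos[OF x y] A(1) by (intro add_nonneg_pos) simp_all
  next
    case True
    then have ut: "u = t *\<^sub>R y" by simp
    with u have "t \<noteq> 0" by auto
    have "lin_form (\<lambda>i. Ry i x y) y = R x y"
      unfolding lin_form_def by (rule sum_Ry_mult_y[OF x y])
    then have "lin_form (\<lambda>i. Ry i x y) u \<noteq> 0"
      using \<open>t \<noteq> 0\<close> R_pos[OF x y] unfolding ut lin_form_scaleR by simp
    then show ?thesis unfolding True by (simp add: E_def quad_form_def)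
  qed
  ultimately show ?thesis by simp
qed

text \<open>Lowering returns \<open>\<Gamma>l\<close>, and two of its three derivatives agree after
  contraction with y twice. With the factor 1/2 in the spray this gives the weights 1/2 and
  1/4.\<close>

lemma lower_geodesic:
  assumes x: "x \<in> U"
  shows "(\<Sum>j\<in>UNIV. a l j x * quad_form (\<lambda>i k. \<Gamma> j i k x / 2) y)
    = (\<Sum>k\<in>UNIV. y $ k * lin_form (\<lambda>j. pd k (a l j) x) y) / 2 - quad_form (\<lambda>i j. pd l (a i j) x) y / 4"
proof -
  have "(\<Sum>j\<in>UNIV. a l j x * quad_form (\<lambda>i k. \<Gamma> j i k x / 2) y) = quad_form (\<lambda>i k. \<Gamma>l l i k x / 2) y"
    unfolding quad_form_cmult quad_form_sum times_divide_eq_right sum_divide_distrib[symmetric]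
      lower_\<Gamma>[OF x] ..
  also have "\<dots> = quad_form (\<lambda>i k. pd i (a l k) x) y / 4 + quad_form (\<lambda>i k. pd k (a l i) x) y / 4
      - quad_form (\<lambda>i k. pd l (a i k) x) y / 4"
  proof -
    have "quad_form (\<lambda>i k. \<Gamma>l l i k x / 2) y = (1/4) * (quad_form (\<lambda>i k. pd i (a l k) x) y
       + quad_form (\<lambda>i k. pd k (a l i) x) y - quad_form (\<lambda>i k. pd l (a i k) x) y)"
      unfolding quad_form_cmult quad_form_add quad_form_diff by (simp add: \<Gamma>l_def)
    then show ?thesis by (simp add: field_simps)
  qed
  finally show ?thesis
    unfolding quad_form_lin_form[of "\<lambda>i k. pd i (a l k) x"] quad_form_lin_form'[of "\<lambda>i k. pd k (a l i) x"]
    by simp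
qed

text \<open>The Euler-Lagrange equations \<open>2 F\<^bsub>y\<^sup>l y\<^sup>j\<^esub> G\<^sup>j = F\<^bsub>x\<^sup>k y\<^sup>l\<^esub> y\<^sup>k - F\<^bsub>x\<^sup>l\<^esub>\<close>; they do not determine the component of
  the spray in direction \<open>y\<close>, which is why \<open>p\<close> is arbitrary.\<close>

lemma euler_lagrange:
  assumes x: "x \<in> U" and y: "y \<noteq> 0"
  shows "(\<Sum>j\<in>UNIV. Ryy l j x y * (H j x y + p * y $ j))
    = ((\<Sum>k\<in>UNIV. Rxy k l x y * y $ k) - Rx l x y) / 2"
proof -
  define A where "A = \<alpha> x y"
  have A: "A \<noteq> 0" "quad_form (\<lambda>i j. a i j x) y = A * A"
    using \<alpha>_pos[OF x y] \<alpha>_square[OF x, of y] by (simp_all add: A_def power2_eq_square)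
  define M where "M = (\<lambda>l. \<Sum>k\<in>UNIV. y $ k * lin_form (\<lambda>j. pd k (a l j) x) y)"
  define E where "E = (\<lambda>k. quad_form (\<lambda>i j. pd k (a i j) x) y)"
  define EE where "EE = (\<Sum>k\<in>UNIV. y $ k * E k)"
  define s0 where "s0 = (\<lambda>l. lin_form (\<lambda>k. s l k x) y)"
  have low_G: "(\<Sum>j\<in>UNIV. a m j x * (H j x y + p * y $ j)) = M m / 2 - E m / 4 + A * s0 m + p * low m x y" for m
  proof -
    have "(\<Sum>j\<in>UNIV. a m j x * (H j x y + p * y $ j))
       = (\<Sum>j\<in>UNIV. a m j x * quad_form (\<lambda>i k. \<Gamma> j i k x / 2) y)
         + A * (\<Sum>j\<in>UNIV. a m j x * T0 j x y) + p * low m x y"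
      by (simp add: H_def low_def lin_form_def A_def distrib_left sum.distrib sum_distrib_left mult_ac)
    then show ?thesis
      unfolding lower_geodesic[OF x] lower_T0[OF x] M_def E_def s0_def by simp
  qed
  have yM: "(\<Sum>m\<in>UNIV. y $ m * M m) = EE"
  proof -
    have "(\<Sum>m\<in>UNIV. y $ m * M m) = (\<Sum>k\<in>UNIV. \<Sum>m\<in>UNIV. y $ m * (y $ k * lin_form (\<lambda>j. pd k (a m j) x) y))"
      unfolding M_def sum_distrib_left by (rule sum.swap)
    then show ?thesis
      by (simp add: EE_def E_def quad_form_lin_form sum_distrib_left mult_ac)
  qed
  have ys: "(\<Sum>m\<in>UNIV. y $ m * s0 m) = 0"
    unfolding s0_def quad_form_lin_form[symmetric] by (rule s_quad)
  have y_low_G: "(\<Sum>m\<in>UNIV. y $ m * (M m / 2 - E m / 4 + A * s0 m + p * low m x y)) = EE / 4 + p * (A * A)"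
  proof -
    have "(\<Sum>m\<in>UNIV. y $ m * (M m / 2 - E m / 4 + A * s0 m + p * low m x y))
       = (\<Sum>m\<in>UNIV. y $ m * M m) / 2 - EE / 4 + A * (\<Sum>m\<in>UNIV. y $ m * s0 m) + p * (\<Sum>m\<in>UNIV. y $ m * low m x y)"
      unfolding EE_def
      by (simp add: right_diff_distrib distrib_left sum.distrib sum_subtractf sum_distrib_left
          sum_divide_distrib mult_ac)
    then show ?thesis unfolding yM ys sum_low A(2) by simp
  qed
  \<comment> \<open>The two terms with \<open>p\<close> cancel each other, because y lies in the
    kernel of the Hessian of \<alpha>.\<close>
  have lhs: "(\<Sum>j\<in>UNIV. Ryy l j x y * (H j x y + p * y $ j))
     = (M l / 2 - E l / 4 + A * s0 l + p * low l x y) / A - low l x y * (EE / 4 + p * (A * A)) / A ^ 3"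
    unfolding sum_Ryy_mult[OF x] low_G y_low_G A_def[symmetric] ..
  have rhs1: "(\<Sum>k\<in>UNIV. Rxy k l x y * y $ k) = M l / A - EE * low l x y / (2 * A ^ 3) + lin_form (\<lambda>k. pd k (b l) x) y"
  proof -
    have "Rxy k l x y * y $ k = (y $ k * lin_form (\<lambda>j. pd k (a l j) x) y) / A
       - (y $ k * E k) * low l x y / (2 * A ^ 3) + pd k (b l) x * y $ k" for k
      unfolding Rxy_def A_def[symmetric] E_def by (simp add: algebra_simps)
    then show ?thesis
      by (simp add: M_def EE_def lin_form_def[of "\<lambda>k. pd k (b l) x"] sum.distrib sum_subtractf sum_divide_distrib sum_distrib_right)
  qed
  have rhs2: "Rx l x y = E l / (2 * A) + lin_form (\<lambda>i. pd l (b i) x) y"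
    unfolding Rx_def E_def A_def ..
  \<comment> \<open>The derivatives of b on the right form a curl, twice \<open>s0 l\<close>. It is
    matched by the part \<alpha> \<open>T\<close> of \<open>H\<close>, whose factor \<alpha>
    compensates the 1/\<alpha> of the Hessian.\<close>
  have s0: "s0 l = (lin_form (\<lambda>k. pd k (b l) x) y - lin_form (\<lambda>i. pd l (b i) x) y) / 2"
  proof -
    have "s0 l = (1/2) * (lin_form (\<lambda>k. pd k (b l) x) y - lin_form (\<lambda>i. pd l (b i) x) y)"
      unfolding lin_form_diff lin_form_cmult by (simp add: s0_def s_def)
    then show ?thesis by simp
  qed
  show ?thesis unfolding lhs rhs1 rhs2 s0
    using A(1) by (simp add: field_simps power3_eq_cube)
qed

text \<open>The fundamental tensor is not inverted explicitly. It is a rank one part built from the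
  gradient of F plus F times the Hessian; applied to H + P y, the first part is evaluated by the
  choice of \<open>P\<close> and the second by \<open>euler_lagrange\<close>. Invertibility then
  identifies the spray.\<close>

lemma spray_coeff_randers:
  assumes F: "\<And>x y. x \<in> U \<Longrightarrow> F x y = R x y" and x: "x \<in> U" and y: "y \<noteq> 0"
  shows "spray_coeff F i x y = H i x y + P x y * y $ i"
proof -
  have yV: "y \<in> V" using y by simp
  define g where "g = fundamental_tensor F x y"
  have sq_snd: "pd i (\<lambda>y. (F x y)\<^sup>2) y = 2 * (R x y * Ry i x y)" if "x \<in> U" "y \<in> V" for i x y
    using pd_square_snd[OF that(1)] that by (simp add: F)
  have sq_fst: "pd k (\<lambda>x. (F x y)\<^sup>2) x = 2 * (R x y * Rx k x y)" if "x \<in> U" "y \<in> V" for k x y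
  proof -
    have "pd k (\<lambda>x. (F x y)\<^sup>2) x = pd k (\<lambda>x. (R x y)\<^sup>2) x"
      by (rule pd_cong[OF U that(1)]) (simp add: F)
    then show ?thesis using pd_square_fst[OF that(1)] that(2) by simp
  qed
  have g: "g $ i $ j = Ry j x y * Ry i x y + R x y * Ryy i j x y" for i j
  proof -
    have "pd j (pd i (\<lambda>y. (F x y)\<^sup>2)) y = pd j (\<lambda>y. 2 * (R x y * Ry i x y)) y"
      by (rule pd_cong[OF V yV sq_snd[OF x]])
    also have "\<dots> = 2 * (Ry j x y * Ry i x y + Ryy i j x y * R x y)"
      by (intro has_pd_imp_pd has_pd_cmult has_pd_mult has_pd_R_snd has_pd_Ry x y)
    finally show ?thesis by (simp add: g_def fundamental_tensor_def mult.commute)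
  qed
  have inv: "invertible g"
    using fundamental_tensor_pos[OF x y] by (intro pos_def_invertible) (simp add: g)
  define L where "L = (\<lambda>l. (\<Sum>k\<in>UNIV. pd l (\<lambda>y. pd k (\<lambda>x. (F x y)\<^sup>2) x) y * y $ k) - pd l (\<lambda>x. (F x y)\<^sup>2) x)"
  define R0 where "R0 = (\<Sum>k\<in>UNIV. y $ k * Rx k x y)"
  define G where "G = (\<chi> j. H j x y + P x y * y $ j)"
  have L: "L l = 2 * (Ry l x y * R0 + R x y * ((\<Sum>k\<in>UNIV. Rxy k l x y * y $ k) - Rx l x y))" for l
  proof -
    have "pd l (\<lambda>y. pd k (\<lambda>x. (F x y)\<^sup>2) x) y = 2 * (Ry l x y * Rx k x y + Rxy k l x y * R x y)" for k
    proof -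
      have "pd l (\<lambda>y. pd k (\<lambda>x. (F x y)\<^sup>2) x) y = pd l (\<lambda>y. 2 * (R x y * Rx k x y)) y"
        by (rule pd_cong[OF V yV sq_fst[OF x]])
      also have "\<dots> = 2 * (Ry l x y * Rx k x y + Rxy k l x y * R x y)"
        by (intro has_pd_imp_pd has_pd_cmult has_pd_mult has_pd_R_snd has_pd_Rx x y)
      finally show ?thesis .
    qed
    then have "L l = (\<Sum>k\<in>UNIV. 2 * (Ry l x y * (y $ k * Rx k x y) + R x y * (Rxy k l x y * y $ k)))
        - 2 * (R x y * Rx l x y)"
      unfolding L_def sq_fst[OF x yV] by (simp add: algebra_simps)
    then show ?thesis
      by (simp add: R0_def sum.distrib sum_distrib_left[symmetric] right_diff_distrib)
  qed
  have RyG: "(\<Sum>j\<in>UNIV. Ry j x y * (H j x y + P x y * y $ j)) = R0 / 2"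
  proof -
    have "(\<Sum>j\<in>UNIV. Ry j x y * (H j x y + P x y * y $ j))
       = (\<Sum>j\<in>UNIV. Ry j x y * H j x y) + P x y * (\<Sum>j\<in>UNIV. Ry j x y * y $ j)"
      by (simp add: distrib_left sum.distrib sum_distrib_left mult_ac)
    then show ?thesis
      unfolding sum_Ry_mult_y[OF x y] P_def R0_def using R_pos[OF x y] by simp
  qed
  have gG: "g *v G = (\<chi> l. L l / 4)"
  proof (subst vec_eq_iff, intro allI)
    fix l
    have "(g *v G) $ l = (\<Sum>j\<in>UNIV. Ry l x y * (Ry j x y * (H j x y + P x y * y $ j))
        + R x y * (Ryy l j x y * (H j x y + P x y * y $ j)))"
      unfolding matrix_vector_mult_def G_def g vec_lambda_beta distrib_right mult.assoc
      by (simp add: mult.left_commute)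
    also have "\<dots> = Ry l x y * (R0 / 2) + R x y * (((\<Sum>k\<in>UNIV. Rxy k l x y * y $ k) - Rx l x y) / 2)"
      unfolding sum.distrib sum_distrib_left[symmetric] RyG euler_lagrange[OF x y] ..
    also have "\<dots> = (\<chi> l. L l / 4) $ l"
      by (simp add: L field_simps)
    finally show "(g *v G) $ l = (\<chi> l. L l / 4) $ l" .
  qed
  have "G = matrix_inv g *v (g *v G)"
    by (simp add: matrix_vector_mul_assoc matrix_inv_mult[OF inv])
  then have "G $ i = (matrix_inv g *v (\<chi> l. L l / 4)) $ i"
    unfolding gG by (rule arg_cong)
  then have "H i x y + P x y * y $ i = 1 / 4 * (\<Sum>l\<in>UNIV. matrix_inv g $ i $ l * L l)"
    by (simp add: G_def matrix_vector_mult_def sum_divide_distrib)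
  then show ?thesis unfolding spray_coeff_def g_def L_def by simp
qed

text \<open>Smoothness and the homogeneity \<open>P_scaleR\<close> are what projective invariance
  asks of \<open>P\<close>.\<close>

lemma smooth_P: "smooth2_on U V P"
proof -
  have b': "smooth_on U (\<lambda>x. pd k (b i) x)" for k i by (intro smooth_on_pd U smooth_b)
  have a': "smooth_on U (\<lambda>x. pd k (a i j) x)" for k i j by (intro smooth_on_pd U smooth_a)
  have low: "smooth2_on U V (low l)" for l
    unfolding low_def[abs_def] by (intro smooth2_on_lin_form smooth_a U V)
  have \<alpha>: "\<alpha> x y \<noteq> 0" if "x \<in> U" "y \<in> V" for x y using \<alpha>_pos[OF that(1), of y] that by auto
  have R: "R x y \<noteq> 0" if "x \<in> U" "y \<in> V" for x y using R_pos[OF that(1), of y] that by auto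
  have \<alpha>2: "2 * \<alpha> x y \<noteq> 0" if "x \<in> U" "y \<in> V" for x y using \<alpha>[OF that] by simp
  have Rs: "smooth2_on U V R"
    unfolding R_def[abs_def] \<beta>_def by (intro smooth2_on_add smooth_\<alpha> smooth2_on_lin_form smooth_b U V)
  have Rx: "smooth2_on U V (Rx k)" for k
    unfolding Rx_def[abs_def]
    by (intro smooth2_on_add smooth2_on_divide smooth2_on_quad_form smooth2_on_lin_form smooth2_on_mult
        smooth2_on_const smooth_\<alpha> a' b' U V \<alpha>2)
  have Ry: "smooth2_on U V (Ry k)" for k
    unfolding Ry_def[abs_def]
    by (intro smooth2_on_add smooth2_on_divide low smooth2_on_const1 smooth_\<alpha> smooth_b U V \<alpha>)
  have two: "(2::real) \<noteq> 0" by simp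
  show ?thesis unfolding P_def[abs_def]
    by (intro smooth2_on_divide smooth2_on_diff smooth2_on_sum smooth2_on_mult smooth2_on_nth
        smooth2_on_const Rs Rx Ry smooth_H U V R two)
qed

lemma \<alpha>_scaleR: "t > 0 \<Longrightarrow> \<alpha> x (t *\<^sub>R y) = t * \<alpha> x y"
  by (simp add: \<alpha>_def quad_form_scaleR real_sqrt_mult)

lemma H_scaleR: "t > 0 \<Longrightarrow> H i x (t *\<^sub>R y) = t\<^sup>2 * H i x y"
  by (simp add: H_def \<alpha>_scaleR T0_def lin_form_scaleR quad_form_scaleR power2_eq_square distrib_left)

lemma P_scaleR: "t > 0 \<Longrightarrow> P x (t *\<^sub>R y) = t * P x y"
proof -
  assume t: "t > 0"
  have "Rx k x (t *\<^sub>R y) = t * Rx k x y" for k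
    using t by (simp add: Rx_def \<alpha>_scaleR quad_form_scaleR lin_form_scaleR power2_eq_square distrib_left)
  moreover have "Ry k x (t *\<^sub>R y) = Ry k x y" for k
    using t by (simp add: Ry_def low_def \<alpha>_scaleR lin_form_scaleR)
  moreover have "R x (t *\<^sub>R y) = t * R x y"
    using t by (simp add: R_def \<beta>_def \<alpha>_scaleR lin_form_scaleR distrib_left)
  ultimately have "P x (t *\<^sub>R y) = (t * t * (\<Sum>k\<in>UNIV. y $ k * Rx k x y) / 2
      - t * t * (\<Sum>j\<in>UNIV. Ry j x y * H j x y)) / (t * R x y)"
    using t by (simp add: P_def H_scaleR sum_distrib_left power2_eq_square mult_ac)
  also have "\<dots> = (t * (t * ((\<Sum>k\<in>UNIV. y $ k * Rx k x y) / 2 - (\<Sum>j\<in>UNIV. Ry j x y * H j x y)))) / (t * R x y)"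
    by (simp add: algebra_simps)
  finally show ?thesis using t by (simp add: P_def)
qed

text \<open>Degree two is read off from the Jacobian: the Christoffel part doubles, and in
  \<open>\<alpha> x y * T0 i x y\<close> each factor contributes one copy.\<close>

lemma euler_H:
  assumes x: "x \<in> U" and y: "y \<noteq> 0"
  shows "(\<Sum>j\<in>UNIV. y $ j * pd j (H i x) y) = 2 * H i x y"
proof -
  have A: "\<alpha> x y \<noteq> 0" "quad_form (\<lambda>i j. a i j x) y = \<alpha> x y * \<alpha> x y"
    using \<alpha>_pos[OF x y] \<alpha>_square[OF x, of y] by (simp_all add: power2_eq_square)
  have 1: "(\<Sum>j\<in>UNIV. y $ j * pd j (H i x) y) = (\<Sum>j\<in>UNIV. y $ j * lin_form (\<lambda>k. \<Gamma> i j k x) y)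
     + (\<Sum>j\<in>UNIV. y $ j * low j x y) * T0 i x y / \<alpha> x y + \<alpha> x y * (\<Sum>j\<in>UNIV. y $ j * T i j x)"
    unfolding has_pd_imp_pd[OF has_pd_H_snd[OF x y]]
    by (simp add: distrib_left sum.distrib sum_distrib_left sum_distrib_right sum_divide_distrib mult_ac)
  have 2: "(\<Sum>j\<in>UNIV. y $ j * T i j x) = T0 i x y"
    by (simp add: T0_def lin_form_def mult.commute)
  have 3: "quad_form (\<lambda>j k. \<Gamma> i j k x) y = 2 * quad_form (\<lambda>j k. \<Gamma> i j k x / 2) y"
    by (simp add: quad_form_cmult)
  show ?thesis
    unfolding 1 2 sum_low A(2) quad_form_lin_form[symmetric] 3 H_def using A(1) by simp
qed

text \<open>The logarithm of the density is represented on \<open>U\<close> by an abstract smooth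
  \<open>\<sigma>\<close>, whose differential serves as the form in \<open>spray_PRic\<close>. The
  curvature computation is thus separated from the volume computation.\<close>

lemma PRic_randers:
  assumes F: "\<And>x y. x \<in> U \<Longrightarrow> F x y = R x y"
    and \<sigma>: "smooth_on U \<sigma>" "\<And>x. x \<in> U \<Longrightarrow> ln (BH_density F x) = \<sigma> x"
    and x: "x \<in> U"
  shows "\<exists>q l. (\<forall>y. y \<noteq> 0 \<longrightarrow> PRic F x y = quad_form q y + \<alpha> x y * lin_form l y)
    \<and> (CARD('n) = 1 \<longrightarrow> l = (\<lambda>k. 0))"
proof -
  define c where "c = (\<lambda>m x. pd m \<sigma> x)"
  have c: "smooth_on U (c m)" for m unfolding c_def by (rule smooth_on_pd[OF U \<sigma>(1)])
  have PR: "PRic F x y = spray_PRic H c x y" if y: "y \<noteq> 0" for y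
  proof -
    have yV: "y \<in> V" using y by simp
    have "PRic F x y = spray_PRic (\<lambda>i x y. H i x y + P x y * y $ i) c x y"
      unfolding PRic_eq_spray_PRic
    proof (rule spray_PRic_cong[OF U V x yV])
      show "spray_coeff F i x y = H i x y + P x y * y $ i" if "x \<in> U" "y \<in> V" for i x y
        by (rule spray_coeff_randers[OF F that(1)]) (use that in simp_all)
      show "pd m (\<lambda>x. ln (BH_density F x)) x = c m x" if "x \<in> U" for m x
        unfolding c_def by (rule pd_cong[OF U that \<sigma>(2)])
    qed
    also have "\<dots> = spray_PRic H c x y"
    proof (rule spray_PRic_projective[OF U V x yV smooth_H smooth_P c])
      fix x y assume *: "x \<in> U" "y \<in> V"
      then have y: "y \<noteq> 0" by simp
      show "(\<Sum>j\<in>UNIV. y $ j * pd j (H i x) y) = 2 * H i x y" for i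
        by (rule euler_H[OF *(1) y])
      show "(\<Sum>j\<in>UNIV. y $ j * pd j (P x) y) = P x y"
        by (rule euler_homogeneous[OF smooth_P *(1) y P_scaleR])
      have "pd j (spray_div H x) y = dv j x" for j
      proof -
        have "pd j (spray_div H x) y = pd j (\<lambda>y. lin_form (\<lambda>k. dv k x) y) y"
          by (rule pd_cong[OF V *(2) div_H[OF *(1)]]) simp
        then show ?thesis using has_pd_imp_pd[OF has_pd_lin_form] by simp
      qed
      then show "(\<Sum>j\<in>UNIV. y $ j * pd j (spray_div H x) y) = spray_div H x y"
        unfolding div_H[OF *(1) y] by (simp add: lin_form_def mult.commute)
    qed
    finally show ?thesis .
  qed
  obtain q where "\<forall>y. y \<noteq> 0 \<longrightarrow> spray_PRic H c x y
    = quad_form q y + \<alpha> x y * lin_form (\<lambda>k. odd_coeff c k x) y"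
    using spray_PRic_H[OF x c] ..
  with PR have "\<forall>y. y \<noteq> 0 \<longrightarrow> PRic F x y = quad_form q y + \<alpha> x y * lin_form (\<lambda>k. odd_coeff c k x) y"
    by simp
  moreover have "CARD('n) = 1 \<longrightarrow> (\<lambda>k. odd_coeff c k x) = (\<lambda>k. 0)"
    using odd_coeff_1[OF x] by simp
  ultimately show ?thesis by (intro exI conjI)
qed

end

section \<open>The Busemann-Hausdorff density\<close>

text \<open>The change of variables formula of HOL-Analysis is restricted to vectors indexed by well-ordered
  types; a copy of the index type with an arbitrary well-order makes it applicable in general.\<close>

typedef 'n windex = "UNIV :: 'n set" by simp

definition enum_index :: "'n::finite \<Rightarrow> nat" where
  "enum_index = (SOME f. inj f)"

lemma inj_enum_index: "inj (enum_index :: 'n::finite \<Rightarrow> nat)"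
  unfolding enum_index_def
proof (rule someI_ex[of inj])
  obtain f :: "'n \<Rightarrow> nat" and n where "f ` UNIV = {i. i < n}" "inj_on f UNIV"
    using finite_imp_inj_to_nat_seg[OF finite_class.finite_UNIV] by blast
  then show "\<exists>f :: 'n \<Rightarrow> nat. inj f" by (intro exI)
qed

instantiation windex :: (finite) "{finite, wellorder}"
begin

definition less_eq_windex :: "'a windex \<Rightarrow> 'a windex \<Rightarrow> bool" where
  "less_eq_windex i j \<longleftrightarrow> enum_index (Rep_windex i) \<le> enum_index (Rep_windex j)"

definition less_windex :: "'a windex \<Rightarrow> 'a windex \<Rightarrow> bool" where
  "less_windex i j \<longleftrightarrow> enum_index (Rep_windex i) < enum_index (Rep_windex j)"

instance
proof
  show "finite (UNIV :: 'a windex set)"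
  proof -
    have "finite (range (Abs_windex :: 'a \<Rightarrow> 'a windex))" by simp
    moreover have "range (Abs_windex :: 'a \<Rightarrow> 'a windex) = UNIV"
      using type_definition.Abs_image[OF type_definition_windex] .
    ultimately show ?thesis by simp
  qed
next
  fix x y z :: "'a windex"
  show "x < y \<longleftrightarrow> x \<le> y \<and> \<not> y \<le> x"
    by (auto simp: less_eq_windex_def less_windex_def)
  show "x \<le> x" by (simp add: less_eq_windex_def)
  show "x \<le> y \<Longrightarrow> y \<le> z \<Longrightarrow> x \<le> z" by (simp add: less_eq_windex_def)
  show "x \<le> y \<Longrightarrow> y \<le> x \<Longrightarrow> x = y"
    unfolding less_eq_windex_def using injD[OF inj_enum_index] Rep_windex_inject
    by (metis order_antisym)
  show "x \<le> y \<or> y \<le> x" by (auto simp: less_eq_windex_def)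
next
  fix P :: "'a windex \<Rightarrow> bool" and a
  assume *: "\<And>x. (\<And>y. y < x \<Longrightarrow> P y) \<Longrightarrow> P x"
  show "P a"
    by (induction "enum_index (Rep_windex a)" arbitrary: a rule: less_induct)
      (use * in \<open>auto simp: less_windex_def\<close>)
qed

end

section \<open>Lebesgue measure under a renaming of the coordinates\<close>

lemma bij_Rep_windex: "bij (Rep_windex :: 'n windex \<Rightarrow> 'n)"
  by (rule bijI') (auto simp: Rep_windex_inject intro: exI[of _ "Abs_windex _"] simp: Abs_windex_inverse)

definition reindex :: "real^('n::finite windex) \<Rightarrow> real^'n" where
  "reindex y = (\<chi> i. y $ Abs_windex i)"

lemma reindex_nth: "reindex y $ Rep_windex k = y $ k"
  by (simp add: reindex_def Rep_windex_inverse)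

lemma sum_windex: "(\<Sum>k\<in>UNIV. f (Rep_windex k)) = (\<Sum>i\<in>UNIV. f i)" for f :: "'n::finite \<Rightarrow> real"
  by (rule sum.reindex_bij_betw[OF bij_Rep_windex])

lemma prod_windex: "(\<Prod>k\<in>UNIV. f (Rep_windex k)) = (\<Prod>i\<in>UNIV. f i)" for f :: "'n::finite \<Rightarrow> real"
  by (rule prod.reindex_bij_betw[OF bij_Rep_windex])

lemma prod_Basis_vec: "(\<Prod>b\<in>Basis. x \<bullet> b) = (\<Prod>i\<in>UNIV. x $ i)" for x :: "real^'k::finite"
proof -
  have B: "(Basis :: (real^'k) set) = range (\<lambda>i. axis i 1)"
    by (auto simp: Basis_vec_def)
  have inj: "inj (\<lambda>i. axis i 1 :: real^'k)"
    by (rule injI) (simp add: axis_eq_axis)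
  show ?thesis
    unfolding B prod.reindex[OF inj] by (simp add: inner_axis)
qed

lemma mem_box_windex: "reindex y \<in> box l u \<longleftrightarrow> y \<in> box (\<chi> k. l $ Rep_windex k) (\<chi> k. u $ Rep_windex k)"
proof -
  have "(\<forall>i. l $ i < reindex y $ i \<and> reindex y $ i < u $ i)
    \<longleftrightarrow> (\<forall>k. l $ Rep_windex k < reindex y $ Rep_windex k \<and> reindex y $ Rep_windex k < u $ Rep_windex k)"
    by (metis bij_Rep_windex bij_pointE)
  then show ?thesis by (simp add: mem_box_cart reindex_nth)
qed

lemma continuous_reindex: "continuous_on UNIV reindex"
  unfolding reindex_def[abs_def] by (intro continuous_intros)

text \<open>Lebesgue measure is determined by its values on boxes; renaming the coordinates maps
  boxes to boxes with the same side lengths.\<close>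

lemma distr_reindex: "distr lborel borel (reindex :: real^('n::finite windex) \<Rightarrow> _) = lborel"
proof (rule lborel_eqI[symmetric])
  have m: "(reindex :: real^('n windex) \<Rightarrow> _) \<in> borel_measurable borel"
    by (rule borel_measurable_continuous_onI[OF continuous_reindex])
  fix l u :: "real^'n"
  assume lu: "\<And>b. b \<in> Basis \<Longrightarrow> l \<bullet> b \<le> u \<bullet> b"
  have le: "l $ i \<le> u $ i" for i
    using lu[of "axis i 1"] by (simp add: inner_axis)
  define l' u' where "l' = (\<chi> k. l $ Rep_windex k)" and "u' = (\<chi> k. u $ Rep_windex k)"
  have "emeasure (distr lborel borel reindex) (box l u) = emeasure lborel (reindex -` box l u)"
    using m by (subst emeasure_distr) auto
  also have "reindex -` box l u = box l' u'"
    unfolding l'_def u'_def by (intro set_eqI) (simp only: vimage_eq mem_box_windex)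
  also have "emeasure lborel (box l' u') = (\<Prod>b\<in>Basis. (u' - l') \<bullet> b)"
  proof (rule emeasure_lborel_box)
    fix b :: "real^('n windex)" assume "b \<in> Basis"
    then obtain k where "b = axis k 1" by (auto simp: Basis_vec_def)
    then show "l' \<bullet> b \<le> u' \<bullet> b" using le by (simp add: inner_axis l'_def u'_def)
  qed
  also have "(\<Prod>b\<in>Basis. (u' - l') \<bullet> b) = (\<Prod>b\<in>Basis. (u - l) \<bullet> b)"
    using prod_windex[of "\<lambda>i. (u - l) $ i"] by (simp add: prod_Basis_vec l'_def u'_def)
  finally show "emeasure (distr lborel borel reindex) (box l u) = (\<Prod>b\<in>Basis. (u - l) \<bullet> b)" .
qed simp

lemma measure_reindex:
  fixes S :: "(real^'n::finite) set"
  assumes "S \<in> sets borel"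
  shows "measure lebesgue {y. reindex y \<in> S} = measure lebesgue S"
proof -
  have m: "(reindex :: real^('n windex) \<Rightarrow> _) \<in> borel_measurable borel"
    by (rule borel_measurable_continuous_onI[OF continuous_reindex])
  have "measure lborel S = measure (distr lborel borel (reindex :: real^('n windex) \<Rightarrow> _)) S"
    by (simp only: distr_reindex)
  also have "\<dots> = measure lborel (reindex -` S)"
    using m assms by (subst measure_distr) auto
  finally have "measure lborel S = measure lborel (reindex -` S)" .
  moreover have "reindex -` S \<in> sets borel"
    using measurable_sets[OF m assms] by simp
  ultimately show ?thesis using assms by (simp add: measure_completion vimage_def)
qed

section \<open>Volumes of ellipsoids\<close>

lemma lin_form_zero: "lin_form c 0 = 0"
  by (simp add: lin_form_def)

lemma lin_form_vsum: "lin_form c (\<Sum>i\<in>I. f i) = (\<Sum>i\<in>I. lin_form c (f i))"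
  by (induction I rule: infinite_finite_induct) (simp_all add: lin_form_zero lin_form_plus)

text \<open>Gram-Schmidt for the inner product \<open>h\<close>, by induction on the set of indices
  already treated; the columns of \<open>E\<close> are an orthonormal basis.\<close>

lemma pos_def_basis:
  fixes h :: "'n::finite \<Rightarrow> 'n \<Rightarrow> real"
  assumes sym: "\<And>i j. h i j = h j i" and pos: "\<And>u. u \<noteq> 0 \<Longrightarrow> 0 < quad_form h u"
  shows "\<exists>E :: real^'n^'n. transpose E ** (\<chi> i j. h i j) ** E = mat 1"
proof -
  define B :: "real^'n \<Rightarrow> real^'n \<Rightarrow> real" where "B u v = (\<Sum>i\<in>UNIV. u $ i * lin_form (h i) v)" for u v
  have B_sym: "B u v = B v u" for u v
  proof -
    have "(\<lambda>l. h l j) = h j" for j using sym by (intro ext)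
    then show ?thesis unfolding B_def lin_form_swap[of u h v] by simp
  qed
  have B_plus: "B u (v + w) = B u v + B u w" for u v w
    by (simp add: B_def lin_form_plus distrib_left sum.distrib)
  have B_scale: "B u (r *\<^sub>R v) = r * B u v" for u v r
    by (simp add: B_def lin_form_scaleR sum_distrib_left mult_ac)
  have B_sum: "B u (\<Sum>i\<in>I. f i) = (\<Sum>i\<in>I. B u (f i))" for u f and I :: "'n set"
    unfolding B_def lin_form_vsum sum_distrib_left by (rule sum.swap)
  have B_pos: "B u u > 0" if "u \<noteq> 0" for u
    using pos[OF that] by (simp add: B_def quad_form_lin_form)
  have "\<exists>e. \<forall>i\<in>S. \<forall>j\<in>S. B (e i) (e j) = (if i = j then 1 else 0)" for S :: "'n set"
  proof (induction S rule: finite_induct[OF finite])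
    case 1
    show ?case by simp
  next
    case (2 k S)
    from 2(3) obtain e where e': "\<forall>i\<in>S. \<forall>j\<in>S. B (e i) (e j) = (if i = j then 1 else 0)" ..
    then have e: "B (e i) (e j) = (if i = j then 1 else 0)" if "i \<in> S" "j \<in> S" for i j
      using that by simp
    have "card (e ` S) \<le> card S" by (rule card_image_le) simp
    also have "card S < CARD('n)"
      using 2 by (intro psubset_card_mono) auto
    finally have "card (e ` S) < CARD('n)" .
    \<comment> \<open>Fewer than n vectors do not span, so there is a vector \<open>v\<close> with
      which the system can be extended.\<close>
    have "span (e ` S) \<noteq> UNIV"
    proof
      assume "span (e ` S) = UNIV"
      then have "dim (UNIV :: (real^'n) set) \<le> card (e ` S)"
        by (intro dim_le_card) auto
      then show False using \<open>card (e ` S) < CARD('n)\<close> by simp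
    qed
    then obtain v where v: "v \<notin> span (e ` S)" by blast
    define p where "p = (\<Sum>i\<in>S. B (e i) v *\<^sub>R e i)"
    \<comment> \<open>\<open>p\<close> is the projection of \<open>v\<close> onto the span of the
      previous vectors with respect to \<open>B\<close>; what remains is orthogonal to them and
      nonzero.\<close>
    define w where "w = v + (-1) *\<^sub>R p"
    have "p \<in> span (e ` S)"
      unfolding p_def by (intro span_sum span_scale span_base) auto
    then have "w \<noteq> 0" using v by (auto simp: w_def)
    have ew: "B (e j) w = 0" if "j \<in> S" for j
    proof -
      have "B (e j) p = (\<Sum>i\<in>S. B (e i) v * (if j = i then 1 else 0))"
        unfolding p_def B_sum B_scale by (intro sum.cong refl) (simp add: e that)
      also have "\<dots> = B (e j) v"
        using that by (simp add: if_distrib[of "\<lambda>t. _ * t"] cong: if_cong)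
      finally show ?thesis unfolding w_def B_plus B_scale by simp
    qed
    define e' where "e' = e(k := (1 / sqrt (B w w)) *\<^sub>R w)"
    have e'k: "e' k = (1 / sqrt (B w w)) *\<^sub>R w" by (simp add: e'_def)
    have e'S: "e' i = e i" if "i \<in> S" for i
      using that 2 by (auto simp: e'_def)
    have kk: "B (e' k) (e' k) = 1"
    proof -
      let ?c = "1 / sqrt (B w w)"
      have "B (e' k) (e' k) = ?c * (?c * B w w)"
        unfolding e'k B_scale B_sym[of "?c *\<^sub>R w" w] ..
      then show ?thesis using B_pos[OF \<open>w \<noteq> 0\<close>] by simp
    qed
    have ik: "B (e' i) (e' k) = 0" if "i \<in> S" for i
      unfolding e'S[OF that] e'k B_scale ew[OF that] by simp
    have "B (e' i) (e' j) = (if i = j then 1 else 0)" if "i \<in> insert k S" "j \<in> insert k S" for i j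
    proof (cases "i = k")
      case True
      then show ?thesis
        using that kk ik[of j] B_sym[of "e' k" "e' j"] by (cases "j = k") auto
    next
      case False
      then show ?thesis
        using that ik[of i] e[of i j] e'S by (cases "j = k") auto
    qed
    then show ?case by (intro exI[of _ e'] ballI)
  qed
  from this[of UNIV] obtain e :: "'n \<Rightarrow> real^'n"
    where "\<forall>i\<in>UNIV. \<forall>j\<in>UNIV. B (e i) (e j) = (if i = j then 1 else 0)" ..
  then have e: "B (e i) (e j) = (if i = j then 1 else 0)" for i j by simp
  define E :: "real^'n^'n" where "E = (\<chi> i j. e j $ i)"
  have "(transpose E ** (\<chi> i j. h i j) ** E) $ i $ j = B (e i) (e j)" for i j
  proof -
    have "(transpose E ** (\<chi> i j. h i j) ** E) $ i $ j = (\<Sum>l\<in>UNIV. \<Sum>k\<in>UNIV. e i $ k * h k l * e j $ l)"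
      by (simp add: matrix_matrix_mult_def transpose_def E_def sum_distrib_right)
    also have "\<dots> = (\<Sum>k\<in>UNIV. \<Sum>l\<in>UNIV. e i $ k * h k l * e j $ l)"
      by (rule sum.swap)
    finally show ?thesis
      by (simp add: B_def lin_form_def sum_distrib_left mult.assoc)
  qed
  then have "transpose E ** (\<chi> i j. h i j) ** E = mat 1"
    using e by (simp add: vec_eq_iff mat_def)
  then show ?thesis ..
qed

text \<open>\<open>E\<close> maps the unit ball onto the unit ball of \<open>h\<close>, so the
  ellipsoid is a translate of the image of the unit ball under r E. The relation with the identity
  matrix forces |det E| = 1 / sqrt (det h).\<close>

lemma measure_ellipsoid_wellorder:
  fixes h :: "'n::{finite,wellorder} \<Rightarrow> 'n \<Rightarrow> real" and v :: "(real, 'n) vec"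
  assumes sym: "\<And>i j. h i j = h j i" and pos: "\<And>u. u \<noteq> 0 \<Longrightarrow> 0 < quad_form h u" and r: "r > 0"
  shows "measure lebesgue {y. quad_form h (y + v) < r\<^sup>2}
      = r ^ CARD('n) / sqrt (det (\<chi> i j. h i j)) * measure lebesgue (ball (0::(real, 'n) vec) 1)"
    and "det (\<chi> i j. h i j) > 0"
proof -
  let ?h = "\<chi> i j. h i j"
  from pos_def_basis[OF sym pos] obtain E :: "((real, 'n) vec, 'n) vec" where E: "transpose E ** ?h ** E = mat 1" ..
  have "det E * det ?h * det E = 1"
    using arg_cong[OF E, of det] by (simp add: det_mul)
  then have dE: "(det E)\<^sup>2 * det ?h = 1" by (simp add: power2_eq_square mult_ac)
  then have "det E \<noteq> 0" by auto
  then have "det ?h = 1 / (det E)\<^sup>2" using dE by (simp add: field_simps)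
  then show dh: "det ?h > 0" using \<open>det E \<noteq> 0\<close> by simp
  have "\<bar>det E\<bar> * sqrt (det ?h) = 1"
    using arg_cong[OF dE, of sqrt] by (simp add: real_sqrt_mult)
  then have dE': "\<bar>det E\<bar> = 1 / sqrt (det ?h)"
    using dh by (simp add: field_simps)
  have quad: "quad_form h (E *v z) = z \<bullet> z" for z
  proof -
    have "quad_form h (E *v z) = (E *v z) \<bullet> (?h *v (E *v z))"
      by (simp add: quad_form_lin_form lin_form_def inner_vec_def matrix_vector_mult_def)
    also have "\<dots> = z \<bullet> (transpose E *v (?h *v (E *v z)))"
      unfolding transpose_matrix_vector inner_commute[of z "_ v* _"] dot_lmul_matrix
      by (rule inner_commute)
    also have "\<dots> = z \<bullet> ((transpose E ** ?h ** E) *v z)"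
      by (simp only: matrix_vector_mul_assoc matrix_mul_assoc)
    finally show ?thesis by (simp add: E)
  qed
  define K where "K = (\<lambda>z. r *\<^sub>R (E *v z))"
  have lin: "linear K"
    unfolding K_def by (intro linear_compose_scale_right) simp
  have "matrix K = (\<chi> i. r *s E $ i)"
    by (simp add: K_def matrix_def vec_eq_iff matrix_vector_mult_basis column_def)
  then have detK: "det (matrix K) = r ^ CARD('n) * det E"
    using det_rows_mul[of "\<lambda>i. r" "\<lambda>i. E $ i"] by simp
  have set: "{y. quad_form h (y + v) < r\<^sup>2} = (\<lambda>y. y - v) ` K ` ball 0 1"
  proof (rule set_eqI)
    fix y
    have surj: "\<exists>z. y + v = K z"
    proof
      show "y + v = K ((1 / r) *\<^sub>R (matrix_inv E *v (y + v)))"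
        using r \<open>det E \<noteq> 0\<close>
        by (simp add: K_def matrix_vector_mult_scaleR matrix_vector_mul_assoc matrix_inv_mult invertible_det_nz)
    qed
    then obtain z where z: "y + v = K z" ..
    have q: "quad_form h (K z') = r\<^sup>2 * (z' \<bullet> z')" for z'
      by (simp add: K_def quad_form_scaleR quad)
    have inj: "z' \<bullet> z' = z \<bullet> z" if "y + v = K z'" for z'
      using q[of z'] q[of z] r unfolding z[symmetric] that[symmetric] by simp
    have "y \<in> (\<lambda>y. y - v) ` K ` ball 0 1 \<longleftrightarrow> (\<exists>z'. y = K z' - v \<and> norm z' < 1)"
      unfolding image_image image_iff by auto
    also have "\<dots> \<longleftrightarrow> (\<exists>z'. y + v = K z' \<and> z' \<bullet> z' < 1)"
      unfolding eq_diff_eq norm_eq_sqrt_inner real_sqrt_lt_1_iff ..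
    also have "\<dots> \<longleftrightarrow> z \<bullet> z < 1"
    proof
      assume "\<exists>z'. y + v = K z' \<and> z' \<bullet> z' < 1"
      then obtain z' where "y + v = K z'" "z' \<bullet> z' < 1" by (elim exE conjE)
      then show "z \<bullet> z < 1" using inj by simp
    qed (intro exI[of _ z] conjI z)
    also have "\<dots> \<longleftrightarrow> quad_form h (y + v) < r\<^sup>2"
      unfolding z q using r by simp
    finally show "y \<in> {y. quad_form h (y + v) < r\<^sup>2} \<longleftrightarrow> y \<in> (\<lambda>y. y - v) ` K ` ball 0 1"
      by simp
  qed
  show "measure lebesgue {y. quad_form h (y + v) < r\<^sup>2}
      = r ^ CARD('n) / sqrt (det ?h) * measure lebesgue (ball (0::(real, 'n) vec) 1)"
    unfolding set measure_translation_subtract measure_linear_image[OF lin lmeasurable_ball] detK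
    using r by (simp add: abs_mult dE')
qed

lemma CARD_windex: "CARD('n::finite windex) = CARD('n)"
  by (rule bij_betw_same_card[OF bij_Rep_windex])

lemma quad_form_reindex:
  "quad_form h (reindex y) = quad_form (\<lambda>k l. h (Rep_windex k) (Rep_windex l)) y"
proof -
  have "quad_form h (reindex y) = (\<Sum>k\<in>UNIV. \<Sum>l\<in>UNIV. h (Rep_windex k) (Rep_windex l)
      * reindex y $ Rep_windex k * reindex y $ Rep_windex l)"
    unfolding quad_form_def sum_windex[of "\<lambda>j. h _ j * reindex y $ _ * reindex y $ j"]
    by (rule sum_windex[symmetric])
  then show ?thesis by (simp add: quad_form_def reindex_nth)
qed

text \<open>The determinant is left over the copied index type, which spares a comparison with the
  one over the original type.\<close>

lemma measure_ellipsoid: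
  fixes h :: "'n::finite \<Rightarrow> 'n \<Rightarrow> real" and v :: "real^'n"
  assumes sym: "\<And>i j. h i j = h j i" and pos: "\<And>u. u \<noteq> 0 \<Longrightarrow> 0 < quad_form h u" and r: "r > 0"
  shows "measure lebesgue {y. quad_form h (y + v) < r\<^sup>2}
      = r ^ CARD('n) / sqrt (det (\<chi> k l. h (Rep_windex k) (Rep_windex l)))
        * measure lebesgue (ball (0::real^'n) 1)"
    and "det (\<chi> k l. h (Rep_windex k) (Rep_windex l)) > 0"
proof -
  define h' where "h' = (\<lambda>k l. h (Rep_windex k) (Rep_windex l))"
  define v' where "v' = (\<chi> k. v $ Rep_windex k)"
  have v': "reindex v' = v"
    by (simp add: reindex_def v'_def Abs_windex_inverse)
  have sym': "h' i j = h' j i" for i j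
    unfolding h'_def by (rule sym)
  have pos': "0 < quad_form h' u" if "u \<noteq> 0" for u
  proof -
    have "reindex u \<noteq> 0"
    proof
      assume "reindex u = 0"
      then have "u $ k = 0" for k using reindex_nth[of u k] by simp
      then show False using that by (simp add: vec_eq_iff)
    qed
    then show ?thesis using pos by (simp add: h'_def quad_form_reindex[symmetric])
  qed
  have d: "(\<chi> k l. h (Rep_windex k) (Rep_windex l)) = (\<chi> k l. h' k l)"
    by (simp add: h'_def)
  note ell = measure_ellipsoid_wellorder[OF sym' pos' r]
  show "det (\<chi> k l. h (Rep_windex k) (Rep_windex l)) > 0"
    unfolding d by (rule ell(2))
  have "continuous_on UNIV (\<lambda>y. quad_form h (y + v))"
    unfolding quad_form_def by (intro continuous_intros)
  then have "open {y. quad_form h (y + v) < r\<^sup>2}"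
    by (intro open_Collect_less continuous_on_const)
  then have "measure lebesgue {y. quad_form h (y + v) < r\<^sup>2}
      = measure lebesgue {y. reindex y \<in> {y. quad_form h (y + v) < r\<^sup>2}}"
    by (intro measure_reindex[symmetric] borel_open)
  also have "{y. reindex y \<in> {y. quad_form h (y + v) < r\<^sup>2}} = {y. quad_form h' (y + v') < r\<^sup>2}"
  proof -
    have "reindex y + v = reindex (y + v')" for y
      unfolding v'[symmetric] by (simp add: reindex_def vec_eq_iff)
    then show ?thesis by (simp add: quad_form_reindex h'_def)
  qed
  also have "measure lebesgue \<dots> = r ^ CARD('n) / sqrt (det (\<chi> k l. h' k l))
        * measure lebesgue (ball (0::real^('n windex)) 1)"
    using ell(1)[of v'] unfolding CARD_windex .
  also have "ball (0::real^('n windex)) 1 = {y. reindex y \<in> ball 0 1}"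
  proof -
    have "norm (reindex y) = norm y" for y :: "real^('n windex)"
      using sum_windex[of "\<lambda>i. (reindex y $ i)\<^sup>2"] by (simp add: norm_vec_def L2_set_def reindex_nth)
    then show ?thesis by (simp add: set_eq_iff)
  qed
  also have "measure lebesgue \<dots> = measure lebesgue (ball (0::real^'n) 1)"
    by (intro measure_reindex borel_open open_ball)
  finally show "measure lebesgue {y. quad_form h (y + v) < r\<^sup>2}
      = r ^ CARD('n) / sqrt (det (\<chi> k l. h (Rep_windex k) (Rep_windex l)))
        * measure lebesgue (ball (0::real^'n) 1)"
    unfolding d .
qed

section \<open>The density of a Randers metric\<close>

context randers_chart
begin

text \<open>\<open>F < 1\<close> is the ellipsoid \<open>h(y + v, y + v) < 1 + b(v)\<close> with \<open>h = a - b \<otimes> b\<close> and \<open>v = h\<^sup>-\<^sup>1 b\<close>.\<close>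

definition hm where "hm x = (\<chi> i j. a i j x - b i x * b j x)"
definition hv where "hv x = matrix_inv (hm x) *v (\<chi> i. b i x)"

definition vol_det where
  "vol_det x = det (\<chi> k l. a (Rep_windex k) (Rep_windex l) x - b (Rep_windex k) x * b (Rep_windex l) x)"

text \<open>Logarithm of \<open>sqrt (vol_det x) / r ^ CARD('n)\<close>, where r is the radius of
  the ellipsoid; r is itself a square root, whence the factor 1/2 in both terms.\<close>

definition log_density where
  "log_density x = ln (vol_det x) / 2 - real CARD('n) / 2 * ln (1 + lin_form (\<lambda>i. b i x) (hv x))"

lemma quad_hm: "quad_form (\<lambda>i j. a i j x - b i x * b j x) u = quad_form (\<lambda>i j. a i j x) u - (\<beta> x u)\<^sup>2"
  by (simp add: \<beta>_def power2_eq_square lin_form_mult quad_form_diff)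

lemma hm_pos: "x \<in> U \<Longrightarrow> u \<noteq> 0 \<Longrightarrow> 0 < quad_form (\<lambda>i j. a i j x - b i x * b j x) u"
proof -
  assume x: "x \<in> U" and u: "u \<noteq> 0"
  have "\<bar>\<beta> x u\<bar> < \<alpha> x u" using b_less[OF x u] by (simp add: \<beta>_def \<alpha>_def)
  then have "\<bar>\<beta> x u\<bar>\<^sup>2 < (\<alpha> x u)\<^sup>2" by (intro power_strict_mono) auto
  then show ?thesis unfolding quad_hm \<alpha>_square[OF x] by simp
qed

lemma hm_hv: "x \<in> U \<Longrightarrow> hm x *v hv x = (\<chi> i. b i x)"
proof -
  assume x: "x \<in> U"
  have "invertible (hm x)"
    unfolding hm_def using hm_pos[OF x] by (intro pos_def_invertible) simp
  then show ?thesis by (simp add: hv_def matrix_vector_mul_assoc matrix_inv_mult)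
qed

lemma ln_BH_density:
  assumes F: "\<And>x y. x \<in> U \<Longrightarrow> F x y = R x y" and x: "x \<in> U"
  shows "ln (BH_density F x) = log_density x" "vol_det x > 0" "0 < 1 + lin_form (\<lambda>i. b i x) (hv x)"
proof -
  define h where "h = (\<lambda>i j. a i j x - b i x * b j x)"
  have sym: "h i j = h j i" for i j
    by (simp add: h_def a_sym[OF x, of i j] mult.commute)
  have pos: "0 < quad_form h u" if "u \<noteq> 0" for u
    unfolding h_def by (rule hm_pos[OF x that])
  have hv: "lin_form (h i) (hv x) = b i x" for i
  proof -
    have "(\<Sum>j\<in>UNIV. hm x $ i $ j * hv x $ j) = b i x"
      using arg_cong[OF hm_hv[OF x], of "\<lambda>w. w $ i"] by (simp add: matrix_vector_mult_def)
    then show ?thesis by (simp add: hm_def h_def lin_form_def)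
  qed
  have quad_hv: "quad_form h (hv x) = lin_form (\<lambda>i. b i x) (hv x)"
    unfolding quad_form_lin_form hv by (simp add: lin_form_def mult.commute)
  \<comment> \<open>Completing the square: v solves h v = b, so the two mixed terms are \<beta>(y)
    each and the constant is b(v).\<close>
  have quad: "quad_form h (y + hv x) = quad_form (\<lambda>i j. a i j x) y - (\<beta> x y)\<^sup>2 + 2 * \<beta> x y + lin_form (\<lambda>i. b i x) (hv x)" for y
  proof -
    have "(\<Sum>i\<in>UNIV. hv x $ i * lin_form (h i) y) = \<beta> x y"
    proof -
      have "(\<lambda>l. h l j) = h j" for j using sym by (intro ext)
      then have "(\<Sum>i\<in>UNIV. hv x $ i * lin_form (h i) y) = (\<Sum>i\<in>UNIV. y $ i * b i x)"
        unfolding lin_form_swap[of "hv x"] by (simp add: hv)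
      then show ?thesis by (simp add: \<beta>_def lin_form_def mult.commute)
    qed
    moreover have "(\<Sum>i\<in>UNIV. y $ i * b i x) = \<beta> x y"
      by (simp add: \<beta>_def lin_form_def mult.commute)
    moreover have "quad_form h (y + hv x) = quad_form h y + (\<Sum>i\<in>UNIV. y $ i * lin_form (h i) (hv x))
        + (\<Sum>i\<in>UNIV. hv x $ i * lin_form (h i) y) + quad_form h (hv x)"
      unfolding quad_form_lin_form lin_form_plus vector_add_component distrib_left distrib_right sum.distrib
      by simp
    ultimately have "quad_form h (y + hv x) = quad_form h y + 2 * \<beta> x y + quad_form h (hv x)"
      unfolding hv by simp
    then show ?thesis
      unfolding quad_hv using quad_hm[of x y] by (simp add: h_def)
  qed
  have "quad_form h (hv x) \<ge> 0"
    using pos[of "hv x"] by (cases "hv x = 0") (auto simp: quad_form_def)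
  then show r0: "0 < 1 + lin_form (\<lambda>i. b i x) (hv x)" unfolding quad_hv by simp
  define r where "r = sqrt (1 + lin_form (\<lambda>i. b i x) (hv x))"
  have r: "r > 0" "r\<^sup>2 = 1 + lin_form (\<lambda>i. b i x) (hv x)" using r0 by (simp_all add: r_def)
  have "F x y < 1 \<longleftrightarrow> quad_form h (y + hv x) < r\<^sup>2" for y
  proof -
    have b: "\<bar>\<beta> x y\<bar> \<le> \<alpha> x y" "0 \<le> \<alpha> x y"
    proof -
      have "\<bar>\<beta> x y\<bar> \<le> \<alpha> x y \<and> 0 \<le> \<alpha> x y"
      proof (cases "y = 0")
        case True
        then show ?thesis by (simp add: \<alpha>_def \<beta>_def lin_form_def quad_form_def)
      next
        case False
        then show ?thesis using b_less[OF x False] \<alpha>_pos[OF x False] unfolding \<alpha>_def \<beta>_def by simp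
      qed
      then show "\<bar>\<beta> x y\<bar> \<le> \<alpha> x y" "0 \<le> \<alpha> x y" by simp_all
    qed
    have "quad_form h (y + hv x) < r\<^sup>2 \<longleftrightarrow> (\<alpha> x y)\<^sup>2 < (1 - \<beta> x y)\<^sup>2"
      unfolding quad r(2) \<alpha>_square[OF x] by (simp add: power2_eq_square algebra_simps)
    \<comment> \<open>The squared inequality has the second branch \<alpha> < \<beta> - 1, which
      |\<beta>| \<le> \<alpha> excludes.\<close>
    also have "\<dots> \<longleftrightarrow> \<alpha> x y < 1 - \<beta> x y"
    proof
      assume "(\<alpha> x y)\<^sup>2 < (1 - \<beta> x y)\<^sup>2"
      then have "(\<alpha> x y)\<^sup>2 < \<bar>1 - \<beta> x y\<bar>\<^sup>2" by simp
      then have "\<alpha> x y < \<bar>1 - \<beta> x y\<bar>" by (rule power2_less_imp_less) simp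
      then show "\<alpha> x y < 1 - \<beta> x y" using b by auto
    next
      assume "\<alpha> x y < 1 - \<beta> x y"
      then show "(\<alpha> x y)\<^sup>2 < (1 - \<beta> x y)\<^sup>2" using b(2) by (intro power_strict_mono) auto
    qed
    finally show ?thesis by (auto simp: F[OF x] R_def)
  qed
  then have vol: "measure lebesgue {y. F x y < 1}
      = r ^ CARD('n) / sqrt (vol_det x) * measure lebesgue (ball (0::real^'n) 1)"
    using measure_ellipsoid(1)[OF sym pos r(1), of "hv x"] by (simp add: vol_det_def h_def)
  show d: "vol_det x > 0"
    using measure_ellipsoid(2)[OF sym pos r(1)] by (simp add: vol_det_def h_def)
  have "measure lebesgue (ball (0::real^'n) 1) > 0"
    using content_ball_pos[of 1 "0::real^'n"] by simp
  then have "BH_density F x = sqrt (vol_det x) / r ^ CARD('n)"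
    unfolding BH_density_def vol using r(1) d by (simp add: field_simps)
  then have "ln (BH_density F x) = ln (sqrt (vol_det x)) - real CARD('n) * ln r"
    using r(1) d by (simp add: ln_div ln_realpow)
  then show "ln (BH_density F x) = log_density x"
    using d r0 by (simp add: log_density_def r_def ln_sqrt)
qed

lemma smooth_log_density: "smooth_on U log_density"
proof -
  have F: "(\<lambda>x y. R x y) x y = R x y" for x y by simp
  have h: "smooth_on U (\<lambda>x. hm x $ i $ j)" for i j
    using smooth_on_diff[OF U smooth_a smooth_on_mult[OF U smooth_b smooth_b]] by (simp add: hm_def)
  have d: "vol_det x > 0" if "x \<in> U" for x by (rule ln_BH_density(2)[OF F that])
  have "smooth_on U (\<lambda>x. (\<chi> k l. a (Rep_windex k) (Rep_windex l) x - b (Rep_windex k) x * b (Rep_windex l) x) $ i $ j)" for i j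
    using smooth_on_diff[OF U smooth_a smooth_on_mult[OF U smooth_b smooth_b]] by simp
  from smooth_on_det[OF U this] have vd: "smooth_on U vol_det"
    unfolding vol_det_def[abs_def] .
  have inv: "det (hm x) \<noteq> 0" if "x \<in> U" for x
    unfolding invertible_det_nz[symmetric] hm_def
    by (rule pos_def_invertible) (simp add: hm_pos[OF that])
  have hv: "smooth_on U (\<lambda>x. hv x $ i)" for i
    unfolding hv_def by (rule smooth_on_matrix_inv_mult[OF U h _ inv]) (simp add: smooth_b)
  have pos: "0 < 1 + (\<Sum>k\<in>UNIV. b k x * hv x $ k)" if "x \<in> U" for x
    using ln_BH_density(3)[OF F that] by (simp add: lin_form_def)
  have two: "(2::real) \<noteq> 0" by simp
  have "smooth_on U (\<lambda>x. ln (vol_det x) / 2 - real CARD('n) / 2 * ln (1 + (\<Sum>k\<in>UNIV. b k x * hv x $ k)))"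
    by (intro smooth_on_diff smooth_on_divide smooth_on_ln vd smooth_on_mult smooth_on_add
        smooth_on_sum smooth_on_const h hv smooth_b U d pos two)
  then show ?thesis by (simp add: log_density_def[abs_def] lin_form_def)
qed

end

section \<open>Reversibility and third derivatives\<close>

lemma pd3_quad_form_eq_0:
  fixes f :: "real^'n::finite \<Rightarrow> real"
  assumes f: "\<And>y. y \<noteq> 0 \<Longrightarrow> f y = quad_form q y" and y: "y \<noteq> 0"
  shows "pd i (pd j (pd k f)) y = 0"
proof -
  let ?V = "- {0 :: real^'n}"
  have V: "open ?V" by auto
  define c where "c = (\<lambda>j. q k j + q j k)"
  have 1: "pd k f z = lin_form c z" if "z \<in> ?V" for z
  proof -
    have "pd k f z = pd k (quad_form q) z"
      by (rule pd_cong[OF V that]) (simp add: f)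
    then show ?thesis unfolding c_def has_pd_imp_pd[OF has_pd_quad_form] .
  qed
  have 2: "pd j (pd k f) z = c j" if "z \<in> ?V" for z
  proof -
    have "pd j (pd k f) z = pd j (lin_form c) z"
      by (rule pd_cong[OF V that 1])
    then show ?thesis unfolding has_pd_imp_pd[OF has_pd_lin_form] .
  qed
  have "pd i (pd j (pd k f)) y = pd i (\<lambda>z. c j) y"
    by (rule pd_cong[OF V _ 2]) (use y in simp_all)
  then show ?thesis unfolding has_pd_imp_pd[OF has_pd_const] .
qed

lemma smooth_on_has_derivative_line:
  fixes f :: "real^'n::finite \<Rightarrow> real"
  assumes "smooth_on S f" "u + t *\<^sub>R v \<in> S"
  shows "((\<lambda>t. f (u + t *\<^sub>R v)) has_real_derivative (\<Sum>i\<in>UNIV. v $ i * pd i f (u + t *\<^sub>R v))) (at t)"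
proof -
  have "((\<lambda>t. u + t *\<^sub>R v) has_derivative (\<lambda>h. h *\<^sub>R v)) (at t)"
    by (auto intro!: derivative_eq_intros)
  from has_derivative_compose[OF this smooth_on_has_derivative_pd[OF assms]]
  have "((\<lambda>t. f (u + t *\<^sub>R v)) has_derivative (\<lambda>h. \<Sum>i\<in>UNIV. (h *\<^sub>R v) $ i * pd i f (u + t *\<^sub>R v))) (at t)" .
  moreover have "(\<lambda>h. \<Sum>i\<in>UNIV. (h *\<^sub>R v) $ i * pd i f (u + t *\<^sub>R v))
      = (*) (\<Sum>i\<in>UNIV. v $ i * pd i f (u + t *\<^sub>R v))"
    by (rule ext) (simp add: sum_distrib_left mult_ac)
  ultimately show ?thesis unfolding has_field_derivative_def by simp
qed

text \<open>\<open>f1\<close> and \<open>f2\<close> are the first and second derivatives in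
  direction v. All partial derivatives of \<open>f2\<close> vanish, so \<open>f2\<close> is constant
  on the line, and two integrations follow, each by showing that a difference has derivative
  0.\<close>

lemma pd3_eq_0_imp_quadratic_on_line:
  fixes f :: "real^'n::finite \<Rightarrow> real"
  assumes "open S" "smooth_on S f"
    and zero: "\<And>y i j k. y \<in> S \<Longrightarrow> pd i (pd j (pd k f)) y = 0"
    and line: "\<And>t. u + t *\<^sub>R v \<in> S"
  shows "\<exists>A B C. \<forall>t. f (u + t *\<^sub>R v) = A + B * t + C * t\<^sup>2"
proof -
  define f1 where "f1 = (\<lambda>y. \<Sum>k\<in>UNIV. v $ k * pd k f y)"
  define f2 where "f2 = (\<lambda>y. \<Sum>j\<in>UNIV. v $ j * pd j f1 y)"
  have s1: "smooth_on S (pd k f)" for k by (rule smooth_on_pd[OF assms(1,2)])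
  have s2: "smooth_on S (pd j (pd k f))" for j k by (rule smooth_on_pd[OF assms(1) s1])
  have f1: "smooth_on S f1"
    unfolding f1_def by (intro smooth_on_sum smooth_on_mult smooth_on_const s1 assms(1))
  have pf1: "pd j f1 y = (\<Sum>k\<in>UNIV. v $ k * pd j (pd k f) y)" if "y \<in> S" for j y
    unfolding f1_def by (intro has_pd_imp_pd has_pd_sum has_pd_cmult smooth_on_has_pd[OF s1 that])
  have s3: "smooth_on S (pd j f1)" for j by (rule smooth_on_pd[OF assms(1) f1])
  have f2: "smooth_on S f2"
    unfolding f2_def by (intro smooth_on_sum smooth_on_mult smooth_on_const s3 assms(1))
  have pf2: "pd i f2 y = 0" if y: "y \<in> S" for i y
  proof -
    have "pd i (pd j f1) y = 0" for j
    proof -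
      have "pd i (pd j f1) y = pd i (\<lambda>y. \<Sum>k\<in>UNIV. v $ k * pd j (pd k f) y) y"
        by (rule pd_cong[OF assms(1) y pf1])
      also have "\<dots> = (\<Sum>k\<in>UNIV. v $ k * pd i (pd j (pd k f)) y)"
        by (intro has_pd_imp_pd has_pd_sum has_pd_cmult smooth_on_has_pd[OF s2 y])
      finally show ?thesis by (simp add: zero[OF y])
    qed
    then have "(\<Sum>j\<in>UNIV. v $ j * pd i (pd j f1) y) = 0" by simp
    moreover have "pd i f2 y = (\<Sum>j\<in>UNIV. v $ j * pd i (pd j f1) y)"
      unfolding f2_def by (intro has_pd_imp_pd has_pd_sum has_pd_cmult smooth_on_has_pd[OF s3 y])
    ultimately show ?thesis by simp
  qed
  have D0: "((\<lambda>t. f (u + t *\<^sub>R v)) has_real_derivative f1 (u + t *\<^sub>R v)) (at t)" for t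
    unfolding f1_def by (rule smooth_on_has_derivative_line[OF assms(2) line])
  have D1: "((\<lambda>t. f1 (u + t *\<^sub>R v)) has_real_derivative f2 (u + t *\<^sub>R v)) (at t)" for t
    unfolding f2_def by (rule smooth_on_has_derivative_line[OF f1 line])
  have "((\<lambda>t. f2 (u + t *\<^sub>R v)) has_real_derivative 0) (at t)" for t
    using smooth_on_has_derivative_line[OF f2 line, of t] by (simp add: pf2[OF line])
  then have c2: "f2 (u + t *\<^sub>R v) = f2 (u + 0 *\<^sub>R v)" for t
    using DERIV_isconst_all[of "\<lambda>t. f2 (u + t *\<^sub>R v)" t 0] by simp
  define K where "K = f2 (u + 0 *\<^sub>R v)"
  have "((\<lambda>t. f1 (u + t *\<^sub>R v) - K * t) has_real_derivative 0) (at t)" for t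
    using D1[of t] unfolding c2[of t] K_def by (auto intro!: derivative_eq_intros)
  then have c1: "f1 (u + t *\<^sub>R v) - K * t = f1 (u + 0 *\<^sub>R v) - K * 0" for t
    using DERIV_isconst_all[of "\<lambda>t. f1 (u + t *\<^sub>R v) - K * t" t 0] by simp
  define B where "B = f1 (u + 0 *\<^sub>R v)"
  have c1': "f1 (u + t *\<^sub>R v) = B + K * t" for t using c1[of t] by (simp add: B_def)
  have "((\<lambda>t. f (u + t *\<^sub>R v) - B * t - K * t\<^sup>2 / 2) has_real_derivative 0) (at t)" for t
    using D0[of t] unfolding c1'[of t] by (auto intro!: derivative_eq_intros)
  then have c0: "f (u + t *\<^sub>R v) - B * t - K * t\<^sup>2 / 2 = f (u + 0 *\<^sub>R v) - B * 0 - K * 0\<^sup>2 / 2" for t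
    using DERIV_isconst_all[of "\<lambda>t. f (u + t *\<^sub>R v) - B * t - K * t\<^sup>2 / 2" t 0] by simp
  have "f (u + t *\<^sub>R v) = f (u + 0 *\<^sub>R v) + B * t + K / 2 * t\<^sup>2" for t
    using c0[of t] by simp
  then show ?thesis by (intro exI allI)
qed

text \<open>Compare \<open>t = 1 / s\<close> with \<open>t = - 1 / s\<close> as \<open>s\<close> tends to \<open>0\<close>.\<close>

lemma odd_homogeneous_quadratic_on_line:
  fixes g :: "real^'n::finite \<Rightarrow> real"
  assumes hom: "\<And>s y. s > 0 \<Longrightarrow> g (s *\<^sub>R y) = s\<^sup>2 * g y" and odd: "\<And>y. g (- y) = - g y"
    and cont: "continuous_on UNIV g"
    and line: "\<And>t. g (u + t *\<^sub>R v) = A + B * t + C * t\<^sup>2"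
  shows "g v = 0"
proof -
  have p: "g (v + s *\<^sub>R u) = A * s\<^sup>2 + B * s + C" if "s > 0" for s
  proof -
    have "g (v + s *\<^sub>R u) = g (s *\<^sub>R (u + (1 / s) *\<^sub>R v))"
      using that by (simp add: scaleR_add_right add.commute)
    also have "\<dots> = s\<^sup>2 * (A + B * (1 / s) + C * (1 / s)\<^sup>2)"
      unfolding hom[OF that] line ..
    also have "\<dots> = A * s\<^sup>2 + B * s + C"
      using that by (simp add: field_simps power2_eq_square)
    finally show ?thesis .
  qed
  have m: "- g (v + s *\<^sub>R (- u)) = A * s\<^sup>2 - B * s + C" if "s > 0" for s
  proof -
    have "- g (v + s *\<^sub>R (- u)) = g (s *\<^sub>R (u + (- 1 / s) *\<^sub>R v))"
      unfolding odd[symmetric] using that by (simp add: scaleR_add_right algebra_simps)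
    also have "\<dots> = s\<^sup>2 * (A + B * (- 1 / s) + C * (- 1 / s)\<^sup>2)"
      unfolding hom[OF that] line ..
    also have "\<dots> = A * s\<^sup>2 - B * s + C"
      using that by (simp add: field_simps power2_eq_square)
    finally show ?thesis .
  qed
  have lim: "((\<lambda>s. g (v + s *\<^sub>R w)) \<longlongrightarrow> g v) (at_right 0)" for w
  proof -
    have "((\<lambda>s. v + s *\<^sub>R w) \<longlongrightarrow> v + 0 *\<^sub>R w) (at_right 0)"
      by (intro tendsto_intros)
    moreover have "isCont g (v + 0 *\<^sub>R w)"
      using cont by (simp add: continuous_on_eq_continuous_at)
    ultimately have "((\<lambda>s. g (v + s *\<^sub>R w)) \<longlongrightarrow> g (v + 0 *\<^sub>R w)) (at_right 0)"
      by (rule isCont_tendsto_compose[rotated])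
    then show ?thesis by simp
  qed
  have pos: "\<forall>\<^sub>F s in at_right 0. (0::real) < s"
    by (rule eventually_at_right_less)
  have "((\<lambda>s. A * s\<^sup>2 + B * s + C) \<longlongrightarrow> A * 0\<^sup>2 + B * 0 + C) (at_right 0)"
    by (intro tendsto_intros)
  moreover have "\<forall>\<^sub>F s in at_right 0. A * s\<^sup>2 + B * s + C = g (v + s *\<^sub>R u)"
    using pos by (rule eventually_mono) (simp add: p)
  ultimately have "((\<lambda>s. g (v + s *\<^sub>R u)) \<longlongrightarrow> A * 0\<^sup>2 + B * 0 + C) (at_right 0)"
    by (rule Lim_transform_eventually)
  \<comment> \<open>Both limits pick out the leading coefficient \<open>C\<close>, here as the value
    \<open>g v\<close> and afterwards as \<open>- g v\<close>.\<close>
  from tendsto_unique[OF _ lim this] have 1: "g v = C" by simp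
  have "((\<lambda>s. A * s\<^sup>2 - B * s + C) \<longlongrightarrow> A * 0\<^sup>2 - B * 0 + C) (at_right 0)"
    by (intro tendsto_intros)
  moreover have "\<forall>\<^sub>F s in at_right 0. A * s\<^sup>2 - B * s + C = - g (v + s *\<^sub>R (- u))"
    using pos by (rule eventually_mono) (simp only: m)
  ultimately have "((\<lambda>s. - g (v + s *\<^sub>R (- u))) \<longlongrightarrow> A * 0\<^sup>2 - B * 0 + C) (at_right 0)"
    by (rule Lim_transform_eventually)
  from tendsto_unique[OF _ tendsto_minus[OF lim] this] have 2: "- g v = C" by simp
  from 1 2 show ?thesis by simp
qed

lemma smooth_on_nth: "open S \<Longrightarrow> smooth_on S (\<lambda>x. x $ i :: real)"
  by (rule smooth_on_linear[OF _ bounded_linear_vec_nth])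

lemma smooth_on_quad_form: "open S \<Longrightarrow> smooth_on S (quad_form q)"
  unfolding quad_form_def[abs_def]
  by (intro smooth_on_sum smooth_on_mult smooth_on_const smooth_on_nth)

lemma smooth_on_lin_form: "open S \<Longrightarrow> smooth_on S (lin_form l)"
  unfolding lin_form_def[abs_def]
  by (intro smooth_on_sum smooth_on_mult smooth_on_const smooth_on_nth)

lemma quad_form_minus: "quad_form q (- y) = quad_form q y"
  by (simp add: quad_form_def)

lemma lin_form_minus: "lin_form l (- y) = - lin_form l y"
  by (simp add: lin_form_def sum_negf)

lemma even_iff_pd3_eq_0:
  fixes f :: "real^'n::finite \<Rightarrow> real"
  assumes a: "\<And>y. y \<noteq> 0 \<Longrightarrow> 0 < quad_form a y"
    and f: "\<And>y. y \<noteq> 0 \<Longrightarrow> f y = quad_form q y + sqrt (quad_form a y) * lin_form l y"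
    and n1: "CARD('n) = 1 \<Longrightarrow> l = (\<lambda>k. 0)"
  shows "(\<forall>y. y \<noteq> 0 \<longrightarrow> f y = f (- y)) \<longleftrightarrow> (\<forall>y. y \<noteq> 0 \<longrightarrow> (\<forall>i j k. pd i (pd j (pd k f)) y = 0))"
proof
  assume "\<forall>y. y \<noteq> 0 \<longrightarrow> f y = f (- y)"
  then have even: "y \<noteq> 0 \<longrightarrow> f y = f (- y)" for y by (rule spec)
  have l: "lin_form l y = 0" if "y \<noteq> 0" for y
  proof -
    have "- y \<noteq> 0" using that by simp
    have "sqrt (quad_form a y) * lin_form l y = 0"
      using mp[OF even that] unfolding f[OF that] f[OF \<open>- y \<noteq> 0\<close>]
      by (simp add: quad_form_minus lin_form_minus)
    then show ?thesis using a[OF that] by simp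
  qed
  have "f y = quad_form q y" if "y \<noteq> 0" for y
    using f[OF that] l[OF that] by simp
  from pd3_quad_form_eq_0[OF this]
  show "\<forall>y. y \<noteq> 0 \<longrightarrow> (\<forall>i j k. pd i (pd j (pd k f)) y = 0)" by simp
next
  assume "\<forall>y. y \<noteq> 0 \<longrightarrow> (\<forall>i j k. pd i (pd j (pd k f)) y = 0)"
  then have zero: "pd i (pd j (pd k f)) y = 0" if "y \<in> - {0}" for i j k y
    using that by simp
  let ?V = "- {0 :: real^'n}"
  have V: "open ?V" by auto
  define g where "g = (\<lambda>y. sqrt (quad_form a y) * lin_form l y)"
  have "smooth_on ?V (\<lambda>y. quad_form q y + sqrt (quad_form a y) * lin_form l y)"
    by (intro smooth_on_add smooth_on_mult smooth_on_sqrt smooth_on_quad_form smooth_on_lin_form V)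
      (simp add: a)
  then have fs: "smooth_on ?V f"
    by (rule smooth_on_cong[OF V, rotated]) (simp add: f)
  have "l = (\<lambda>k. 0)"
  proof (rule ccontr)
    assume "l \<noteq> (\<lambda>k. 0)"
    then obtain k where k: "l k \<noteq> 0" unfolding fun_eq_iff not_all ..
    have "CARD('n) \<noteq> 1" using n1 \<open>l \<noteq> (\<lambda>k. 0)\<close> by (rule contrapos_nn[rotated])
    have "\<exists>m :: 'n. m \<noteq> k"
    proof (rule ccontr)
      assume "\<nexists>m. m \<noteq> k"
      then have "x \<in> {k}" for x by simp
      then have "(UNIV :: 'n set) = {k}" by (intro equalityI subsetI) simp_all
      from arg_cong[OF this, of card] have "CARD('n) = 1" by simp
      with \<open>CARD('n) \<noteq> 1\<close> show False ..
    qed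
    then obtain m where m: "m \<noteq> k" ..
    \<comment> \<open>The direction is the coordinate axis on which \<lambda> does not vanish; the
      base point on another axis keeps the whole line away from the origin.\<close>
    define u v :: "real^'n" where "u = axis m 1" and "v = axis k 1"
    have uv: "(u + t *\<^sub>R v) $ m = 1" for t using m by (simp add: u_def v_def axis_def)
    have line: "u + t *\<^sub>R v \<in> ?V" for t
    proof
      assume "u + t *\<^sub>R v \<in> {0}"
      then have "(u + t *\<^sub>R v) $ m = 0" by simp
      then show False using uv[of t] by simp
    qed
    \<comment> \<open>On a single line the odd part cannot be separated from q. The mirror line
      supplies f at the opposite points, and half the difference is \<open>g\<close>, again a
      polynomial of degree at most two in t.\<close>
    have line': "- u + t *\<^sub>R (- v) \<in> ?V" for t
    proof -
      have "- u + t *\<^sub>R (- v) = - (u + t *\<^sub>R v)" by simp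
      then show ?thesis
        using line[of t] unfolding Compl_iff singleton_iff by (simp only: neg_equal_0_iff_equal not_False_eq_True)
    qed
    have "\<exists>A B C. \<forall>t. f (u + t *\<^sub>R v) = A + B * t + C * t\<^sup>2"
      by (rule pd3_eq_0_imp_quadratic_on_line[OF V fs zero line])
    then obtain A B C where 1: "\<forall>t. f (u + t *\<^sub>R v) = A + B * t + C * t\<^sup>2"
      by (elim exE)
    have "\<exists>A B C. \<forall>t. f (- u + t *\<^sub>R (- v)) = A + B * t + C * t\<^sup>2"
      by (rule pd3_eq_0_imp_quadratic_on_line[OF V fs zero line'])
    then obtain A' B' C' where 2: "\<forall>t. f (- u + t *\<^sub>R (- v)) = A' + B' * t + C' * t\<^sup>2"
      by (elim exE)
    have "g (u + t *\<^sub>R v) = (A - A') / 2 + (B - B') / 2 * t + (C - C') / 2 * t\<^sup>2" for t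
    proof -
      have nz: "u + t *\<^sub>R v \<noteq> 0" "- (u + t *\<^sub>R v) \<noteq> 0"
        using line[of t] unfolding Compl_iff singleton_iff neg_equal_0_iff_equal by (assumption, assumption)
      have "2 * g (u + t *\<^sub>R v) = f (u + t *\<^sub>R v) - f (- (u + t *\<^sub>R v))"
        unfolding f[OF nz(1)] f[OF nz(2)] quad_form_minus lin_form_minus g_def by simp
      also have "- (u + t *\<^sub>R v) = - u + t *\<^sub>R (- v)" by simp
      finally have "2 * g (u + t *\<^sub>R v) = (A + B * t + C * t\<^sup>2) - (A' + B' * t + C' * t\<^sup>2)"
        unfolding spec[OF 1] spec[OF 2] .
      then show ?thesis by (simp add: field_simps)
    qed
    then have "g v = 0"
    proof (rule odd_homogeneous_quadratic_on_line[rotated 3])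
      show "g (s *\<^sub>R y) = s\<^sup>2 * g y" if "s > 0" for s y
        using that by (simp add: g_def quad_form_scaleR lin_form_scaleR real_sqrt_mult power2_eq_square)
      show "g (- y) = - g y" for y
        by (simp add: g_def quad_form_minus lin_form_minus)
      show "continuous_on UNIV g"
        unfolding g_def quad_form_def lin_form_def by (intro continuous_intros)
    qed
    moreover have "v \<noteq> 0" by (simp add: v_def axis_eq_0_iff)
    ultimately have "lin_form l v = 0" using a[of v] by (simp add: g_def)
    then show False using k by (simp add: v_def lin_form_axis)
  qed
  then have fq: "f y = quad_form q y" if "y \<noteq> 0" for y
    using f[OF that] by (simp add: lin_form_def)
  show "\<forall>y. y \<noteq> 0 \<longrightarrow> f y = f (- y)"
  proof (intro allI impI)
    fix y :: "real^'n" assume y: "y \<noteq> 0"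
    then have "- y \<noteq> 0" by simp
    show "f y = f (- y)" unfolding fq[OF y] fq[OF \<open>- y \<noteq> 0\<close>] quad_form_minus ..
  qed
qed

section \<open>Linear functions on coordinate space\<close>

text \<open>The quotient is homogeneous of degree 0, so its supremum is taken on the compact unit
  sphere. This makes the supremum in \<open>form_norm\<close> an honest upper bound.\<close>

lemma lin_form_bound:
  fixes b :: "'n::finite \<Rightarrow> real"
  assumes a: "\<And>y. y \<noteq> 0 \<Longrightarrow> 0 < quad_form a y"
  shows "\<exists>K. \<forall>y. y \<noteq> 0 \<longrightarrow> \<bar>lin_form b y\<bar> / sqrt (quad_form a y) \<le> K"
proof -
  define r where "r = (\<lambda>y. \<bar>lin_form b y\<bar> / sqrt (quad_form a y))"
  have nz: "sqrt (quad_form a y) \<noteq> 0" if "y \<in> sphere 0 1" for y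
  proof -
    have "y \<noteq> 0" using that by auto
    from a[OF this] show ?thesis by simp
  qed
  have q: "continuous_on S (quad_form a)" for S
    unfolding quad_form_def by (intro continuous_intros)
  have l: "continuous_on S (lin_form b)" for S
    unfolding lin_form_def by (intro continuous_intros)
  have "continuous_on (sphere 0 1) r"
    unfolding r_def using nz by (intro continuous_on_divide continuous_on_rabs continuous_on_real_sqrt q l) simp
  from compact_continuous_image[OF this compact_sphere]
  have "bounded (r ` sphere 0 1)" by (rule compact_imp_bounded)
  then obtain K where "\<forall>z\<in>r ` sphere 0 1. norm z \<le> K"
    unfolding bounded_iff by (elim exE)
  then have K: "r y \<le> K" if "norm y = 1" for y
  proof -
    have "norm (r y) \<le> K" using \<open>\<forall>z\<in>r ` sphere 0 1. norm z \<le> K\<close> that by simp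
    then show ?thesis by simp
  qed
  have "r y \<le> K" if "y \<noteq> 0" for y
  proof -
    define w where "w = (1 / norm y) *\<^sub>R y"
    have "norm w = 1" using that by (simp add: w_def)
    have "y = norm y *\<^sub>R w" using that by (simp add: w_def)
    then have "r y = r (norm y *\<^sub>R w)" by simp
    also have "\<dots> = r w"
      using that by (simp add: r_def lin_form_scaleR quad_form_scaleR real_sqrt_mult abs_mult)
    finally show ?thesis using K[OF \<open>norm w = 1\<close>] by simp
  qed
  then show ?thesis unfolding r_def by (intro exI[of _ K]) simp
qed

lemma linear_eq_lin_form:
  fixes f :: "real^'n::finite \<Rightarrow> real"
  assumes "\<And>y z r s. f (r *\<^sub>R y + s *\<^sub>R z) = r * f y + s * f z"
  shows "f y = lin_form (\<lambda>i. f (axis i 1)) y"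
proof -
  have l: "linear f"
    by (rule linearI) (use assms[of 1 _ 1] assms[of _ _ 0] in simp_all)
  have "f y = f (\<Sum>i\<in>UNIV. (y $ i) *\<^sub>R axis i 1)"
    by (simp add: basis_expansion scalar_mult_eq_scaleR[symmetric])
  also have "\<dots> = lin_form (\<lambda>i. f (axis i 1)) y"
    by (simp add: linear_sum[OF l] linear_cmul[OF l] lin_form_def mult.commute)
  finally show ?thesis .
qed

section \<open>Reduction to charts\<close>

locale atlas =
  fixes M :: "'m topology" and A :: "('m, 'n::finite) chart set"
  assumes manifold: "smooth_manifold M A"
begin

lemma openin_dom: "c \<in> A \<Longrightarrow> openin M (fst c)"
  and open_chart_image: "c \<in> A \<Longrightarrow> open (chart_image c)"
  and homeo: "c \<in> A \<Longrightarrow> homeomorphic_map (subtopology M (fst c)) (top_of_set (chart_image c)) (snd c)"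
  and smooth_transition: "c \<in> A \<Longrightarrow> d \<in> A \<Longrightarrow> smooth_on (snd c ` (fst c \<inter> fst d)) (transition c d)"
  using manifold unfolding smooth_manifold_def by simp_all

lemma inj_chart: "c \<in> A \<Longrightarrow> inj_on (snd c) (fst c)"
proof -
  assume c: "c \<in> A"
  have "topspace (subtopology M (fst c)) = fst c"
    using openin_subset[OF openin_dom[OF c]] by auto
  then show ?thesis using homeomorphic_imp_injective_map[OF homeo[OF c]] by simp
qed

lemma chart_inv: "c \<in> A \<Longrightarrow> p \<in> fst c \<Longrightarrow> chart_inv c (snd c p) = p"
  unfolding chart_inv_def by (rule inv_into_f_f[OF inj_chart])

lemma open_chart:
  assumes c: "c \<in> A" and S: "openin M S" "S \<subseteq> fst c"
  shows "open (snd c ` S)"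
proof -
  have "openin (subtopology M (fst c)) S"
    using S openin_subtopology_Int[OF S(1), of "fst c"] by (simp add: Int_absorb2)
  then have "openin (top_of_set (chart_image c)) (snd c ` S)"
    using homeomorphic_imp_open_map[OF homeo[OF c]] unfolding open_map_def by simp
  then show ?thesis
    using openin_open_trans[OF _ open_chart_image[OF c]] by simp
qed

lemma transition_chart: "c \<in> A \<Longrightarrow> p \<in> fst c \<Longrightarrow> transition c d (snd c p) = snd d p"
  by (simp add: transition_def chart_inv)

definition dtrans where "dtrans c d p = frechet_derivative (transition c d) (at (snd c p))"

lemma has_derivative_transition:
  assumes "c \<in> A" "d \<in> A" "p \<in> fst c" "p \<in> fst d"
  shows "(transition c d has_derivative dtrans c d p) (at (snd c p))"
  unfolding dtrans_def
  by (rule smooth_on_has_derivative[OF smooth_transition[OF assms(1,2)]]) (use assms in simp)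

text \<open>The cocycle rule for the differentials: the transition maps compose on the triple
  overlap, which is open in the chart and therefore determines the derivative.\<close>

lemma dtrans_trans:
  assumes c: "c \<in> A" "p \<in> fst c" and d: "d \<in> A" "p \<in> fst d" and e: "e \<in> A" "p \<in> fst e"
  shows "dtrans d e p (dtrans c d p y) = dtrans c e p y"
proof -
  let ?S = "snd c ` (fst c \<inter> fst d \<inter> fst e)"
  have S: "open ?S"
    using openin_dom[OF c(1)] openin_dom[OF d(1)] openin_dom[OF e(1)]
    by (intro open_chart[OF c(1)] openin_Int) auto
  have de: "(transition d e has_derivative dtrans d e p) (at (transition c d (snd c p)))"
    using has_derivative_transition[OF d(1) e(1) d(2) e(2)] by (simp add: transition_chart c)
  have "((\<lambda>z. transition d e (transition c d z)) has_derivative (\<lambda>y. dtrans d e p (dtrans c d p y))) (at (snd c p))"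
    by (rule has_derivative_compose[OF has_derivative_transition[OF c(1) d(1) c(2) d(2)] de])
  then have "(transition c e has_derivative (\<lambda>y. dtrans d e p (dtrans c d p y))) (at (snd c p))"
  proof (rule has_derivative_transform_within_open[OF _ S])
    show "snd c p \<in> ?S" using c d e by simp
    fix z assume "z \<in> ?S"
    then obtain r where r: "z = snd c r" "r \<in> fst c" "r \<in> fst d" by auto
    show "transition d e (transition c d z) = transition c e z"
      unfolding r(1) transition_chart[OF c(1) r(2)] transition_chart[OF d(1) r(3)] ..
  qed
  from has_derivative_unique[OF this has_derivative_transition[OF c(1) e(1) c(2) e(2)]]
  show ?thesis by (rule fun_cong)
qed

lemma dtrans_self:
  assumes c: "c \<in> A" "p \<in> fst c"
  shows "dtrans c c p y = y"
proof -
  have "((\<lambda>z. z) has_derivative (\<lambda>y. y)) (at (snd c p))" by (rule has_derivative_ident)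
  then have "(transition c c has_derivative (\<lambda>y. y)) (at (snd c p))"
  proof (rule has_derivative_transform_within_open[OF _ open_chart_image[OF c(1)]])
    show "snd c p \<in> chart_image c" using c by (simp add: chart_image_def)
    fix z assume "z \<in> chart_image c"
    then obtain r where r: "z = snd c r" "r \<in> fst c" unfolding chart_image_def by (rule imageE)
    show "z = transition c c z" unfolding r(1) transition_chart[OF c(1) r(2)] ..
  qed
  from has_derivative_unique[OF this has_derivative_transition[OF c(1) c(1) c(2) c(2)]]
  show ?thesis by (rule fun_cong[symmetric])
qed

lemma coord_vec_eq:
  "coord_vec A c p y d = (if d \<in> charts_at A p then dtrans c d p y else 0)"
  by (simp add: coord_vec_def dtrans_def)

text \<open>The cocycle rule makes the components compatible. Together with
  \<open>coord_vec_self\<close> and \<open>coord_vec_component\<close> the chart identifies the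
  tangent space with the coordinate space.\<close>

lemma coord_vec_in_tangent_space:
  assumes c: "c \<in> A" "p \<in> fst c"
  shows "coord_vec A c p y \<in> tangent_space A p"
proof -
  have 1: "coord_vec A c p y e = dtrans d e p (coord_vec A c p y d)"
    if "d \<in> charts_at A p" "e \<in> charts_at A p" for d e
    using that dtrans_trans[OF c, of d e y] by (simp add: coord_vec_eq charts_at_def)
  have 2: "coord_vec A c p y d = 0" if "d \<notin> charts_at A p" for d
    using that by (simp add: coord_vec_eq)
  show ?thesis
    unfolding tangent_space_def dtrans_def[symmetric]
    by (intro CollectI conjI ballI allI impI 1 2)
qed

lemma coord_vec_self: "c \<in> A \<Longrightarrow> p \<in> fst c \<Longrightarrow> coord_vec A c p y c = y"
  by (simp add: coord_vec_eq charts_at_def dtrans_self)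

lemma coord_vec_component:
  assumes c: "c \<in> A" "p \<in> fst c" and v: "v \<in> tangent_space A p"
  shows "coord_vec A c p (v c) = v"
proof
  fix d
  have "c \<in> charts_at A p" using c by (simp add: charts_at_def)
  with v have 1: "d \<in> charts_at A p \<longrightarrow> v d = dtrans c d p (v c)" and 2: "d \<notin> charts_at A p \<longrightarrow> v d = 0"
    unfolding tangent_space_def dtrans_def[symmetric] by blast+
  show "coord_vec A c p (v c) d = v d"
    unfolding coord_vec_eq using 1 2 by simp
qed

lemma coord_vec_linear:
  assumes c: "c \<in> A" "p \<in> fst c"
  shows "coord_vec A c p (r *\<^sub>R y + s *\<^sub>R z) = (\<lambda>d. r *\<^sub>R coord_vec A c p y d + s *\<^sub>R coord_vec A c p z d)"
proof
  fix d
  show "coord_vec A c p (r *\<^sub>R y + s *\<^sub>R z) d = r *\<^sub>R coord_vec A c p y d + s *\<^sub>R coord_vec A c p z d"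
  proof (cases "d \<in> charts_at A p")
    case True
    then have "linear (dtrans c d p)"
      using has_derivative_linear[OF has_derivative_transition[OF c(1) _ c(2)]] by (simp add: charts_at_def)
    then show ?thesis using True by (simp only: coord_vec_eq if_True linear_add linear_cmul)
  qed (simp add: coord_vec_eq)
qed

lemma coord_vec_eq_0_iff:
  assumes c: "c \<in> A" "p \<in> fst c"
  shows "coord_vec A c p y = (\<lambda>d. 0) \<longleftrightarrow> y = 0"
proof
  assume "coord_vec A c p y = (\<lambda>d. 0)"
  then show "y = 0" using coord_vec_self[OF c, of y] by simp
next
  assume "y = 0"
  then show "coord_vec A c p y = (\<lambda>d. 0)" using coord_vec_linear[OF c, of 0 0 0 0] by simp
qed

text \<open>Replaces tangent vectors by their coordinates, so that reversibility is quantified in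
  the same way as \<open>square_PRic\<close>.\<close>

lemma reversible_PRic_iff:
  "reversible_PRic A F \<longleftrightarrow> (\<forall>c\<in>A. \<forall>p\<in>fst c. \<forall>y. y \<noteq> 0 \<longrightarrow>
     PRic (coord_rep A c F) (snd c p) y = PRic (coord_rep A c F) (snd c p) (- y))"
  (is "_ \<longleftrightarrow> ?R")
proof
  assume rev: "reversible_PRic A F"
  show ?R
  proof (intro ballI allI impI)
    fix c p and y :: "real^'n" assume c: "c \<in> A" "p \<in> fst c" and "y \<noteq> 0"
    then have "coord_vec A c p y \<in> tangent_space A p - {\<lambda>d. 0}"
      using coord_vec_in_tangent_space[OF c] coord_vec_eq_0_iff[OF c] by simp
    from bspec[OF bspec[OF bspec[OF rev[unfolded reversible_PRic_def] c(1)] c(2)] this]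
    show "PRic (coord_rep A c F) (snd c p) y = PRic (coord_rep A c F) (snd c p) (- y)"
      unfolding coord_vec_self[OF c] .
  qed
next
  assume R: ?R
  show "reversible_PRic A F"
    unfolding reversible_PRic_def
  proof (intro ballI)
    fix c p v assume c: "c \<in> A" "p \<in> fst c" and v: "v \<in> tangent_space A p - {\<lambda>d. 0}"
    then have "v c \<noteq> 0"
      using coord_vec_component[OF c, of v] coord_vec_eq_0_iff[OF c, of "v c"] by auto
    from mp[OF spec[OF bspec[OF bspec[OF R c(1)] c(2)]] this]
    show "PRic (coord_rep A c F) (snd c p) (v c) = PRic (coord_rep A c F) (snd c p) (- v c)" .
  qed
qed

text \<open>Coefficients of the metric and of the form are read off on the coordinate vectors and
  shown to satisfy \<open>randers_chart\<close>. The \<open>g\<close> of the conclusion is the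
  metric tensor at the given point, so its root is \<alpha>.\<close>

lemma PRic_coord_rep:
  assumes F: "randers_metric A F" and c: "c \<in> A" and p: "p \<in> fst c"
  shows "\<exists>g q l. (\<forall>y. y \<noteq> 0 \<longrightarrow> 0 < quad_form g y)
    \<and> (\<forall>y. y \<noteq> 0 \<longrightarrow> PRic (coord_rep A c F) (snd c p) y = quad_form q y + sqrt (quad_form g y) * lin_form l y)
    \<and> (CARD('n) = 1 \<longrightarrow> l = (\<lambda>k. 0))"
proof -
  obtain a b where a: "riemannian_metric A a" and b: "one_form A b"
    and F': "\<And>p. charts_at A p \<noteq> {} \<Longrightarrow> form_norm A a b p < 1"
      "\<And>p v. charts_at A p \<noteq> {} \<Longrightarrow> v \<in> tangent_space A p \<Longrightarrow> F p v = sqrt (a p v v) + b p v"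
    using F unfolding randers_metric_def by auto
  define cv where "cv = (\<lambda>x. coord_vec A c (chart_inv c x))"
  define g where "g = (\<lambda>i j x. a (chart_inv c x) (cv x (axis i 1)) (cv x (axis j 1)))"
  define \<omega> where "\<omega> = (\<lambda>i x. b (chart_inv c x) (cv x (axis i 1)))"
  have pt: "chart_inv c x \<in> fst c" "charts_at A (chart_inv c x) \<noteq> {}" if "x \<in> chart_image c" for x
  proof -
    from that obtain r where r: "x = snd c r" "r \<in> fst c" unfolding chart_image_def by (rule imageE)
    then show "chart_inv c x \<in> fst c" using chart_inv[OF c] by simp
    then have "c \<in> charts_at A (chart_inv c x)" using c by (simp add: charts_at_def)
    then show "charts_at A (chart_inv c x) \<noteq> {}" by blast
  qed
  have cv_T: "cv x y \<in> tangent_space A (chart_inv c x)" if "x \<in> chart_image c" for x y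
    unfolding cv_def by (rule coord_vec_in_tangent_space[OF c pt(1)[OF that]])
  have cv_lin: "cv x (r *\<^sub>R y + s *\<^sub>R z) = (\<lambda>d. r *\<^sub>R cv x y d + s *\<^sub>R cv x z d)"
    if "x \<in> chart_image c" for x r y s z
    unfolding cv_def by (rule coord_vec_linear[OF c pt(1)[OF that]])
  have a_ax: "a (chart_inv c x) u v = a (chart_inv c x) v u"
      "a (chart_inv c x) (\<lambda>d. r *\<^sub>R u d + s *\<^sub>R v d) w = r * a (chart_inv c x) u w + s * a (chart_inv c x) v w"
      "v \<noteq> (\<lambda>d. 0) \<Longrightarrow> a (chart_inv c x) v v > 0"
    if "x \<in> chart_image c" "u \<in> tangent_space A (chart_inv c x)" "v \<in> tangent_space A (chart_inv c x)"
      "w \<in> tangent_space A (chart_inv c x)" for x u v w r s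
    using a pt(2)[OF that(1)] that(2-) unfolding riemannian_metric_def by simp_all
  have b_ax: "b (chart_inv c x) (\<lambda>d. r *\<^sub>R u d + s *\<^sub>R v d) = r * b (chart_inv c x) u + s * b (chart_inv c x) v"
    if "x \<in> chart_image c" "u \<in> tangent_space A (chart_inv c x)" "v \<in> tangent_space A (chart_inv c x)"
    for x u v r s
    using b pt(2)[OF that(1)] that(2-) unfolding one_form_def by simp
  have bq: "b (chart_inv c x) (cv x y) = lin_form (\<lambda>i. \<omega> i x) y" if x: "x \<in> chart_image c" for x y
    unfolding \<omega>_def
    by (rule linear_eq_lin_form) (simp only: cv_lin[OF x] b_ax[OF x cv_T[OF x] cv_T[OF x]])
  have aq: "a (chart_inv c x) (cv x y) (cv x y) = quad_form (\<lambda>i j. g i j x) y" if x: "x \<in> chart_image c" for x y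
  proof -
    have 1: "a (chart_inv c x) (cv x y) (cv x z) = lin_form (\<lambda>i. a (chart_inv c x) (cv x (axis i 1)) (cv x z)) y" for y z
      by (rule linear_eq_lin_form) (simp only: cv_lin[OF x] a_ax(2)[OF x cv_T[OF x] cv_T[OF x] cv_T[OF x]])
    have 2: "a (chart_inv c x) (cv x (axis i 1)) (cv x y) = lin_form (\<lambda>j. g i j x) y" for i
    proof -
      have "a (chart_inv c x) (cv x (axis i 1)) (cv x y) = a (chart_inv c x) (cv x y) (cv x (axis i 1))"
        by (rule a_ax(1)[OF x cv_T[OF x] cv_T[OF x] cv_T[OF x]])
      also have "\<dots> = lin_form (\<lambda>j. a (chart_inv c x) (cv x (axis j 1)) (cv x (axis i 1))) y"
        by (rule 1)
      also have "(\<lambda>j. a (chart_inv c x) (cv x (axis j 1)) (cv x (axis i 1))) = (\<lambda>j. g i j x)"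
        unfolding g_def by (rule ext) (rule a_ax(1)[OF x cv_T[OF x] cv_T[OF x] cv_T[OF x]])
      finally show ?thesis .
    qed
    have "a (chart_inv c x) (cv x y) (cv x y) = lin_form (\<lambda>i. lin_form (\<lambda>j. g i j x) y) y"
      unfolding 1[of y y] 2 ..
    then show ?thesis
      unfolding quad_form_lin_form lin_form_def[of "\<lambda>i. lin_form (\<lambda>j. g i j x) y"]
      by (simp only: mult.commute)
  qed
  have g_pos: "0 < quad_form (\<lambda>i j. g i j x) y" if x: "x \<in> chart_image c" and y: "y \<noteq> 0" for x y
  proof -
    have "cv x y \<noteq> (\<lambda>d. 0)"
      using coord_vec_eq_0_iff[OF c pt(1)[OF x], of y] y by (simp add: cv_def)
    from a_ax(3)[OF x cv_T[OF x] cv_T[OF x] cv_T[OF x] this] show ?thesis unfolding aq[OF x] .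
  qed
  have w_less: "\<bar>lin_form (\<lambda>i. \<omega> i x) y\<bar> < sqrt (quad_form (\<lambda>i j. g i j x) y)"
    if x: "x \<in> chart_image c" and y: "y \<noteq> 0" for x y
  proof -
    let ?p = "chart_inv c x"
    let ?f = "\<lambda>v. \<bar>b ?p v\<bar> / sqrt (a ?p v v)"
    have "\<exists>K. \<forall>y. y \<noteq> 0 \<longrightarrow> \<bar>lin_form (\<lambda>i. \<omega> i x) y\<bar> / sqrt (quad_form (\<lambda>i j. g i j x) y) \<le> K"
      by (rule lin_form_bound[OF g_pos[OF x]])
    then obtain K where K: "\<forall>y. y \<noteq> 0 \<longrightarrow> \<bar>lin_form (\<lambda>i. \<omega> i x) y\<bar> / sqrt (quad_form (\<lambda>i j. g i j x) y) \<le> K" ..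
    \<comment> \<open>A supremum of reals bounds its members only if the set is bounded above; the
      bound \<open>K\<close> on the coordinate space is carried over to tangent vectors.\<close>
    have "bdd_above (?f ` (tangent_space A ?p - {\<lambda>d. 0}))"
    proof (rule bdd_aboveI2)
      fix v assume v: "v \<in> tangent_space A ?p - {\<lambda>d. 0}"
      then have v': "cv x (v c) = v" unfolding cv_def by (intro coord_vec_component[OF c pt(1)[OF x]]) simp
      have "v c \<noteq> 0"
        using v coord_vec_eq_0_iff[OF c pt(1)[OF x], of "v c"] v' by (simp add: cv_def)
      from mp[OF spec[OF K] this] show "?f v \<le> K"
        unfolding bq[OF x, symmetric] aq[OF x, symmetric] v' .
    qed
    moreover have "cv x y \<in> tangent_space A ?p - {\<lambda>d. 0}"
      using cv_T[OF x] coord_vec_eq_0_iff[OF c pt(1)[OF x], of y] y by (simp add: cv_def)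
    ultimately have "?f (cv x y) \<le> form_norm A a b ?p"
      unfolding form_norm_def by (intro cSUP_upper)
    also have "\<dots> < 1" by (rule F'(1)[OF pt(2)[OF x]])
    finally show ?thesis
      using g_pos[OF x y] unfolding bq[OF x] aq[OF x] by (simp add: divide_less_eq)
  qed
  interpret randers_chart "chart_image c" g \<omega>
  proof
    show "open (chart_image c)" by (rule open_chart_image[OF c])
    show "smooth_on (chart_image c) (g i j)" for i j
      using a c unfolding riemannian_metric_def g_def cv_def by simp
    show "smooth_on (chart_image c) (\<omega> i)" for i
      using b c unfolding one_form_def \<omega>_def cv_def by simp
    show "g i j x = g j i x" if x: "x \<in> chart_image c" for x i j
      unfolding g_def by (rule a_ax(1)[OF x cv_T[OF x] cv_T[OF x] cv_T[OF x]])
  qed (fact g_pos, fact w_less)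
  have x: "snd c p \<in> chart_image c" using p by (simp add: chart_image_def)
  have FR: "coord_rep A c F x y = R x y" if x: "x \<in> chart_image c" for x y
    unfolding coord_rep_def R_def \<alpha>_def \<beta>_def
    using F'(2)[OF pt(2)[OF x] cv_T[OF x, of y]] unfolding aq[OF x] bq[OF x] unfolding cv_def .
  have "\<exists>q l. (\<forall>y. y \<noteq> 0 \<longrightarrow> PRic (coord_rep A c F) (snd c p) y = quad_form q y + \<alpha> (snd c p) y * lin_form l y)
     \<and> (CARD('n) = 1 \<longrightarrow> l = (\<lambda>k. 0))"
    by (rule PRic_randers[OF FR smooth_log_density ln_BH_density(1)[OF FR] x])
  then obtain q l where "\<forall>y. y \<noteq> 0 \<longrightarrow> PRic (coord_rep A c F) (snd c p) y = quad_form q y + \<alpha> (snd c p) y * lin_form l y"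
     "CARD('n) = 1 \<longrightarrow> l = (\<lambda>k. 0)"
    by (elim exE conjE)
  moreover have "\<forall>y. y \<noteq> 0 \<longrightarrow> 0 < quad_form (\<lambda>i j. g i j (snd c p)) y"
    using g_pos[OF x] by simp
  ultimately show ?thesis
    unfolding \<alpha>_def by (intro exI conjI)
qed

end

theorem theorem1p3:
  fixes M :: "'m topology"
    and A :: "('m, 'n::finite) chart set"
    and F :: "'m \<Rightarrow> (('m, 'n) chart \<Rightarrow> real^'n) \<Rightarrow> real"
  assumes "smooth_manifold M A"
    and "randers_metric A F"
  shows "reversible_PRic A F \<longleftrightarrow> square_PRic A F"
proof -
  interpret atlas M A by (unfold_locales) (rule assms(1))
  \<comment> \<open>Both properties are tested for each chart and point separately, so the claim
    concerns one function on the nonzero vectors of a coordinate space.\<close>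
  have "(\<forall>y. y \<noteq> 0 \<longrightarrow> PRic (coord_rep A c F) (snd c p) y = PRic (coord_rep A c F) (snd c p) (- y))
    \<longleftrightarrow> (\<forall>y. y \<noteq> 0 \<longrightarrow> (\<forall>i j k. pd i (pd j (pd k (PRic (coord_rep A c F) (snd c p)))) y = 0))"
    if c: "c \<in> A" "p \<in> fst c" for c p
  proof -
    from PRic_coord_rep[OF assms(2) c] obtain g q l where
      1: "\<forall>y. y \<noteq> 0 \<longrightarrow> 0 < quad_form g y" and
      2: "\<forall>y. y \<noteq> 0 \<longrightarrow> PRic (coord_rep A c F) (snd c p) y = quad_form q y + sqrt (quad_form g y) * lin_form l y" and
      3: "CARD('n) = 1 \<longrightarrow> l = (\<lambda>k. 0)"
      by (elim exE conjE)
    show ?thesis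
      by (rule even_iff_pd3_eq_0[OF mp[OF spec[OF 1]] mp[OF spec[OF 2]] mp[OF 3]])
  qed
  then show ?thesis
    unfolding reversible_PRic_iff square_PRic_def by (intro ball_cong refl)
qed

end
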